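(* Let $\mathcal{F}=\{F_t\}_{t\ge0}$ be a semigroup of holomorphic self-mappings of a domain $\mathcal{D}$ in a complex Banach space $X$ satisfying condition ( * ) with limit point $x_0$ and generator $f$, where $f'(x_0)=-\omega\,\mathrm{Id}_X$ for some $\omega\in\mathbb{C}$. Let $\{\Gamma_t\}_{t\ge0}$ be a semicocycle over $\mathcal{F}$, with values in a complex unital Banach algebra $\mathcal{A}$, generated by a holomorphic $B:\mathcal{D}\to\mathcal{A}$, and let $B_0=B(x_0)$. If $$k\omega\notin\sigma(B_0)-\sigma(B_0)=\{\lambda-\lambda':\ \lambda,\lambda'\in\sigma(B_0)\}\quad\text{for all } k\in\mathbb{N},$$ then there is a holomorphic $M:\mathcal{D}\to\mathcal{A}_*$ with $\Gamma_t(x)=M(F_t(x))^{-1}e^{tB_0}M(x)$ for all $t\ge0$, $x\in\mathcal{D}$, and such $M$ normalized by $M(x_0)=1_{\mathcal A}$ is unique.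
   Context: Condition ( * ): $F_t(x)\to x_0\in\mathcal{D}$ as $t\to\infty$ uniformly on subsets strictly inside $\mathcal{D}$ (bounded subsets at positive distance from $\partial\mathcal{D}$), and $\mathcal{F}$ is generated by a holomorphic $f:\mathcal{D}\to X$ (i.e. $f(x)=\lim_{t\to0^+}\frac1t(F_t(x)-x)$ uniformly on subsets strictly inside $\mathcal{D}$) with $\kappa_+(f'(x_0))<0$, where $\kappa_+(a)=\limsup_{t\to\infty}\frac1t\log\|e^{ta}\|$. Semigroup: holomorphic self-maps $F_t$ with $F_{t+s}=F_t\circ F_s$, $F_t(x)\to x$ as $t\to0^+$. $\mathcal{A}$ has unit $1_{\mathcal A}$, $\|1_{\mathcal A}\|=1$; $\mathcal{A}_*$ = invertible elements; $\sigma(B_0)$ is the spectrum of $B_0$ in $\mathcal{A}$. Semicocycle: holomorphic $\Gamma_t:\mathcal{D}\to\mathcal{A}$ with $\Gamma_t(F_s(x))\Gamma_s(x)=\Gamma_{t+s}(x)$, $\Gamma_t(x)\to1_{\mathcal A}$ as $t\to0^+$; generated by $B$: $t\mapsto\Gamma_t(x)$ solves $\frac{dv}{dt}=B(F_t(x))v$, $v(0)=1_{\mathcal A}$. *)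

theory Defs
  imports "HOL-Analysis.Analysis"
begin

class cnormed_vector = real_normed_vector +
  fixes cscale :: "complex \<Rightarrow> 'a \<Rightarrow> 'a"  (infixr \<open>*\<^sub>C\<close> 75)
  assumes cscale_of_real: "cscale (complex_of_real r) x = r *\<^sub>R x"
    and cscale_add_left: "cscale (a + b) x = cscale a x + cscale b x"
    and cscale_add_right: "cscale a (x + y) = cscale a x + cscale a y"
    and cscale_cscale: "cscale a (cscale b x) = cscale (a * b) x"
    and cscale_one: "cscale 1 x = x"
    and norm_cscale: "norm (cscale a x) = cmod a * norm x"

class cbanach = cnormed_vector + banach

class cbanach_algebra_1 = cbanach + real_normed_algebra_1 +
  assumes cscale_mult_left: "(cscale c a) * b = cscale c (a * b)"
    and cscale_mult_right: "a * (cscale c b) = cscale c (a * b)"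

definition clinear_bounded :: "('a::cnormed_vector \<Rightarrow> 'b::cnormed_vector) \<Rightarrow> bool" where
  "clinear_bounded L \<longleftrightarrow> bounded_linear L \<and> (\<forall>c v. L (c *\<^sub>C v) = c *\<^sub>C L v)"

definition holo_on :: "'a::cnormed_vector set \<Rightarrow> ('a \<Rightarrow> 'b::cnormed_vector) \<Rightarrow> bool" where
  "holo_on D g \<longleftrightarrow> (\<forall>x\<in>D. \<exists>L. (g has_derivative L) (at x) \<and> clinear_bounded L)"

definition invertible_el :: "'a::cbanach_algebra_1 \<Rightarrow> bool" where
  "invertible_el a \<longleftrightarrow> (\<exists>b. a * b = 1 \<and> b * a = 1)"

definition ainv :: "'a::cbanach_algebra_1 \<Rightarrow> 'a" where
  "ainv a = (THE b. a * b = 1 \<and> b * a = 1)"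

definition spec :: "'a::cbanach_algebra_1 \<Rightarrow> complex set" where
  "spec a = {z. \<not> invertible_el (z *\<^sub>C 1 - a)}"

primrec op_pow :: "('a::real_normed_vector \<Rightarrow>\<^sub>L 'a) \<Rightarrow> nat \<Rightarrow> ('a \<Rightarrow>\<^sub>L 'a)" where
  "op_pow a 0 = id_blinfun"
| "op_pow a (Suc n) = a o\<^sub>L op_pow a n"

definition op_exp :: "('a::banach \<Rightarrow>\<^sub>L 'a) \<Rightarrow> ('a \<Rightarrow>\<^sub>L 'a)" where
  "op_exp a = (\<Sum>n. (1 / fact n) *\<^sub>R op_pow a n)"

definition kappa_plus :: "('a::banach \<Rightarrow>\<^sub>L 'a) \<Rightarrow> ereal" where
  "kappa_plus a = Limsup at_top (\<lambda>t::real.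
      if norm (op_exp (t *\<^sub>R a)) = 0 then - \<infinity>
      else ereal (ln (norm (op_exp (t *\<^sub>R a))) / t))"

definition strictly_inside :: "'a::real_normed_vector set \<Rightarrow> 'a set \<Rightarrow> bool" where
  "strictly_inside S D \<longleftrightarrow> S \<subseteq> D \<and> bounded S \<and> (\<exists>r>0. \<forall>x\<in>S. ball x r \<subseteq> D)"

end

theory Submission
  imports Defs "HOL-Complex_Analysis.Complex_Analysis"
begin

text \<open>
  A map \<open>M\<close> with invertible values linearizes the semicocycle iff it is fixed by the operators
  \<open>(T\<^sub>s M)(x) = exp (- s B0) M(F\<^sub>s x) \<Gamma>\<^sub>s(x)\<close>. Since \<open>F\<^sub>s'(x0) = exp (- s \<omega>) Id\<close> is a scalar, \<open>T\<^sub>s\<close> acts on maps \<open>W\<close>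
  vanishing to order \<open>k\<close> at \<open>x0\<close>, up to order \<open>k + 1\<close>, by applying
  \<open>a \<mapsto> exp (- k s \<omega>) exp (- s B0) a exp (s B0)\<close> to the values of \<open>W\<close>; no Taylor expansion in the Banach
  space \<open>X\<close> is needed. Non-resonance makes this operator minus the identity invertible for all small
  \<open>s > 0\<close> and all \<open>k\<close> below a bound \<open>m\<close>, because the Sylvester operator \<open>a \<mapsto> (B0 + k \<omega>) a - a B0\<close> is
  invertible. Hence the constant map \<open>1\<close> can be corrected order by order to a map fixed up to order
  \<open>m\<close>, and on maps vanishing to an order \<open>m > 2 \<parallel>B0\<parallel> / Re \<omega>\<close> the iterates of \<open>T\<^sub>s\<close> decay geometrically.
  This gives existence, and the same two steps applied to a difference of fixed points give uniqueness.

  Banach-valued holomorphy is reduced to one complex variable by the Hahn-Banach theorem, applied to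
  restrictions to complex lines.
\<close>

subsection \<open>The Hahn-Banach theorem\<close>

text \<open>The equation is solved for a single time step because one step involves only
  compositions and products, which preserve holomorphy on all of \<open>D\<close>; an infinitesimal
  version would differentiate the unknown map. The step has to be small since exponentials are not
  injective: for a given \<open>s\<close> the number \<open>exp (- s (k \<omega> + z - w))\<close>
  may be 1 for spectral values \<open>z\<close>, \<open>w\<close> with
  \<open>k \<omega> + z - w\<close> nonzero. Only finitely many orders \<open>k\<close> are
  corrected, so one step serves them all. The bound on \<open>m\<close> balances two effects of a
  step \<open>s\<close>: conjugation by \<open>exp (s B0)\<close> enlarges norms by at most
  \<open>exp (2 s \<parallel>B0\<parallel>)\<close>, while vanishing to order \<open>m\<close>
  contributes \<open>exp (- m s Re \<omega>)\<close>. The special step disappears at the end: the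
  operators commute, so for a fixed point \<open>M\<close> of one of them every difference between
  \<open>M\<close> and its image under another is again fixed, vanishes at \<open>x0\<close>, and is
  0 by uniqueness. Invertibility of the values holds near \<open>x0\<close> by continuity and is
  carried back along orbits.\<close>

definition sublinear :: "('a::real_vector \<Rightarrow> real) \<Rightarrow> bool" where
  "sublinear p \<longleftrightarrow> (\<forall>x y. p (x + y) \<le> p x + p y) \<and> (\<forall>t>0. \<forall>x. p (t *\<^sub>R x) = t * p x)"

lemma sublinearD:
  assumes "sublinear p"
  shows "p (x + y) \<le> p x + p y" "t > 0 \<Longrightarrow> p (t *\<^sub>R x) = t * p x"
    "p 0 = 0" "- p (- x) \<le> p x" "t \<ge> 0 \<Longrightarrow> p (t *\<^sub>R x) = t * p x"
proof -
  show 1: "\<And>x y. p (x + y) \<le> p x + p y" and 2: "\<And>t x. t > 0 \<Longrightarrow> p (t *\<^sub>R x) = t * p x"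
    using assms unfolding sublinear_def by auto
  show 0: "p 0 = 0" using 2[of 2 0] by simp
  show "- p (- x) \<le> p x" using 1[of x "-x"] 0 by simp
  show "t \<ge> 0 \<Longrightarrow> p (t *\<^sub>R x) = t * p x"
    using 2[of t x] 0 by (cases "t = 0") auto
qed

text \<open>Linearizes a sublinear functional in the direction \<open>y\<close>; a minimal sublinear functional is
  fixed by all these operations, hence additive.\<close>
lemma sublinear_lower:
  fixes p :: "'a::real_vector \<Rightarrow> real"
  assumes p: "sublinear p"
  defines "q \<equiv> \<lambda>y x. INF t\<in>{0..}. p (x + t *\<^sub>R y) - t * p y"
  shows "sublinear (q y)" "q y x \<le> p x" "q y (- y) \<le> - p y"
    "t \<ge> 0 \<Longrightarrow> q y x \<le> p (x + t *\<^sub>R y) - t * p y"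
proof -
  note s = sublinearD[OF p]
  have bdd: "bdd_below ((\<lambda>t. p (x + t *\<^sub>R y) - t * p y) ` {0..})" for x
  proof (rule bdd_belowI[of _ "- p (- x)"])
    fix z assume "z \<in> (\<lambda>t. p (x + t *\<^sub>R y) - t * p y) ` {0..}"
    then obtain t where t: "t \<ge> 0" "z = p (x + t *\<^sub>R y) - t * p y" by auto
    have "t * p y = p (t *\<^sub>R y)" using s(5) t by simp
    also have "\<dots> \<le> p (x + t *\<^sub>R y) + p (- x)" using s(1)[of "x + t *\<^sub>R y" "- x"] by simp
    finally show "- p (- x) \<le> z" using t by simp
  qed
  have le: "q y x \<le> p (x + t *\<^sub>R y) - t * p y" if "t \<ge> 0" for t x
    unfolding q_def using that by (intro cINF_lower bdd) auto
  show "t \<ge> 0 \<Longrightarrow> q y x \<le> p (x + t *\<^sub>R y) - t * p y" by (rule le)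
  show "q y x \<le> p x" using le[of 0 x] by simp
  show "q y (- y) \<le> - p y" using le[of 1 "-y"] s(3) by simp
  have ge: "c \<le> q y x" if "\<And>t. t \<ge> 0 \<Longrightarrow> c \<le> p (x + t *\<^sub>R y) - t * p y" for c x
    unfolding q_def using that by (intro cINF_greatest) auto
  have add: "q y (u + v) \<le> q y u + q y v" for u v
  proof -
    have "q y (u + v) - (p (u + a *\<^sub>R y) - a * p y) \<le> p (v + b *\<^sub>R y) - b * p y"
      if "a \<ge> 0" "b \<ge> 0" for a b
    proof -
      have "q y (u + v) \<le> p ((u + v) + (a + b) *\<^sub>R y) - (a + b) * p y"
        using that by (intro le) auto
      also have "(u + v) + (a + b) *\<^sub>R y = (u + a *\<^sub>R y) + (v + b *\<^sub>R y)"
        by (simp add: scaleR_add_left algebra_simps)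
      finally show ?thesis using s(1)[of "u + a *\<^sub>R y" "v + b *\<^sub>R y"]
        by (simp add: algebra_simps)
    qed
    then have "q y (u + v) - (p (u + a *\<^sub>R y) - a * p y) \<le> q y v" if "a \<ge> 0" for a
      using that by (intro ge) auto
    then have "q y (u + v) - q y v \<le> p (u + a *\<^sub>R y) - a * p y" if "a \<ge> 0" for a
      using that by (smt (verit))
    then have "q y (u + v) - q y v \<le> q y u" by (rule ge)
    then show ?thesis by simp
  qed
  have hom1: "q y (r *\<^sub>R u) \<le> r * q y u" if "r > 0" for r u
  proof -
    have "q y (r *\<^sub>R u) / r \<le> q y u"
    proof (rule ge)
      fix t :: real assume "t \<ge> 0"
      then have "q y (r *\<^sub>R u) \<le> p (r *\<^sub>R u + (r * t) *\<^sub>R y) - (r * t) * p y"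
        using that by (intro le) auto
      also have "r *\<^sub>R u + (r * t) *\<^sub>R y = r *\<^sub>R (u + t *\<^sub>R y)" by (simp add: scaleR_add_right)
      also have "p \<dots> = r * p (u + t *\<^sub>R y)" using s(2) that by simp
      finally show "q y (r *\<^sub>R u) / r \<le> p (u + t *\<^sub>R y) - t * p y"
        using that by (simp add: field_simps)
    qed
    then show ?thesis using that by (simp add: field_simps)
  qed
  have hom: "q y (r *\<^sub>R u) = r * q y u" if "r > 0" for r u
    using hom1[OF that, of u] hom1[of "1 / r" "r *\<^sub>R u"] that by (simp add: field_simps)
  show "sublinear (q y)" unfolding sublinear_def using add hom by blast
qed

text \<open>Zorn's lemma for the reversed pointwise order. The infimum of a chain stays finite
  because every sublinear \<open>a\<close> below \<open>p\<close> satisfies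
  \<open>a x \<ge> - a (- x) \<ge> - p (- x)\<close>.\<close>

lemma minimal_sublinear_exists:
  fixes p :: "'a::real_vector \<Rightarrow> real"
  assumes p: "sublinear p"
  obtains m where "sublinear m" "\<And>x. m x \<le> p x"
    "\<And>r. sublinear r \<Longrightarrow> (\<And>x. r x \<le> m x) \<Longrightarrow> r = m"
proof -
  define A where "A = {r. sublinear r \<and> (\<forall>x. r x \<le> p x)}"
  define P :: "('a \<Rightarrow> real) \<Rightarrow> ('a \<Rightarrow> real) \<Rightarrow> bool" where "P = (\<lambda>u v. \<forall>x. v x \<le> u x)"
  have po: "partial_order_on A (relation_of P A)"
    unfolding partial_order_on_def preorder_on_def refl_on_def trans_def antisym_def relation_of_def P_def
    by (fastforce intro!: ext antisym intro: order_trans)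
  have "\<exists>m\<in>A. \<forall>a\<in>A. P m a \<longrightarrow> a = m"
  proof (rule predicate_Zorn[OF po])
    fix C assume C: "C \<in> Chains (relation_of P A)"
    then have CA: "C \<subseteq> A" and ch: "\<And>a b. a \<in> C \<Longrightarrow> b \<in> C \<Longrightarrow> P a b \<or> P b a"
      unfolding Chains_def relation_of_def by auto
    show "\<exists>u\<in>A. \<forall>a\<in>C. P a u"
    proof (cases "C = {}")
      case True
      have "p \<in> A" unfolding A_def using p by auto
      then show ?thesis using True by auto
    next
      case False
      define u where "u = (\<lambda>x. INF a\<in>C. a x)"
      have sub: "sublinear a" "a x \<le> p x" if "a \<in> C" for a x using that CA unfolding A_def by auto
      have bdd: "bdd_below ((\<lambda>a. a x) ` C)" for x
      proof (rule bdd_belowI[of _ "- p (- x)"])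
        fix z assume "z \<in> (\<lambda>a. a x) ` C"
        then obtain a where a: "a \<in> C" "z = a x" by auto
        show "- p (- x) \<le> z"
          using sublinearD(4)[OF sub(1)[OF a(1)], of x] sub(2)[OF a(1), of "- x"] a(2) by simp
      qed
      have le: "u x \<le> a x" if "a \<in> C" for a x
        unfolding u_def using that by (intro cINF_lower bdd) auto
      have ge: "c \<le> u x" if "\<And>a. a \<in> C \<Longrightarrow> c \<le> a x" for c x
        unfolding u_def using that False by (intro cINF_greatest) auto
      have add: "u (x + y) \<le> u x + u y" for x y
      proof -
        \<comment> \<open>Of two members of the chain one lies below both, and its own subadditivity
          links the independent choices \<open>a\<close> and \<open>b\<close>.\<close>
        have *: "u (x + y) - a x \<le> b y" if ab: "a \<in> C" "b \<in> C" for a b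
        proof -
          obtain c where c: "c \<in> C" "c x \<le> a x" "c y \<le> b y"
            using ch[OF ab] ab unfolding P_def by blast
          then show ?thesis using le[OF c(1), of "x + y"] sublinearD(1)[OF sub(1)[OF c(1)], of x y]
            by simp
        qed
        have "u (x + y) - a x \<le> u y" if "a \<in> C" for a
          using *[OF that] by (rule ge)
        then have "u (x + y) - u y \<le> a x" if "a \<in> C" for a using that by (smt (verit))
        then have "u (x + y) - u y \<le> u x" by (rule ge)
        then show ?thesis by simp
      qed
      have hom1: "u (t *\<^sub>R x) \<le> t * u x" if "t > 0" for t x
      proof -
        have "u (t *\<^sub>R x) / t \<le> u x"
        proof (rule ge)
          fix a assume a: "a \<in> C"
          have "u (t *\<^sub>R x) \<le> t * a x"
            using le[OF a, of "t *\<^sub>R x"] sublinearD(2)[OF sub(1)[OF a] that] by simp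
          then show "u (t *\<^sub>R x) / t \<le> a x" using that by (simp add: field_simps)
        qed
        then show ?thesis using that by (simp add: field_simps)
      qed
      have hom: "u (t *\<^sub>R x) = t * u x" if "t > 0" for t x
        using hom1[OF that, of x] hom1[of "1 / t" "t *\<^sub>R x"] that by (simp add: field_simps)
      have "sublinear u" unfolding sublinear_def using add hom by blast
      moreover have "u x \<le> p x" for x
        using False le sub(2) by (metis all_not_in_conv order_trans)
      ultimately have "u \<in> A" unfolding A_def by blast
      moreover have "\<forall>a\<in>C. P a u" unfolding P_def using le by blast
      ultimately show ?thesis by blast
    qed
  qed
  then obtain m where m: "m \<in> A" "\<And>a. a \<in> A \<Longrightarrow> P m a \<Longrightarrow> a = m" by blast
  show ?thesis
  proof (rule that[of m])
    show "sublinear m" "\<And>x. m x \<le> p x" using m(1) unfolding A_def by auto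
    fix r assume r: "sublinear r" "\<And>x. r x \<le> m x"
    have "r x \<le> p x" for x using r(2)[of x] m(1) order_trans unfolding A_def by blast
    then have "r \<in> A" unfolding A_def using r(1) by blast
    then show "r = m" using m(2)[of r] r(2) unfolding P_def by blast
  qed
qed

text \<open>Zorn's lemma starts from \<open>p\<close> lowered in the direction \<open>y\<close>, not
  from \<open>p\<close> itself: this majorant is at most \<open>- p y\<close> at \<open>- y\<close>,
  so every linear functional below it is forced up to the value \<open>p y\<close> at
  \<open>y\<close>.\<close>

lemma hahn_banach_sublinear:
  fixes p :: "'a::real_vector \<Rightarrow> real"
  assumes p: "sublinear p"
  obtains \<phi> where "linear \<phi>" "\<And>x. \<phi> x \<le> p x" "\<phi> y = p y"
proof -
  note lowp = sublinear_lower[OF p]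
  obtain m where m: "sublinear m"
    and mp: "\<And>x. m x \<le> (INF t\<in>{0..}. p (x + t *\<^sub>R y) - t * p y)"
    and min: "\<And>r. sublinear r \<Longrightarrow> (\<And>x. r x \<le> m x) \<Longrightarrow> r = m"
    using minimal_sublinear_exists[OF lowp(1)[of y]] by metis
  note lowm = sublinear_lower[OF m] and s = sublinearD[OF m]
  have fixm: "(\<lambda>x. INF t\<in>{0..}. m (x + t *\<^sub>R z) - t * m z) = m" for z
    by (rule min) (auto intro: lowm)
  \<comment> \<open>Invariance under lowering in the direction \<open>z\<close>, read at
    \<open>t = 1\<close>, is the missing superadditivity.\<close>
  have add: "m (x + z) = m x + m z" for x z
    using lowm(4)[where t=1 and y=z and x=x] fun_cong[OF fixm[of z], of x] s(1)[of x z] by simp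
  have neg: "m (- x) = - m x" for x using add[of x "- x"] s(3) by simp
  have hom: "m (t *\<^sub>R x) = t * m x" for t x
  proof (cases "t \<ge> 0")
    case True then show ?thesis by (rule s(5))
  next
    case False
    then have "m ((- t) *\<^sub>R x) = - t * m x" by (intro s(5)) simp
    then show ?thesis using neg[of "t *\<^sub>R x"] by simp
  qed
  have "linear m" by (rule linearI) (simp_all add: add hom)
  moreover have mp': "m x \<le> p x" for x using mp[of x] lowp(2)[where y=y and x=x] by linarith
  moreover have "m y = p y" using mp[of "- y"] lowp(3)[of y] neg[of y] mp'[of y] by linarith
  ultimately show ?thesis using that by blast
qed

lemma sublinear_infdist:
  fixes J :: "'a::real_normed_vector set"
  assumes J: "subspace J"
  shows "sublinear (\<lambda>x. infdist x J)" "infdist x J \<le> norm x" "infdist (- x) J = infdist x J"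
proof -
  have ne: "J \<noteq> {}" using subspace_0[OF J] by blast
  show "infdist x J \<le> norm x" for x
    using infdist_le[OF subspace_0[OF J], of x] by simp
  have approx: "\<exists>j\<in>J. norm (x - j) < infdist x J + e" if "e > 0" for x e
  proof -
    have "Inf (dist x ` J) < infdist x J + e" using that ne by (simp add: infdist_def)
    then obtain j where "j \<in> J" "dist x j < infdist x J + e"
      using ne by (subst (asm) cInf_less_iff) auto
    then show ?thesis by (auto simp: dist_norm)
  qed
  have le: "infdist x J \<le> norm (x - j)" if "j \<in> J" for x j
    using infdist_le[OF that, of x] by (simp add: dist_norm)
  have neg1: "infdist (- x) J \<le> infdist x J" for x
  proof (rule field_le_epsilon)
    fix e :: real assume "e > 0"
    then obtain j where j: "j \<in> J" "norm (x - j) < infdist x J + e" using approx by blast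
    have "infdist (- x) J \<le> norm (- x - - j)" using subspace_neg[OF J j(1)] by (rule le)
    also have "\<dots> = norm (x - j)" using norm_minus_cancel[of "x - j"] by (simp add: algebra_simps)
    finally show "infdist (- x) J \<le> infdist x J + e" using j by simp
  qed
  show "infdist (- x) J = infdist x J" for x using neg1[of x] neg1[of "- x"] by simp
  have add: "infdist (x + y) J \<le> infdist x J + infdist y J" for x y
  proof (rule field_le_epsilon)
    fix e :: real assume "e > 0"
    then obtain j k where j: "j \<in> J" "norm (x - j) < infdist x J + e / 2"
      and k: "k \<in> J" "norm (y - k) < infdist y J + e / 2"
      using approx[of "e / 2"] by (meson half_gt_zero)
    have "infdist (x + y) J \<le> norm ((x + y) - (j + k))" using subspace_add[OF J j(1) k(1)] by (rule le)
    also have "\<dots> \<le> norm (x - j) + norm (y - k)"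
      using norm_triangle_ineq[of "x - j" "y - k"] by (simp add: algebra_simps)
    finally show "infdist (x + y) J \<le> infdist x J + infdist y J + e" using j k by linarith
  qed
  have hom1: "infdist (t *\<^sub>R x) J \<le> t * infdist x J" if "t > 0" for t x
  proof (rule field_le_epsilon)
    fix e :: real assume "e > 0"
    then obtain j where j: "j \<in> J" "norm (x - j) < infdist x J + e / t"
      using approx[of "e / t"] \<open>t > 0\<close> by (meson divide_pos_pos)
    have "infdist (t *\<^sub>R x) J \<le> norm (t *\<^sub>R x - t *\<^sub>R j)" using subspace_scale[OF J j(1)] by (rule le)
    also have "\<dots> = t * norm (x - j)" using \<open>t > 0\<close> by (simp flip: scaleR_diff_right)
    also have "\<dots> \<le> t * (infdist x J + e / t)" using j \<open>t > 0\<close> by simp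
    also have "\<dots> = t * infdist x J + e" using \<open>t > 0\<close> by (simp add: distrib_left)
    finally show "infdist (t *\<^sub>R x) J \<le> t * infdist x J + e" .
  qed
  have "infdist (t *\<^sub>R x) J = t * infdist x J" if "t > 0" for t x
    using hom1[OF that, of x] hom1[of "1 / t" "t *\<^sub>R x"] that by (simp add: field_simps)
  then show "sublinear (\<lambda>x. infdist x J)" unfolding sublinear_def using add by blast
qed

text \<open>A functional dominated by the distance to \<open>J\<close> vanishes on \<open>J\<close>,
  and its value at \<open>y\<close> tells whether \<open>y\<close> lies in the closure of
  \<open>J\<close>. With \<open>J = {0}\<close> it norms a vector; with \<open>J\<close> the range
  of a composition operator it yields approximate inverses.\<close>

lemma hahn_banach_infdist:
  fixes J :: "'a::real_normed_vector set"
  assumes J: "subspace J"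
  obtains \<phi> where "bounded_linear \<phi>" "\<And>x. \<bar>\<phi> x\<bar> \<le> infdist x J" "\<phi> y = infdist y J"
proof -
  note sub = sublinear_infdist[OF J]
  obtain \<phi> where \<phi>: "linear \<phi>" "\<And>x. \<phi> x \<le> infdist x J" "\<phi> y = infdist y J"
    using hahn_banach_sublinear[OF sub(1), of y] by metis
  have abs: "\<bar>\<phi> x\<bar> \<le> infdist x J" for x
    using \<phi>(2)[of x] \<phi>(2)[of "- x"] linear_neg[OF \<phi>(1), of x] sub(3)[of x] by simp
  have "bounded_linear \<phi>"
  proof (rule bounded_linear_intro[of _ 1])
    show "norm (\<phi> x) \<le> norm x * 1" for x using abs[of x] sub(2)[of x] by simp
  qed (use \<phi>(1) in \<open>simp_all add: linear_add linear_scale\<close>)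
  then show ?thesis using that abs \<phi>(3) by blast
qed

subsection \<open>Complex normed spaces\<close>

lemma cscale_zero_left [simp]: "(0::complex) *\<^sub>C (x::'a::cnormed_vector) = 0"
  using norm_cscale[of 0 x] by simp

lemma cscale_zero_right [simp]: "c *\<^sub>C (0::'a::cnormed_vector) = 0"
  using norm_cscale[of c "0::'a"] by simp

lemma cscale_minus_left: "(- c) *\<^sub>C (x::'a::cnormed_vector) = - (c *\<^sub>C x)"
  using cscale_add_left[of c "- c" x] by (simp add: eq_neg_iff_add_eq_0 add.commute)

lemma cscale_minus_right: "c *\<^sub>C (- x::'a::cnormed_vector) = - (c *\<^sub>C x)"
  using cscale_add_right[of c x "- x"] by (simp add: eq_neg_iff_add_eq_0 add.commute)

lemma cscale_diff_left: "(c - d) *\<^sub>C (x::'a::cnormed_vector) = c *\<^sub>C x - d *\<^sub>C x"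
  using cscale_add_left[of c "- d" x] by (simp add: cscale_minus_left)

lemma cscale_diff_right: "c *\<^sub>C (x - y::'a::cnormed_vector) = c *\<^sub>C x - c *\<^sub>C y"
  using cscale_add_right[of c x "- y"] by (simp add: cscale_minus_right)

lemma cscale_scaleR: "c *\<^sub>C (r *\<^sub>R x::'a::cnormed_vector) = r *\<^sub>R (c *\<^sub>C x)"
  by (simp add: cscale_cscale mult.commute flip: cscale_of_real)

lemma scaleR_cscale: "(r *\<^sub>R c) *\<^sub>C (x::'a::cnormed_vector) = r *\<^sub>R (c *\<^sub>C x)"
  by (simp add: cscale_cscale scaleR_conv_of_real flip: cscale_of_real)

lemma bounded_bilinear_cscale:
  "bounded_bilinear (cscale :: complex \<Rightarrow> 'a \<Rightarrow> 'a::cnormed_vector)"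
  by (rule bounded_bilinear.intro)
     (auto simp: cscale_add_left cscale_add_right cscale_scaleR scaleR_cscale norm_cscale intro!: exI[of _ 1])

lemma clinear_bounded_cscale: "clinear_bounded (cscale c :: 'a \<Rightarrow> 'a::cnormed_vector)"
  unfolding clinear_bounded_def
  by (simp add: bounded_bilinear.bounded_linear_right[OF bounded_bilinear_cscale] cscale_cscale mult.commute)

section \<open>Complex-linear functionals\<close>

definition cfunctional :: "('a::cnormed_vector \<Rightarrow> complex) \<Rightarrow> bool" where
  "cfunctional \<psi> \<longleftrightarrow> bounded_linear \<psi> \<and> (\<forall>c v. \<psi> (c *\<^sub>C v) = c * \<psi> v)"

text \<open>The only possible complex-linear functional with real part \<open>\<phi>\<close>; it
  lets the real Hahn-Banach theorem serve complex spaces.\<close>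

definition complexify :: "('a::cnormed_vector \<Rightarrow> real) \<Rightarrow> 'a \<Rightarrow> complex" where
  "complexify \<phi> u = Complex (\<phi> u) (- \<phi> (\<i> *\<^sub>C u))"

lemma cfunctional_complexify:
  assumes "bounded_linear \<phi>"
  shows "cfunctional (complexify \<phi>)"
proof -
  interpret \<phi>: bounded_linear \<phi> by fact
  have eq: "complexify \<phi> = (\<lambda>u. complex_of_real (\<phi> u) - \<i> * complex_of_real (\<phi> (\<i> *\<^sub>C u)))"
    unfolding complexify_def by (auto simp: fun_eq_iff complex_eq_iff)
  have "bounded_linear (\<lambda>u. \<phi> (\<i> *\<^sub>C u))"
    using bounded_linear_compose[OF assms bounded_bilinear.bounded_linear_right[OF bounded_bilinear_cscale]]
    by (simp add: o_def)
  then have "bounded_linear (complexify \<phi>)" unfolding eq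
    by (intro bounded_linear_sub bounded_linear_const_mult bounded_linear_compose[OF bounded_linear_of_real] assms)
  moreover have "complexify \<phi> (c *\<^sub>C v) = c * complexify \<phi> v" for c v
  proof -
    have c: "c *\<^sub>C w = Re c *\<^sub>R w + Im c *\<^sub>R (\<i> *\<^sub>C w)" for w :: 'a
      by (subst (1) complex_eq[of c])
        (simp add: cscale_add_left cscale_of_real mult.commute[of \<i>] flip: cscale_cscale)
    have ii: "\<i> *\<^sub>C \<i> *\<^sub>C v = - v" by (simp add: cscale_cscale cscale_minus_left cscale_one)
    have "complexify \<phi> (c *\<^sub>C v) = Complex (Re c * \<phi> v + Im c * \<phi> (\<i> *\<^sub>C v)) (- (Re c * \<phi> (\<i> *\<^sub>C v) - Im c * \<phi> v))"
      unfolding complexify_def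
      by (simp add: c[of v] cscale_add_right cscale_scaleR \<phi>.add \<phi>.scaleR ii \<phi>.neg \<phi>.diff)
    then show ?thesis by (auto simp: complexify_def complex_eq_iff algebra_simps)
  qed
  ultimately show ?thesis unfolding cfunctional_def by blast
qed

text \<open>The factor 2 comes from bounding a modulus by the sum of real and imaginary part. A
  sharp constant would take a rotation argument and gain nothing here.\<close>

lemma norming_cfunctional:
  fixes x :: "'a::cnormed_vector"
  obtains \<psi> where "cfunctional \<psi>" "\<And>v. cmod (\<psi> v) \<le> 2 * norm v" "norm x \<le> cmod (\<psi> x)"
proof -
  obtain \<phi> where \<phi>: "bounded_linear \<phi>" "\<And>v::'a. \<bar>\<phi> v\<bar> \<le> infdist v {0}" "\<phi> x = infdist x {0}"
    using hahn_banach_infdist[of "{0::'a}" x] subspace_single_0 by metis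
  have b: "\<bar>\<phi> v\<bar> \<le> norm v" for v using \<phi>(2)[of v] by simp
  show ?thesis
  proof (rule that[of "complexify \<phi>"])
    show "cfunctional (complexify \<phi>)" by (rule cfunctional_complexify[OF \<phi>(1)])
    show "cmod (complexify \<phi> v) \<le> 2 * norm v" for v
      using cmod_le[of "complexify \<phi> v"] b[of v] b[of "\<i> *\<^sub>C v"]
      by (simp add: complexify_def norm_cscale)
    show "norm x \<le> cmod (complexify \<phi> x)"
      using complex_Re_le_cmod[of "complexify \<phi> x"] \<phi>(3) by (simp add: complexify_def)
  qed
qed

subsection \<open>Holomorphic maps between complex Banach spaces\<close>

lemma holo_onI:
  assumes "\<And>x. x \<in> S \<Longrightarrow> (g has_derivative L x) (at x)" "\<And>x. x \<in> S \<Longrightarrow> clinear_bounded (L x)"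
  shows "holo_on S g"
  using assms unfolding holo_on_def by blast

lemma holo_on_subset: "holo_on S g \<Longrightarrow> T \<subseteq> S \<Longrightarrow> holo_on T g"
  unfolding holo_on_def by blast

lemma holo_on_isCont: "holo_on S g \<Longrightarrow> x \<in> S \<Longrightarrow> isCont g x"
  unfolding holo_on_def by (blast intro: has_derivative_continuous)

lemma clinear_bounded_zero: "clinear_bounded (\<lambda>h. 0)"
  unfolding clinear_bounded_def by simp

lemma clinear_bounded_add:
  "clinear_bounded L \<Longrightarrow> clinear_bounded M \<Longrightarrow> clinear_bounded (\<lambda>h. L h + M h)"
  unfolding clinear_bounded_def by (simp add: bounded_linear_add cscale_add_right)

lemma clinear_bounded_compose:
  "clinear_bounded L \<Longrightarrow> clinear_bounded M \<Longrightarrow> clinear_bounded (\<lambda>h. L (M h))"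
  unfolding clinear_bounded_def using bounded_linear_compose by auto

lemma clinear_bounded_mult_left: "clinear_bounded (\<lambda>y. a * y :: 'a::cbanach_algebra_1)"
  unfolding clinear_bounded_def by (simp add: bounded_linear_mult_right cscale_mult_right)

lemma clinear_bounded_mult_right: "clinear_bounded (\<lambda>y. y * a :: 'a::cbanach_algebra_1)"
  unfolding clinear_bounded_def by (simp add: bounded_linear_mult_left cscale_mult_left)

lemma holo_on_const: "holo_on S (\<lambda>x. c)"
  unfolding holo_on_def by (blast intro: has_derivative_const clinear_bounded_zero)

lemma holo_on_add: "holo_on S f \<Longrightarrow> holo_on S g \<Longrightarrow> holo_on S (\<lambda>x. f x + g x)"
  unfolding holo_on_def by (blast intro: has_derivative_add clinear_bounded_add)

lemma holo_on_clinear: "clinear_bounded L \<Longrightarrow> holo_on S L"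
  unfolding holo_on_def clinear_bounded_def by (blast intro: bounded_linear_imp_has_derivative)

lemma holo_on_compose:
  assumes "holo_on S g" "holo_on T f" "\<And>x. x \<in> S \<Longrightarrow> g x \<in> T"
  shows "holo_on S (\<lambda>x. f (g x))"
  unfolding holo_on_def
proof
  fix x assume "x \<in> S"
  then obtain L M where "(g has_derivative L) (at x)" "clinear_bounded L"
    "(f has_derivative M) (at (g x))" "clinear_bounded M"
    using assms unfolding holo_on_def by meson
  then show "\<exists>L. ((\<lambda>x. f (g x)) has_derivative L) (at x) \<and> clinear_bounded L"
    by (blast intro: has_derivative_compose clinear_bounded_compose)
qed

lemma holo_on_clinear_compose:
  "clinear_bounded L \<Longrightarrow> holo_on S f \<Longrightarrow> holo_on S (\<lambda>x. L (f x))"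
  by (rule holo_on_compose[where T=UNIV]) (auto intro: holo_on_clinear)

lemma holo_on_cscale: "holo_on S f \<Longrightarrow> holo_on S (\<lambda>x. c *\<^sub>C f x)"
  by (rule holo_on_clinear_compose[OF clinear_bounded_cscale])

lemma holo_on_minus: "holo_on S f \<Longrightarrow> holo_on S (\<lambda>x. - f x)"
  using holo_on_cscale[of S f "-1"] by (simp add: cscale_minus_left cscale_one)

lemma holo_on_diff: "holo_on S f \<Longrightarrow> holo_on S g \<Longrightarrow> holo_on S (\<lambda>x. f x - g x)"
  using holo_on_add[OF _ holo_on_minus, of S f g] by simp

lemma holo_on_mult:
  fixes f g :: "'x::cnormed_vector \<Rightarrow> 'a::cbanach_algebra_1"
  assumes "holo_on S f" "holo_on S g"
  shows "holo_on S (\<lambda>x. f x * g x)"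
  unfolding holo_on_def
proof
  fix x assume "x \<in> S"
  then obtain L M where L: "(f has_derivative L) (at x)" "clinear_bounded L"
    and M: "(g has_derivative M) (at x)" "clinear_bounded M"
    using assms unfolding holo_on_def by meson
  have "clinear_bounded (\<lambda>h. f x * M h + L h * g x)"
    using L M by (intro clinear_bounded_add clinear_bounded_compose[OF clinear_bounded_mult_left]
        clinear_bounded_compose[OF clinear_bounded_mult_right])
  then show "\<exists>L. ((\<lambda>x. f x * g x) has_derivative L) (at x) \<and> clinear_bounded L"
    using has_derivative_mult[OF L(1) M(1)] by blast
qed

section \<open>Restriction to complex lines and Cauchy estimates\<close>

lemma line_has_derivative: "((\<lambda>z. x + z *\<^sub>C (h::'a::cnormed_vector)) has_derivative (\<lambda>d. d *\<^sub>C h)) (at z)"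
  by (auto intro!: derivative_eq_intros bounded_linear_imp_has_derivative
      bounded_bilinear.bounded_linear_left[OF bounded_bilinear_cscale])

lemma line_has_field_derivative:
  assumes g: "(g has_derivative L) (at (x + z *\<^sub>C h))" "clinear_bounded L" and \<psi>: "cfunctional \<psi>"
  shows "((\<lambda>z. \<psi> (g (x + z *\<^sub>C h))) has_field_derivative \<psi> (L h)) (at z)"
proof -
  have "((\<lambda>z. g (x + z *\<^sub>C h)) has_derivative (\<lambda>d. L (d *\<^sub>C h))) (at z)"
    by (rule has_derivative_compose[OF line_has_derivative g(1)])
  then have "((\<lambda>z. \<psi> (g (x + z *\<^sub>C h))) has_derivative (\<lambda>d. \<psi> (L (d *\<^sub>C h)))) (at z)"
    using \<psi> unfolding cfunctional_def by (auto intro: bounded_linear.has_derivative)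
  moreover have "(\<lambda>d. \<psi> (L (d *\<^sub>C h))) = (*) (\<psi> (L h))"
    using \<psi> g(2) unfolding cfunctional_def clinear_bounded_def by (auto simp: fun_eq_iff)
  ultimately show ?thesis unfolding has_field_derivative_def by simp
qed

lemma line_holomorphic:
  assumes "holo_on S g" "cfunctional \<psi>" "\<And>z. z \<in> T \<Longrightarrow> x + z *\<^sub>C h \<in> S"
  shows "(\<lambda>z. \<psi> (g (x + z *\<^sub>C h))) holomorphic_on T"
  unfolding holomorphic_on_def
proof
  fix z assume "z \<in> T"
  then obtain L where "(g has_derivative L) (at (x + z *\<^sub>C h))" "clinear_bounded L"
    using assms unfolding holo_on_def by blast
  from line_has_field_derivative[OF this assms(2)]
  show "(\<lambda>z. \<psi> (g (x + z *\<^sub>C h))) field_differentiable at z within T"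
    using field_differentiable_at_within field_differentiable_def by blast
qed

lemma line_in_ball:
  fixes h :: "'a::cnormed_vector"
  assumes "r > 0" "z \<in> ball 0 (r / norm h)"
  shows "x + z *\<^sub>C h \<in> ball x r"
  using assms by (cases "h = 0") (auto simp: dist_norm norm_cscale field_simps)

lemma ball_trans:
  assumes "v \<in> ball x s" "s + t \<le> r"
  shows "ball v t \<subseteq> ball x r"
proof
  fix w assume "w \<in> ball v t"
  then show "w \<in> ball x r" using assms dist_triangle[of x w v] by simp
qed

text \<open>The 4 is 2 from the norming functional times 2 from halving the radius, which keeps the
  closed disc inside the domain of the restriction to the line.\<close>

lemma cauchy_estimate:
  assumes g: "holo_on (ball x r) g" and r: "r > 0"
    and K: "\<And>y. y \<in> ball x r \<Longrightarrow> norm (g y) \<le> K"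
    and L: "(g has_derivative L) (at x)" "clinear_bounded L"
  shows "norm (L h) \<le> 4 * K / r * norm h"
proof (cases "h = 0")
  case True
  then show ?thesis using L(2) unfolding clinear_bounded_def by (simp add: linear_simps(3))
next
  case False
  obtain \<psi> where \<psi>: "cfunctional \<psi>" "\<And>v. cmod (\<psi> v) \<le> 2 * norm v" "norm (L h) \<le> cmod (\<psi> (L h))"
    using norming_cfunctional by metis
  define \<rho> where "\<rho> = r / norm h / 2"
  define u where "u = (\<lambda>z. \<psi> (g (x + z *\<^sub>C h)))"
  have \<rho>: "\<rho> > 0" using r False unfolding \<rho>_def by simp
  then have "\<rho> < r / norm h" unfolding \<rho>_def by simp
  then have \<rho>2: "cball 0 \<rho> \<subseteq> ball (0::complex) (r / norm h)" by auto
  have hol: "u holomorphic_on ball 0 (r / norm h)"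
    unfolding u_def by (rule line_holomorphic[OF g \<psi>(1) line_in_ball[OF r]])
  have "norm ((deriv ^^ 1) u 0) \<le> fact 1 * (2 * K) / \<rho> ^ 1"
  proof (rule Cauchy_inequality)
    show "u holomorphic_on ball 0 \<rho>"
      using hol \<rho>2 ball_subset_cball holomorphic_on_subset by blast
    show "continuous_on (cball 0 \<rho>) u"
      using hol \<rho>2 holomorphic_on_imp_continuous_on continuous_on_subset by blast
    fix z :: complex assume "norm (0 - z) = \<rho>"
    then have "x + z *\<^sub>C h \<in> ball x r"
      using \<rho>2 by (intro line_in_ball[OF r]) auto
    then show "cmod (u z) \<le> 2 * K" unfolding u_def using \<psi>(2) K
      by (meson mult_left_mono order_trans zero_le_numeral)
  qed fact
  moreover have "deriv u 0 = \<psi> (L h)"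
    unfolding u_def using L
    by (intro DERIV_imp_deriv line_has_field_derivative) (simp_all add: \<psi>(1))
  ultimately show ?thesis using \<psi>(3) unfolding \<rho>_def by (simp add: field_simps)
qed

text \<open>Every point of the smaller ball is the centre of a ball of radius \<open>r\<close> on
  which \<open>K\<close> still bounds \<open>g\<close>, so one Cauchy estimate controls all
  derivatives and the mean value inequality on a convex set applies.\<close>

lemma holo_lipschitz:
  assumes g: "holo_on (ball x (2 * r)) g" and r: "r > 0"
    and K: "\<And>y. y \<in> ball x (2 * r) \<Longrightarrow> norm (g y) \<le> K"
    and yz: "y \<in> ball x r" "z \<in> ball x r"
  shows "norm (g y - g z) \<le> 4 * K / r * norm (y - z)"
proof -
  obtain G where G: "\<And>v. v \<in> ball x (2 * r) \<Longrightarrow> (g has_derivative G v) (at v)"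
    "\<And>v. v \<in> ball x (2 * r) \<Longrightarrow> clinear_bounded (G v)"
    using g unfolding holo_on_def by metis
  have sub: "ball v r \<subseteq> ball x (2 * r)" if "v \<in> ball x r" for v
    using that by (intro ball_trans[of v x r]) auto
  have vin: "v \<in> ball x (2 * r)" if "v \<in> ball x r" for v using that r by auto
  have K0: "0 \<le> K" using order_trans[OF norm_ge_zero K[of x]] r by simp
  show ?thesis
  proof (rule differentiable_bound[of "ball x r" g G])
    fix v assume v: "v \<in> ball x r"
    show "(g has_derivative G v) (at v within ball x r)"
      using G(1)[OF vin[OF v]] has_derivative_at_withinI by blast
    have "norm (G v h) \<le> 4 * K / r * norm h" for h
      by (rule cauchy_estimate[OF holo_on_subset[OF g sub[OF v]] r _ G(1)[OF vin[OF v]] G(2)[OF vin[OF v]]])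
        (use K sub[OF v] in blast)
    then show "onorm (G v) \<le> 4 * K / r"
      using K0 r by (intro onorm_bound) auto
  qed (use yz in auto)
qed

text \<open>The Cauchy estimate for \<open>g m - g n\<close> turns uniform convergence of the maps
  into uniform operator-norm convergence of the derivatives on a ball of half the size, so the
  theorem on differentiating limits applies. Complex linearity passes to the limit
  pointwise.\<close>

lemma holo_uniform_limit:
  fixes g :: "nat \<Rightarrow> 'x::cnormed_vector \<Rightarrow> 'b::cbanach"
  assumes g: "\<And>n. holo_on (ball x r) (g n)" and lim: "uniform_limit (ball x r) g l sequentially" and r: "r > 0"
  shows "\<exists>L. (l has_derivative L) (at x) \<and> clinear_bounded L"
proof -
  obtain G where G: "\<And>n v. v \<in> ball x r \<Longrightarrow> (g n has_derivative G n v) (at v)"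
    "\<And>n v. v \<in> ball x r \<Longrightarrow> clinear_bounded (G n v)"
    using g unfolding holo_on_def by metis
  define s where "s = r / 2"
  have s: "s > 0" "\<And>v. v \<in> ball x s \<Longrightarrow> v \<in> ball x r" using r unfolding s_def by auto
  have sub: "ball v s \<subseteq> ball x r" if "v \<in> ball x s" for v
    using that by (intro ball_trans[of v x s]) (auto simp: s_def)
  have close: "\<exists>N. \<forall>m\<ge>N. \<forall>n\<ge>N. \<forall>v\<in>ball x s. \<forall>h. norm (G m v h - G n v h) \<le> e * norm h"
    if e: "e > 0" for e
  proof -
    \<comment> \<open>Differences of the maps are at most \<open>2 * d\<close> and the Cauchy
      estimate multiplies by \<open>4 / s\<close>; the 8 makes the result \<open>e\<close>.\<close>
    define d where "d = e * s / 8"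
    have d: "d > 0" unfolding d_def using e s by simp
    obtain N where N: "\<And>n v. n \<ge> N \<Longrightarrow> v \<in> ball x r \<Longrightarrow> dist (g n v) (l v) < d"
      using uniform_limitD[OF lim d] unfolding eventually_sequentially by blast
    have "norm (G m v h - G n v h) \<le> e * norm h" if mn: "m \<ge> N" "n \<ge> N" and v: "v \<in> ball x s" for m n v h
    proof -
      have "norm (G m v h - G n v h) \<le> 4 * (2 * d) / s * norm h"
      proof (rule cauchy_estimate[where g="\<lambda>v. g m v - g n v" and x=v])
        show "holo_on (ball v s) (\<lambda>v. g m v - g n v)"
          by (intro holo_on_diff holo_on_subset[OF g sub[OF v]])
        show "((\<lambda>v. g m v - g n v) has_derivative (\<lambda>h. G m v h - G n v h)) (at v)"
          using s(2)[OF v] by (intro has_derivative_diff G)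
        show "clinear_bounded (\<lambda>h. G m v h - G n v h)"
          using G(2)[OF s(2)[OF v]] unfolding clinear_bounded_def
          by (simp add: bounded_linear_sub cscale_diff_right)
        fix y assume "y \<in> ball v s"
        then have "y \<in> ball x r" using sub[OF v] by blast
        then have "dist (g m y) (l y) < d" "dist (g n y) (l y) < d" using N mn by blast+
        then show "norm (g m y - g n y) \<le> 2 * d"
          using dist_triangle2[of "g m y" "g n y" "l y"] by (simp add: dist_norm)
      qed (rule s)
      also have "4 * (2 * d) / s = e" unfolding d_def using s by simp
      finally show ?thesis .
    qed
    then show ?thesis by blast
  qed
  define G' where "G' v h = lim (\<lambda>n. G n v h)" for v h
  have conv: "(\<lambda>n. G n v h) \<longlonglongrightarrow> G' v h" if v: "v \<in> ball x s" for v h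
  proof -
    have "Cauchy (\<lambda>n. G n v h)"
    proof (rule metric_CauchyI)
      fix e :: real assume e: "e > 0"
      obtain N where N: "\<forall>m\<ge>N. \<forall>n\<ge>N. norm (G m v h - G n v h) \<le> e / (norm h + 1) * norm h"
        using close[of "e / (norm h + 1)"] e v by (metis add_nonneg_pos divide_pos_pos norm_ge_zero zero_less_one)
      have "e / (norm h + 1) * norm h < e" using e by (simp add: field_simps add_pos_nonneg)
      then show "\<exists>N. \<forall>m\<ge>N. \<forall>n\<ge>N. dist (G m v h) (G n v h) < e"
        using N unfolding dist_norm by (meson le_less_trans)
    qed
    then show ?thesis unfolding G'_def by (simp add: Cauchy_convergent convergent_LIMSEQ_iff[symmetric])
  qed
  have unif: "\<forall>\<^sub>F n in sequentially. \<forall>v\<in>ball x s. \<forall>h. norm (G n v h - G' v h) \<le> e * norm h" if "e > 0" for e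
  proof -
    obtain N where N: "\<forall>m\<ge>N. \<forall>n\<ge>N. \<forall>v\<in>ball x s. \<forall>h. norm (G m v h - G n v h) \<le> e * norm h"
      using close[OF \<open>e > 0\<close>] by blast
    have "norm (G n v h - G' v h) \<le> e * norm h" if "n \<ge> N" "v \<in> ball x s" for n v h
    proof (rule LIMSEQ_le_const2)
      show "(\<lambda>m. norm (G n v h - G m v h)) \<longlonglongrightarrow> norm (G n v h - G' v h)"
        by (intro tendsto_intros conv that)
      show "\<exists>N. \<forall>m\<ge>N. norm (G n v h - G m v h) \<le> e * norm h" using N that by blast
    qed
    then show ?thesis unfolding eventually_sequentially by blast
  qed
  have pw: "(\<lambda>n. g n v) \<longlonglongrightarrow> l v" if "v \<in> ball x s" for v
    using tendsto_uniform_limitI[OF lim] s(2)[OF that] by blast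
  have xin: "x \<in> ball x s" using s by simp
  have "\<exists>l'. \<forall>v\<in>ball x s. (\<lambda>n. g n v) \<longlonglongrightarrow> l' v \<and> (l' has_derivative G' v) (at v within ball x s)"
    by (rule has_derivative_sequence[where f'=G and S="ball x s" and g'=G'])
      (use unif xin pw[OF xin] in \<open>blast intro: has_derivative_at_withinI G s(2) convex_ball\<close>)+
  then obtain l' where l': "\<And>v. v \<in> ball x s \<Longrightarrow> (\<lambda>n. g n v) \<longlonglongrightarrow> l' v"
    "(l' has_derivative G' x) (at x within ball x s)" using xin by blast
  have eq: "l' v = l v" if "v \<in> ball x s" for v
    using LIMSEQ_unique[OF l'(1) pw] that by blast
  have "(l' has_derivative G' x) (at x)" using l'(2) at_within_open[OF xin open_ball] by simp
  then have der: "(l has_derivative G' x) (at x)"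
    using has_derivative_transform_within_open[OF _ open_ball xin] eq by blast
  have "G' x (c *\<^sub>C h) = c *\<^sub>C G' x h" for c h
  proof (rule LIMSEQ_unique)
    show "(\<lambda>n. G n x (c *\<^sub>C h)) \<longlonglongrightarrow> G' x (c *\<^sub>C h)" by (rule conv[OF xin])
    have "(\<lambda>n. c *\<^sub>C G n x h) \<longlonglongrightarrow> c *\<^sub>C G' x h"
      by (intro bounded_bilinear.tendsto[OF bounded_bilinear_cscale] tendsto_const conv[OF xin])
    then show "(\<lambda>n. G n x (c *\<^sub>C h)) \<longlonglongrightarrow> c *\<^sub>C G' x h"
      using G(2)[of x] r unfolding clinear_bounded_def by simp
  qed
  then have "clinear_bounded (G' x)"
    unfolding clinear_bounded_def using has_derivative_bounded_linear[OF der] by blast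
  then show ?thesis using der by blast
qed

text \<open>Zeros have integer order, so \<open>g = o(z ^ k)\<close> already forces the full factor
  \<open>z ^ Suc k\<close>. Each induction step divides out one zero.\<close>

lemma holomorphic_factor_power:
  fixes g :: "complex \<Rightarrow> complex"
  assumes g: "g holomorphic_on ball 0 r" and r: "r > 0"
    and lim: "((\<lambda>z. g z / z ^ k) \<longlongrightarrow> 0) (at 0)"
  shows "\<exists>q. q holomorphic_on ball 0 r \<and> (\<forall>z\<in>ball 0 r. g z = z ^ Suc k * q z)"
  using lim
proof (induction k)
  case 0
  have "isCont g 0"
    using g r by (intro field_differentiable_imp_continuous_at holomorphic_on_imp_differentiable_at[OF _ open_ball]) auto
  then have "g 0 = 0"
    using 0 LIM_unique[of g "g 0" 0 0] by (simp add: isCont_def)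
  then show ?case
    using pole_lemma_open[OF g open_ball, of 0]
    by (intro exI[of _ "\<lambda>z. if z = 0 then deriv g 0 else (g z - g 0) / (z - 0)"]) auto
next
  case (Suc k)
  have "((\<lambda>z. g z / z ^ Suc k * z) \<longlongrightarrow> 0 * 0) (at 0)"
    by (intro tendsto_mult Suc.prems tendsto_ident_at)
  then have "((\<lambda>z. g z / z ^ Suc k * z) \<longlongrightarrow> 0) (at 0)" by simp
  then have "((\<lambda>z. g z / z ^ k) \<longlongrightarrow> 0) (at 0)"
    by (rule Lim_transform_eventually) (auto simp: eventually_at_filter)
  from Suc.IH[OF this] obtain q where q: "q holomorphic_on ball 0 r" "\<forall>z\<in>ball 0 r. g z = z ^ Suc k * q z"
    by blast
  have "\<forall>\<^sub>F z in at 0. z \<in> ball (0::complex) r"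
    using r by (intro eventually_at_in_open') auto
  then have "\<forall>\<^sub>F z in at 0. g z / z ^ Suc k = q z"
    unfolding eventually_at_filter by eventually_elim (simp add: q(2))
  with Suc.prems have "(q \<longlongrightarrow> 0) (at 0)" by (rule Lim_transform_eventually)
  moreover have "isCont q 0"
    using q(1) r by (intro field_differentiable_imp_continuous_at holomorphic_on_imp_differentiable_at[OF _ open_ball]) auto
  ultimately have "q 0 = 0"
    using LIM_unique[of q "q 0" 0 0] by (simp add: isCont_def)
  then show ?case
    using pole_lemma_open[OF q(1) open_ball, of 0] q(2)
    by (intro exI[of _ "\<lambda>z. if z = 0 then deriv q 0 else (q z - q 0) / (z - 0)"]) auto
qed

text \<open>The maximum principle for the cofactor is applied at radius \<open>r / 2\<close> only.
  This costs powers of 2 but avoids a limit of radii increasing to \<open>r\<close>.\<close>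

lemma holomorphic_schwarz_power:
  fixes g :: "complex \<Rightarrow> complex"
  assumes g: "g holomorphic_on ball 0 r" and r: "r > 0"
    and K: "\<And>z. z \<in> ball 0 r \<Longrightarrow> cmod (g z) \<le> K"
    and lim: "((\<lambda>z. g z / z ^ k) \<longlongrightarrow> 0) (at 0)"
    and z: "cmod z \<le> r / 2"
  shows "cmod (g z) \<le> K * (2 * cmod z / r) ^ Suc k"
proof -
  obtain q where q: "q holomorphic_on ball 0 r" "\<And>z. z \<in> ball 0 r \<Longrightarrow> g z = z ^ Suc k * q z"
    using holomorphic_factor_power[OF g r lim] by blast
  have sub: "cball 0 (r / 2) \<subseteq> ball (0::complex) r" using r by auto
  have "cmod (q z) \<le> K / (r / 2) ^ Suc k"
  proof (rule maximum_modulus_frontier[of q "cball 0 (r / 2)"])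
    show "q holomorphic_on interior (cball 0 (r / 2))"
      using q(1) sub interior_subset holomorphic_on_subset by (metis order_trans)
    show "continuous_on (closure (cball 0 (r / 2))) q"
      using holomorphic_on_imp_continuous_on[OF holomorphic_on_subset[OF q(1) sub]] by simp
    fix w :: complex assume "w \<in> frontier (cball 0 (r / 2))"
    then have w: "cmod w = r / 2" by simp
    then have "w \<in> ball 0 r" using r by simp
    then have "cmod w ^ Suc k * cmod (q w) \<le> K"
      using K[of w] q(2)[of w] by (simp add: norm_mult norm_power)
    then show "cmod (q w) \<le> K / (r / 2) ^ Suc k"
      using r w by (simp add: field_simps)
  qed (use z in auto)
  then have "cmod z ^ Suc k * cmod (q z) \<le> cmod z ^ Suc k * (K / (r / 2) ^ Suc k)"
    by (intro mult_left_mono) auto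
  also have "\<dots> = K * (2 * cmod z / r) ^ Suc k"
    by (simp add: power_divide power_mult_distrib field_simps)
  finally show ?thesis
    using q(2)[of z] z r sub by (simp add: norm_mult norm_power)
qed

text \<open>The vanishing hypothesis speaks of each line and each functional separately. Uniformity
  over directions comes from the common bound \<open>K\<close> through the one-variable estimate;
  this is what replaces a Taylor expansion.\<close>

lemma holo_schwarz:
  assumes W: "holo_on (ball x0 r) W" and r: "r > 0"
    and K: "\<And>x. x \<in> ball x0 r \<Longrightarrow> norm (W x) \<le> K"
    and lim: "\<And>h \<psi>. cfunctional \<psi> \<Longrightarrow> ((\<lambda>z. \<psi> (W (x0 + z *\<^sub>C h)) / z ^ k) \<longlongrightarrow> 0) (at 0)"
    and x: "norm (x - x0) \<le> r / 2"
  shows "norm (W x) \<le> 2 * K * (2 * norm (x - x0) / r) ^ Suc k"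
proof (cases "x = x0")
  case True
  have "norm (W x0) = 0"
  proof (rule ccontr)
    assume n0: "norm (W x0) \<noteq> 0"
    obtain \<psi> where \<psi>: "cfunctional \<psi>" "norm (W x0) \<le> cmod (\<psi> (W x0))"
      using norming_cfunctional by metis
    \<comment> \<open>With direction 0 the restriction is constant, and multiplying the limit by
      \<open>z ^ k\<close> exposes that constant as 0.\<close>
    have "((\<lambda>z. \<psi> (W (x0 + z *\<^sub>C 0)) / z ^ k * z ^ k) \<longlongrightarrow> 0 * 0 ^ k) (at 0)"
      by (intro tendsto_mult lim \<psi>(1) tendsto_power tendsto_ident_at)
    then have "((\<lambda>z::complex. \<psi> (W x0)) \<longlongrightarrow> 0) (at 0)"
      by (rule_tac Lim_transform_eventually, simp) (auto simp: eventually_at_filter)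
    then have "\<psi> (W x0) = 0" using tendsto_const_iff[of "at (0::complex)"] by auto
    then show False using \<psi>(2) n0 by simp
  qed
  then show ?thesis using True by simp
next
  case False
  define h where "h = x - x0"
  have h: "norm h > 0" "norm h \<le> r / 2" using False x unfolding h_def by auto
  obtain \<psi> where \<psi>: "cfunctional \<psi>" "\<And>v. cmod (\<psi> v) \<le> 2 * norm v" "norm (W x) \<le> cmod (\<psi> (W x))"
    using norming_cfunctional by metis
  define g where "g = (\<lambda>z. \<psi> (W (x0 + z *\<^sub>C h)))"
  have "cmod (g 1) \<le> 2 * K * (2 * cmod 1 / (r / norm h)) ^ Suc k"
  proof (rule holomorphic_schwarz_power)
    show "g holomorphic_on ball 0 (r / norm h)"
      unfolding g_def by (rule line_holomorphic[OF W \<psi>(1) line_in_ball[OF r]])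
    show "((\<lambda>z. g z / z ^ k) \<longlongrightarrow> 0) (at 0)" unfolding g_def by (rule lim[OF \<psi>(1)])
    show "cmod 1 \<le> r / norm h / 2" using h by (simp add: field_simps)
    show "r / norm h > 0" using r h by (intro divide_pos_pos)
    show "cmod (g z) \<le> 2 * K" if "z \<in> ball 0 (r / norm h)" for z
      unfolding g_def using \<psi>(2) K[OF line_in_ball[OF r that]] by (meson mult_left_mono order_trans zero_le_numeral)
  qed
  moreover have "g 1 = \<psi> (W x)" unfolding g_def h_def by (simp add: cscale_one)
  ultimately show ?thesis using \<psi>(3) unfolding h_def by simp
qed

subsection \<open>Order of vanishing\<close>

text \<open>An order bound free of derivatives. \<open>nhds\<close> includes the point
  \<open>x0\<close> itself, so an order of at least 1 forces the value 0 there, while order 0 only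
  means local boundedness.\<close>

definition vanishes :: "'x::real_normed_vector \<Rightarrow> nat \<Rightarrow> ('x \<Rightarrow> 'b::real_normed_vector) \<Rightarrow> bool" where
  "vanishes x0 k W \<longleftrightarrow> (\<exists>C. \<forall>\<^sub>F x in nhds x0. norm (W x) \<le> C * norm (x - x0) ^ k)"

lemma vanishesI:
  assumes "\<And>x. x \<in> ball x0 r \<Longrightarrow> norm (W x) \<le> C * norm (x - x0) ^ k" "r > 0"
  shows "vanishes x0 k W"
proof -
  have "\<forall>\<^sub>F x in nhds x0. x \<in> ball x0 r" using assms(2) by (intro eventually_nhds_in_open) auto
  then show ?thesis unfolding vanishes_def using assms(1) by (blast intro: eventually_mono)
qed

lemma vanishesE:
  assumes "vanishes x0 k W" "R > 0"
  obtains C r where "C > 0" "r > 0" "r \<le> R" "\<And>x. x \<in> ball x0 r \<Longrightarrow> norm (W x) \<le> C * norm (x - x0) ^ k"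
proof -
  obtain C where "\<forall>\<^sub>F x in nhds x0. norm (W x) \<le> C * norm (x - x0) ^ k"
    using assms unfolding vanishes_def by blast
  then obtain r where r: "r > 0" "\<And>x. dist x x0 < r \<Longrightarrow> norm (W x) \<le> C * norm (x - x0) ^ k"
    unfolding eventually_nhds_metric by blast
  show ?thesis
  proof (rule that[of "max C 1" "min r R"])
    fix x assume "x \<in> ball x0 (min r R)"
    then have "norm (W x) \<le> C * norm (x - x0) ^ k" using r(2) by (simp add: dist_commute)
    also have "\<dots> \<le> max C 1 * norm (x - x0) ^ k" by (intro mult_right_mono) auto
    finally show "norm (W x) \<le> max C 1 * norm (x - x0) ^ k" .
  qed (use r assms in auto)
qed

lemma vanishes_add:
  assumes "vanishes x0 k V" "vanishes x0 k W"
  shows "vanishes x0 k (\<lambda>x. V x + W x)"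
proof -
  obtain C D where "\<forall>\<^sub>F x in nhds x0. norm (V x) \<le> C * norm (x - x0) ^ k"
    "\<forall>\<^sub>F x in nhds x0. norm (W x) \<le> D * norm (x - x0) ^ k"
    using assms unfolding vanishes_def by blast
  then have "\<forall>\<^sub>F x in nhds x0. norm (V x + W x) \<le> (C + D) * norm (x - x0) ^ k"
    by eventually_elim (auto intro: order_trans[OF norm_triangle_ineq] simp: distrib_right)
  then show ?thesis unfolding vanishes_def by blast
qed

lemma vanishes_bounded_linear:
  assumes L: "bounded_linear L" and W: "vanishes x0 k W"
  shows "vanishes x0 k (\<lambda>x. L (W x))"
proof -
  obtain B where B: "B > 0" "\<And>v. norm (L v) \<le> norm v * B" using bounded_linear.pos_bounded[OF L] by blast
  obtain C where "\<forall>\<^sub>F x in nhds x0. norm (W x) \<le> C * norm (x - x0) ^ k"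
    using W unfolding vanishes_def by blast
  then have "\<forall>\<^sub>F x in nhds x0. norm (L (W x)) \<le> (B * C) * norm (x - x0) ^ k"
  proof eventually_elim
    case (elim x)
    have "norm (L (W x)) \<le> B * norm (W x)" using B(2) by (simp add: mult.commute)
    also have "\<dots> \<le> B * (C * norm (x - x0) ^ k)" using elim B(1) by simp
    finally show ?case by (simp add: mult.assoc)
  qed
  then show ?thesis unfolding vanishes_def by blast
qed

lemma vanishes_mult:
  fixes V W :: "'x::real_normed_vector \<Rightarrow> 'a::real_normed_algebra"
  assumes "vanishes x0 j V" "vanishes x0 k W"
  shows "vanishes x0 (j + k) (\<lambda>x. V x * W x)"
proof -
  obtain C r where C: "C > 0" "r > 0" "\<And>x. x \<in> ball x0 r \<Longrightarrow> norm (V x) \<le> C * norm (x - x0) ^ j"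
    using vanishesE[OF assms(1) zero_less_one] by metis
  obtain D s where D: "D > 0" "s > 0" "s \<le> r" "\<And>x. x \<in> ball x0 s \<Longrightarrow> norm (W x) \<le> D * norm (x - x0) ^ k"
    using vanishesE[OF assms(2) C(2)] by metis
  show ?thesis
  proof (rule vanishesI[of x0 s _ "C * D"])
    fix x assume x: "x \<in> ball x0 s"
    have "norm (V x * W x) \<le> norm (V x) * norm (W x)" by (rule norm_mult_ineq)
    also have "\<dots> \<le> (C * norm (x - x0) ^ j) * (D * norm (x - x0) ^ k)"
      using x C D by (intro mult_mono) auto
    finally show "norm (V x * W x) \<le> C * D * norm (x - x0) ^ (j + k)"
      by (simp add: power_add algebra_simps)
  qed (rule D)
qed

lemma vanishes_cong:
  assumes "vanishes x0 k V" "r > 0" "\<And>x. x \<in> ball x0 r \<Longrightarrow> V x = W x"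
  shows "vanishes x0 k W"
proof -
  obtain C s where C: "C > 0" "s > 0" "s \<le> r" "\<And>x. x \<in> ball x0 s \<Longrightarrow> norm (V x) \<le> C * norm (x - x0) ^ k"
    using vanishesE[OF assms(1,2)] by metis
  show ?thesis
    by (rule vanishesI[of x0 s _ C]) (use C assms(3) in auto)
qed

lemma vanishes_0:
  assumes "isCont V x0"
  shows "vanishes x0 0 V"
proof -
  obtain d where "d > 0" "\<And>x. dist x x0 < d \<Longrightarrow> dist (V x) (V x0) < 1"
    using assms unfolding continuous_at_eps_delta by (metis zero_less_one)
  then have b: "norm (V x) \<le> norm (V x0) + 1" if "x \<in> ball x0 d" for x
    using that norm_triangle_ineq2[of "V x" "V x0"] by (fastforce simp: dist_norm norm_minus_commute)
  show ?thesis by (rule vanishesI[of x0 d _ "norm (V x0) + 1"]) (use b \<open>d > 0\<close> in auto)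
qed

text \<open>The restriction to each complex line, being \<open>o\<close> of order \<open>k\<close>,
  has a zero of integer order above \<open>k\<close>; the local bound given by continuity makes the
  estimate uniform in the direction.\<close>

lemma vanishes_Suc:
  assumes W: "holo_on (ball x0 r) W" and r: "r > 0"
    and lim: "\<And>h \<psi>. cfunctional \<psi> \<Longrightarrow> ((\<lambda>z. \<psi> (W (x0 + z *\<^sub>C h)) / z ^ k) \<longlongrightarrow> 0) (at 0)"
  shows "vanishes x0 (Suc k) W"
proof -
  have "isCont W x0" using holo_on_isCont[OF W] r by simp
  then obtain d where d: "d > 0" "\<And>x. dist x x0 < d \<Longrightarrow> dist (W x) (W x0) < 1"
    unfolding continuous_at_eps_delta by (metis zero_less_one)
  define s where "s = min d r"
  have s: "s > 0" "s \<le> r" "s \<le> d" using d r unfolding s_def by auto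
  have K: "norm (W x) \<le> norm (W x0) + 1" if "x \<in> ball x0 s" for x
  proof -
    have "dist (W x) (W x0) < 1" using d(2)[of x] that s by (simp add: dist_commute)
    then show ?thesis using norm_triangle_ineq2[of "W x" "W x0"] by (simp add: dist_norm)
  qed
  have W': "holo_on (ball x0 s) W" using W s by (auto intro: holo_on_subset)
  show ?thesis
  proof (rule vanishesI)
    fix x assume "x \<in> ball x0 (s / 2)"
    then have "norm (x - x0) \<le> s / 2" by (simp add: dist_norm norm_minus_commute)
    from holo_schwarz[OF W' s(1) K lim this]
    show "norm (W x) \<le> (2 * (norm (W x0) + 1) * (2 / s) ^ Suc k) * norm (x - x0) ^ Suc k"
      by (simp add: power_divide power_mult_distrib mult_ac)
  qed (use s in simp)
qed

lemma vanishes_1: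
  assumes W: "holo_on (ball x0 r) W" and r: "r > 0" and W0: "W x0 = 0"
  shows "vanishes x0 1 W"
proof -
  have "vanishes x0 (Suc 0) W"
  proof (rule vanishes_Suc[OF W r])
    fix h and \<psi> :: "'b \<Rightarrow> complex" assume \<psi>: "cfunctional \<psi>"
    have "((\<lambda>z. x0 + z *\<^sub>C h) \<longlongrightarrow> x0 + 0 *\<^sub>C h) (at 0)"
      using has_derivative_continuous[OF line_has_derivative[of x0 h 0]] by (simp add: isCont_def)
    then have "((\<lambda>z. W (x0 + z *\<^sub>C h)) \<longlongrightarrow> W x0) (at 0)"
      using holo_on_isCont[OF W, of x0] r by (intro isCont_tendsto_compose[of x0 W]) auto
    then have "((\<lambda>z. \<psi> (W (x0 + z *\<^sub>C h))) \<longlongrightarrow> \<psi> (W x0)) (at 0)"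
      using \<psi> unfolding cfunctional_def by (auto intro: bounded_linear.tendsto)
    moreover have "\<psi> 0 = 0" using \<psi> unfolding cfunctional_def by (simp add: linear_simps(3))
    ultimately show "((\<lambda>z. \<psi> (W (x0 + z *\<^sub>C h)) / z ^ 0) \<longlongrightarrow> 0) (at 0)" using W0 by simp
  qed
  then show ?thesis by simp
qed

lemma vanishes_2:
  assumes W: "holo_on (ball x0 r) W" and r: "r > 0" and W0: "W x0 = 0"
    and D: "(W has_derivative (\<lambda>h. 0)) (at x0)"
  shows "vanishes x0 2 W"
proof -
  have "vanishes x0 (Suc 1) W"
  proof (rule vanishes_Suc[OF W r])
    fix h and \<psi> :: "'b \<Rightarrow> complex" assume \<psi>: "cfunctional \<psi>"
    have \<psi>0: "\<psi> 0 = 0" using \<psi> unfolding cfunctional_def by (simp add: linear_simps(3))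
    have "((\<lambda>z. \<psi> (W (x0 + z *\<^sub>C h))) has_field_derivative \<psi> 0) (at 0)"
      by (rule line_has_field_derivative[OF _ clinear_bounded_zero \<psi>]) (simp add: D)
    then show "((\<lambda>z. \<psi> (W (x0 + z *\<^sub>C h)) / z ^ 1) \<longlongrightarrow> 0) (at 0)"
      using W0 \<psi>0 by (simp add: DERIV_def)
  qed
  then show ?thesis by (simp add: numeral_2_eq_2)
qed

text \<open>On a complex line \<open>W\<close>, seen through a functional, is
  \<open>z ^ k * q z\<close>, so the difference becomes
  \<open>\<mu> ^ k * z ^ k * (q (\<mu> * z) - q z)\<close> and continuity of \<open>q\<close> at 0
  gains the extra order. The homogeneous term of degree \<open>k\<close> cancels without ever being
  named.\<close>

lemma vanishes_scaling:
  assumes W: "holo_on (ball x0 r) W" and r: "r > 0" and v: "vanishes x0 k W" and l: "cmod \<mu> \<le> 1"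
  shows "vanishes x0 (Suc k) (\<lambda>x. W (x0 + \<mu> *\<^sub>C (x - x0)) - \<mu> ^ k *\<^sub>C W x)"
proof (rule vanishes_Suc[of x0 r])
  have in_ball: "x0 + \<mu> *\<^sub>C (x - x0) \<in> ball x0 r" if "x \<in> ball x0 r" for x
    using that mult_mono[OF l order_refl, of "norm (x - x0)"]
    by (simp add: dist_norm norm_cscale norm_minus_commute)
  have "((\<lambda>x. x0 + \<mu> *\<^sub>C (x - x0)) has_derivative (\<lambda>h. \<mu> *\<^sub>C h)) (at x)" for x
    using clinear_bounded_cscale[of \<mu>] unfolding clinear_bounded_def
    by (auto intro!: derivative_eq_intros bounded_linear.has_derivative[where f="cscale \<mu>"])
  then have "holo_on (ball x0 r) (\<lambda>x. x0 + \<mu> *\<^sub>C (x - x0))"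
    unfolding holo_on_def using clinear_bounded_cscale by blast
  then show "holo_on (ball x0 r) (\<lambda>x. W (x0 + \<mu> *\<^sub>C (x - x0)) - \<mu> ^ k *\<^sub>C W x)"
    by (intro holo_on_diff holo_on_cscale W holo_on_compose[OF _ W in_ball])
  fix h and \<psi> :: "'b \<Rightarrow> complex" assume \<psi>: "cfunctional \<psi>"
  define g where "g = (\<lambda>z. \<psi> (W (x0 + z *\<^sub>C h)))"
  \<comment> \<open>For \<open>h = 0\<close> the quotient would be 0, so some positive radius is
    substituted.\<close>
  define \<rho> where "\<rho> = (if h = 0 then 1 else r / norm h)"
  have \<rho>: "\<rho> > 0" unfolding \<rho>_def using r by auto
  have lin: "x0 + z *\<^sub>C h \<in> ball x0 r" if "z \<in> ball 0 \<rho>" for z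
    using that r line_in_ball[OF r, of z h x0] by (cases "h = 0") (auto simp: \<rho>_def)
  have g: "g holomorphic_on ball 0 \<rho>"
    unfolding g_def by (rule line_holomorphic[OF W \<psi> lin])
  obtain C s where C: "C > 0" "s > 0" "\<And>x. x \<in> ball x0 s \<Longrightarrow> norm (W x) \<le> C * norm (x - x0) ^ k"
    using vanishesE[OF v zero_less_one] by metis
  obtain B where B: "B > 0" "\<And>v. norm (\<psi> v) \<le> norm v * B"
    using \<psi> bounded_linear.pos_bounded unfolding cfunctional_def by blast
  have gb: "\<forall>\<^sub>F z in at 0. cmod (g z) \<le> B * C * norm h ^ k * cmod z ^ k"
  proof -
    define s' where "s' = (if h = 0 then 1 else s / norm h)"
    have "s' > 0" unfolding s'_def using C by auto
    then have "\<forall>\<^sub>F z in at 0. z \<in> ball (0::complex) s'" by (intro eventually_at_in_open') auto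
    then show ?thesis
    proof eventually_elim
      case (elim z)
      then have "x0 + z *\<^sub>C h \<in> ball x0 s"
        using C(2) line_in_ball[OF C(2), of z h x0] by (cases "h = 0") (auto simp: s'_def)
      from C(3)[OF this] have "norm (W (x0 + z *\<^sub>C h)) \<le> C * (cmod z * norm h) ^ k"
        by (simp add: norm_cscale)
      then have "B * norm (W (x0 + z *\<^sub>C h)) \<le> B * (C * (cmod z * norm h) ^ k)" using B(1) by simp
      moreover have "cmod (g z) \<le> B * norm (W (x0 + z *\<^sub>C h))"
        unfolding g_def using B(2) by (simp add: mult.commute)
      ultimately show ?case by (simp add: power_mult_distrib algebra_simps)
    qed
  qed
  have "\<exists>q. q holomorphic_on ball 0 \<rho> \<and> (\<forall>z\<in>ball 0 \<rho>. g z = z ^ k * q z)"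
  proof (cases k)
    case 0
    then show ?thesis using g by (intro exI[of _ g]) auto
  next
    case (Suc j)
    \<comment> \<open>A bound of order \<open>k = Suc j\<close> is an \<open>o\<close> of order
      \<open>j\<close>, the form in which the factorization takes its hypothesis.\<close>
    have "((\<lambda>z. g z / z ^ j) \<longlongrightarrow> 0) (at 0)"
    proof (rule Lim_null_comparison)
      show "\<forall>\<^sub>F z in at 0. norm (g z / z ^ j) \<le> B * C * norm h ^ k * cmod z"
        using gb unfolding eventually_at_filter
        by eventually_elim (auto simp: norm_divide norm_power field_simps Suc)
      have "((\<lambda>z. B * C * norm h ^ k * cmod z) \<longlongrightarrow> B * C * norm h ^ k * cmod 0) (at 0)"
        by (intro tendsto_intros)
      then show "((\<lambda>z. B * C * norm h ^ k * cmod z) \<longlongrightarrow> 0) (at 0)" by simp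
    qed
    from holomorphic_factor_power[OF g \<rho> this] show ?thesis unfolding Suc .
  qed
  then obtain q where q: "q holomorphic_on ball 0 \<rho>" "\<And>z. z \<in> ball 0 \<rho> \<Longrightarrow> g z = z ^ k * q z" by blast
  have contq: "isCont q 0"
    using q(1) \<rho> by (intro field_differentiable_imp_continuous_at holomorphic_on_imp_differentiable_at[OF _ open_ball]) auto
  have "((\<lambda>z. \<mu> * z) \<longlongrightarrow> \<mu> * 0) (at 0)" by (intro tendsto_intros)
  then have "((\<lambda>z. q (\<mu> * z)) \<longlongrightarrow> q 0) (at 0)"
    using contq by (intro isCont_tendsto_compose[of 0 q]) auto
  then have "((\<lambda>z. \<mu> ^ k * (q (\<mu> * z) - q z)) \<longlongrightarrow> \<mu> ^ k * (q 0 - q 0)) (at 0)"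
    using contq unfolding isCont_def by (intro tendsto_mult tendsto_diff tendsto_const)
  then have "((\<lambda>z. \<mu> ^ k * (q (\<mu> * z) - q z)) \<longlongrightarrow> 0) (at 0)" by simp
  then show "((\<lambda>z. \<psi> (W (x0 + \<mu> *\<^sub>C (x0 + z *\<^sub>C h - x0)) - \<mu> ^ k *\<^sub>C W (x0 + z *\<^sub>C h)) / z ^ k) \<longlongrightarrow> 0) (at 0)"
  proof (rule Lim_transform_eventually)
    have "\<forall>\<^sub>F z in at 0. z \<in> ball (0::complex) \<rho> - {0}"
      using \<rho> by (intro eventually_at_in_open) auto
    then show "\<forall>\<^sub>F z in at 0. \<mu> ^ k * (q (\<mu> * z) - q z)
       = \<psi> (W (x0 + \<mu> *\<^sub>C (x0 + z *\<^sub>C h - x0)) - \<mu> ^ k *\<^sub>C W (x0 + z *\<^sub>C h)) / z ^ k"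
    proof eventually_elim
      case (elim z)
      have "cmod (\<mu> * z) \<le> cmod z" using l mult_right_mono[OF l, of "cmod z"] by (simp add: norm_mult)
      then have lz: "\<mu> * z \<in> ball 0 \<rho>" using elim by auto
      have "\<psi> (W (x0 + \<mu> *\<^sub>C (x0 + z *\<^sub>C h - x0)) - \<mu> ^ k *\<^sub>C W (x0 + z *\<^sub>C h)) = g (\<mu> * z) - \<mu> ^ k * g z"
        using \<psi> unfolding g_def cfunctional_def by (simp add: linear_simps(2) cscale_cscale)
      also have "\<dots> = \<mu> ^ k * z ^ k * (q (\<mu> * z) - q z)"
        using q(2)[OF lz] q(2)[of z] elim by (simp add: power_mult_distrib algebra_simps)
      finally show ?case using elim by simp
    qed
  qed
qed (rule r)

text \<open>On a ball of radius comparable to \<open>n = norm (x - x0)\<close> the map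
  \<open>W\<close> has size of order \<open>n ^ k\<close>, so its Lipschitz constant there is of
  order \<open>n ^ k / n\<close>; a displacement of order \<open>n ^ 2\<close> then leaves
  \<open>n ^ Suc k\<close>.\<close>

lemma vanishes_perturb:
  assumes W: "holo_on (ball x0 r) W" and r: "r > 0" and v: "vanishes x0 k W" and l: "cmod \<mu> \<le> 1"
    and \<phi>: "vanishes x0 2 (\<lambda>x. \<phi> x - (x0 + \<mu> *\<^sub>C (x - x0)))"
  shows "vanishes x0 (Suc k) (\<lambda>x. W (\<phi> x) - W (x0 + \<mu> *\<^sub>C (x - x0)))"
proof -
  obtain C s where C: "C > 0" "s > 0" "s \<le> r" "\<And>x. x \<in> ball x0 s \<Longrightarrow> norm (W x) \<le> C * norm (x - x0) ^ k"
    using vanishesE[OF v r] by metis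
  \<comment> \<open>The Lipschitz estimate below uses the ball of radius \<open>8 * n\<close>, which
    has to stay within radius \<open>s\<close>.\<close>
  have "s / 8 > 0" using C by simp
  then obtain D t where D: "D > 0" "t > 0" "t \<le> s / 8"
    "\<And>x. x \<in> ball x0 t \<Longrightarrow> norm (\<phi> x - (x0 + \<mu> *\<^sub>C (x - x0))) \<le> D * norm (x - x0) ^ 2"
    using vanishesE[OF \<phi>] by metis
  \<comment> \<open>The cap \<open>1 / D\<close> makes the quadratic error at most \<open>n\<close>,
    so \<open>\<phi> x\<close> stays within distance \<open>2 * n\<close> of
    \<open>x0\<close>.\<close>
  define u where "u = min t (1 / D)"
  have u: "u > 0" "u \<le> t" "u \<le> 1 / D" using D unfolding u_def by auto
  show ?thesis
  proof (rule vanishesI[of x0 u _ "4 * (C * 8 ^ k) / 4 * D"])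
    fix x assume x: "x \<in> ball x0 u"
    define n where "n = norm (x - x0)"
    have n: "n < u" using x by (simp add: n_def dist_norm norm_minus_commute)
    define y where "y = x0 + \<mu> *\<^sub>C (x - x0)"
    have ny: "norm (y - x0) \<le> n"
      unfolding y_def n_def using mult_right_mono[OF l, of "norm (x - x0)"] by (simp add: norm_cscale)
    have d: "norm (\<phi> x - y) \<le> D * n ^ 2" unfolding y_def n_def using D(4)[of x] x u by simp
    show "norm (W (\<phi> x) - W y) \<le> 4 * (C * 8 ^ k) / 4 * D * norm (x - x0) ^ Suc k"
    proof (cases "n = 0")
      case True
      then have "\<phi> x = y" using d by simp
      then show ?thesis using D C by simp
    next
      case False
      then have n0: "n > 0" unfolding n_def by simp
      have "D * n \<le> D * (1 / D)" using n u D(1) by (intro mult_left_mono) auto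
      then have "D * n \<le> 1" using D(1) by simp
      then have "D * n ^ 2 \<le> n" using n0 mult_right_mono[of "D * n" 1 n] by (simp add: power2_eq_square mult.assoc)
      then have np: "norm (\<phi> x - x0) \<le> 2 * n"
        using d ny norm_triangle_ineq[of "\<phi> x - y" "y - x0"] by simp
      have "norm (W (\<phi> x) - W y) \<le> 4 * (C * (8 * n) ^ k) / (4 * n) * norm (\<phi> x - y)"
      proof (rule holo_lipschitz)
        have sub: "ball x0 (2 * (4 * n)) \<subseteq> ball x0 s" using n u D(3) by (intro subset_ball) simp
        then show "holo_on (ball x0 (2 * (4 * n))) W"
          using W C(3) subset_ball[of s r] holo_on_subset by blast
        show "\<phi> x \<in> ball x0 (4 * n)" "y \<in> ball x0 (4 * n)"
          using np ny n0 by (auto simp: dist_norm norm_minus_commute)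
        fix z assume z: "z \<in> ball x0 (2 * (4 * n))"
        then have "norm (W z) \<le> C * norm (z - x0) ^ k" using sub C(4) by blast
        also have "\<dots> \<le> C * (8 * n) ^ k"
          using z C(1) by (intro mult_left_mono power_mono) (auto simp: dist_norm norm_minus_commute)
        finally show "norm (W z) \<le> C * (8 * n) ^ k" .
      qed (use n0 in simp)
      also have "\<dots> \<le> 4 * (C * (8 * n) ^ k) / (4 * n) * (D * n ^ 2)"
        using d C n0 by (intro mult_left_mono) auto
      also have "\<dots> = 4 * (C * 8 ^ k) / 4 * D * n ^ Suc k"
        using n0 by (simp add: power_mult_distrib power2_eq_square)
      finally show ?thesis unfolding n_def .
    qed
  qed (rule u)
qed

subsection \<open>Invertible elements and resolvents\<close>

lemma invertible_elI: "a * b = 1 \<Longrightarrow> b * a = 1 \<Longrightarrow> invertible_el a"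
  unfolding invertible_el_def by blast

lemma ainv_unique:
  assumes "a * b = 1" "b * a = 1"
  shows "ainv a = b"
  unfolding ainv_def
proof (rule the_equality)
  fix c assume "a * c = 1 \<and> c * a = 1"
  then show "c = b" using assms by (metis mult.assoc mult_1_left mult_1_right)
qed (use assms in blast)

lemma ainv:
  assumes "invertible_el a"
  shows "a * ainv a = 1" "ainv a * a = 1"
  using assms ainv_unique unfolding invertible_el_def by auto

lemma invertible_el_mult:
  assumes "invertible_el a" "invertible_el b"
  shows "invertible_el (a * b)"
  by (rule invertible_elI[of _ "ainv b * ainv a"])
    (metis ainv assms mult.assoc mult_1_left mult_1_right)+

lemma invertible_el_exp: "invertible_el (exp (a::'a::cbanach_algebra_1))"
  by (rule invertible_elI[of _ "exp (- a)"]) (use exp_minus_inverse[of a] exp_minus_inverse[of "- a"] in auto)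

lemma neumann:
  fixes y :: "'a::cbanach_algebra_1"
  assumes y: "norm (1 - y) < 1"
  shows "invertible_el y" "norm (ainv y) \<le> 1 / (1 - norm (1 - y))"
proof -
  define x where "x = 1 - y"
  have x: "norm x < 1" using y unfolding x_def .
  have sum: "summable (\<lambda>n. x ^ n)" using complete_algebra_summable_geometric[OF x] .
  define s where "s = (\<Sum>n. x ^ n)"
  have tail: "(\<Sum>n. x ^ Suc n) = s - 1"
    unfolding s_def using suminf_split_head[OF sum] by simp
  have "x * s = s - 1" unfolding s_def
    using suminf_mult[OF sum, of x] tail by (simp add: s_def)
  moreover have "s * x = s - 1" unfolding s_def
    using suminf_mult2[OF sum, of x] tail by (simp add: s_def power_commutes)
  ultimately have "y * s = 1" "s * y = 1" unfolding x_def by (simp_all add: algebra_simps)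
  then show "invertible_el y" and s: "norm (ainv y) \<le> 1 / (1 - norm (1 - y))"
  proof -
    assume ys: "y * s = 1" "s * y = 1"
    show "invertible_el y" by (rule invertible_elI[OF ys])
    have pow: "norm (x ^ n) \<le> norm x ^ n" for n by (rule norm_power_ineq)
    have gsum: "summable (\<lambda>n. norm x ^ n)" using x by (intro summable_geometric) simp
    have "norm s \<le> (\<Sum>n. norm x ^ n)" unfolding s_def by (rule norm_suminf_le[OF pow gsum])
    also have "\<dots> = 1 / (1 - norm x)" using x by (intro suminf_geometric) simp
    finally show "norm (ainv y) \<le> 1 / (1 - norm (1 - y))" using ainv_unique[OF ys] unfolding x_def by simp
  qed
qed

definition resolv :: "'a::cbanach_algebra_1 \<Rightarrow> complex \<Rightarrow> 'a" where
  "resolv a z = ainv (z *\<^sub>C 1 - a)"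

lemma resolv:
  assumes "z \<notin> spec a"
  shows "(z *\<^sub>C 1 - a) * resolv a z = 1" "resolv a z * (z *\<^sub>C 1 - a) = 1"
    "a * resolv a z = z *\<^sub>C resolv a z - 1" "resolv a z * a = z *\<^sub>C resolv a z - 1"
proof -
  show 1: "(z *\<^sub>C 1 - a) * resolv a z = 1" "resolv a z * (z *\<^sub>C 1 - a) = 1"
    unfolding resolv_def using assms by (auto intro: ainv simp: spec_def)
  show "a * resolv a z = z *\<^sub>C resolv a z - 1" "resolv a z * a = z *\<^sub>C resolv a z - 1"
    using 1 by (simp_all add: left_diff_distrib right_diff_distrib cscale_mult_left cscale_mult_right algebra_simps)
qed

text \<open>\<open>z *\<^sub>C 1 - a\<close> is \<open>z0 *\<^sub>C 1 - a\<close> times an element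
  within 1/2 of the unit, whose inverse has norm at most 2. This local control gives both the
  openness of the resolvent set and the continuity of the resolvent.\<close>

lemma resolv_near:
  fixes a :: "'a::cbanach_algebra_1"
  assumes z0: "z0 \<notin> spec a" and z: "cmod (z - z0) * norm (resolv a z0) \<le> 1 / 2"
  shows "z \<notin> spec a" "norm (resolv a z) \<le> 2 * norm (resolv a z0)"
proof -
  note R = resolv[OF z0]
  define y where "y = 1 + (z - z0) *\<^sub>C resolv a z0"
  have n: "norm (1 - y) \<le> 1 / 2" using z unfolding y_def by (simp add: norm_cscale)
  then have inv: "invertible_el y" and yn: "norm (ainv y) \<le> 1 / (1 - norm (1 - y))"
    using neumann[of y] by auto
  have "1 / (1 - norm (1 - y)) \<le> 1 / (1 / 2)" using n by (intro divide_left_mono) auto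
  then have yn2: "norm (ainv y) \<le> 2" using yn by simp
  have "invertible_el (z0 *\<^sub>C 1 - a)" using z0 unfolding spec_def by simp
  moreover have fac: "z *\<^sub>C 1 - a = (z0 *\<^sub>C 1 - a) * y"
  proof -
    have "(z0 *\<^sub>C 1 - a) * y = (z0 *\<^sub>C 1 - a) + (z - z0) *\<^sub>C 1"
      unfolding y_def by (simp only: distrib_left cscale_mult_right R(1) mult_1_right)
    then show ?thesis by (simp add: cscale_diff_left)
  qed
  ultimately have invz: "invertible_el (z *\<^sub>C 1 - a)" using inv invertible_el_mult by simp
  then show "z \<notin> spec a" unfolding spec_def by simp
  have "ainv ((z0 *\<^sub>C 1 - a) * y) = ainv y * resolv a z0"
  proof (rule ainv_unique)
    show "(z0 *\<^sub>C 1 - a) * y * (ainv y * resolv a z0) = 1"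
      using R(1) ainv(1)[OF inv] by (metis mult.assoc mult_1_left)
    show "ainv y * resolv a z0 * ((z0 *\<^sub>C 1 - a) * y) = 1"
      using R(2) ainv(2)[OF inv] by (metis mult.assoc mult_1_left)
  qed
  then have "norm (resolv a z) \<le> norm (ainv y) * norm (resolv a z0)"
    unfolding resolv_def[of a z] fac by (simp add: norm_mult_ineq)
  also have "\<dots> \<le> 2 * norm (resolv a z0)" using yn2 by (intro mult_right_mono) auto
  finally show "norm (resolv a z) \<le> 2 * norm (resolv a z0)" .
qed

lemma resolv_identity:
  fixes a :: "'a::cbanach_algebra_1"
  assumes "z \<notin> spec a" "z0 \<notin> spec a"
  shows "resolv a z - resolv a z0 = (z0 - z) *\<^sub>C (resolv a z * resolv a z0)"
proof -
  have *: "u * (v - w) * t = u * (v * t) - (u * w) * t" for u v w t :: 'a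
    by (simp add: algebra_simps)
  have "resolv a z - resolv a z0 = resolv a z * ((z0 *\<^sub>C 1 - a) - (z *\<^sub>C 1 - a)) * resolv a z0"
    by (subst *) (simp only: resolv(1)[OF assms(2)] resolv(2)[OF assms(1)] mult_1_left mult_1_right)
  also have "(z0 *\<^sub>C 1 - a) - (z *\<^sub>C 1 - a) = (z0 - z) *\<^sub>C 1" by (simp add: cscale_diff_left)
  finally show ?thesis by (simp add: cscale_mult_left cscale_mult_right)
qed

lemma open_resolvent_set: "open (- spec (a::'a::cbanach_algebra_1))"
  unfolding open_dist
proof safe
  fix z0 assume z0: "z0 \<notin> spec a"
  define e where "e = 1 / (2 * (norm (resolv a z0) + 1))"
  have n: "norm (resolv a z0) + 1 > 0" by (simp add: add_nonneg_pos)
  show "\<exists>e>0. \<forall>z. dist z z0 < e \<longrightarrow> z \<in> - spec a"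
  proof (intro exI[of _ e] conjI allI impI)
    show "e > 0" unfolding e_def using n by simp
    fix z assume "dist z z0 < e"
    then have "cmod (z - z0) * norm (resolv a z0) \<le> e * (norm (resolv a z0) + 1)"
      using n by (intro mult_mono) (auto simp: dist_norm e_def)
    also have "\<dots> = 1 / 2" unfolding e_def using n by (simp add: field_simps)
    finally show "z \<in> - spec a" using resolv_near(1)[OF z0] by blast
  qed
qed

lemma isCont_resolv:
  fixes a :: "'a::cbanach_algebra_1"
  assumes z0: "z0 \<notin> spec a"
  shows "(resolv a \<longlongrightarrow> resolv a z0) (at z0)"
proof -
  have "((\<lambda>z. resolv a z - resolv a z0) \<longlongrightarrow> 0) (at z0)"
  proof (rule Lim_null_comparison)
    have "((\<lambda>z. cmod (z - z0) * norm (resolv a z0)) \<longlongrightarrow> cmod (z0 - z0) * norm (resolv a z0)) (at z0)"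
      by (intro tendsto_intros)
    then have "\<forall>\<^sub>F z in at z0. cmod (z - z0) * norm (resolv a z0) < 1 / 2"
      by (rule order_tendstoD) simp
    then show "\<forall>\<^sub>F z in at z0. norm (resolv a z - resolv a z0) \<le> cmod (z - z0) * (2 * norm (resolv a z0) * norm (resolv a z0))"
    proof eventually_elim
      case (elim z)
      note near = resolv_near[OF z0 less_imp_le[OF elim]]
      have "norm (resolv a z - resolv a z0) = cmod (z - z0) * norm (resolv a z * resolv a z0)"
        using resolv_identity[OF near(1) z0] by (simp add: norm_cscale norm_minus_commute)
      also have "\<dots> \<le> cmod (z - z0) * (2 * norm (resolv a z0) * norm (resolv a z0))"
        using near(2) by (intro mult_left_mono order_trans[OF norm_mult_ineq] mult_right_mono) auto
      finally show ?case .
    qed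
    have "((\<lambda>z. cmod (z - z0) * (2 * norm (resolv a z0) * norm (resolv a z0)))
        \<longlongrightarrow> cmod (z0 - z0) * (2 * norm (resolv a z0) * norm (resolv a z0))) (at z0)"
      by (intro tendsto_intros)
    then show "((\<lambda>z. cmod (z - z0) * (2 * norm (resolv a z0) * norm (resolv a z0))) \<longlongrightarrow> 0) (at z0)"
      by simp
  qed
  then show ?thesis by (simp add: LIM_zero_iff)
qed

lemma resolv_field_derivative:
  fixes a :: "'a::cbanach_algebra_1"
  assumes z0: "z0 \<notin> spec a" and \<psi>: "cfunctional \<psi>"
  shows "((\<lambda>z. \<psi> (resolv a z)) has_field_derivative - \<psi> (resolv a z0 * resolv a z0)) (at z0)"
  unfolding has_field_derivative_iff
proof (rule Lim_transform_eventually)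
  have b: "bounded_linear \<psi>" using \<psi> unfolding cfunctional_def by blast
  show "((\<lambda>z. - \<psi> (resolv a z * resolv a z0)) \<longlongrightarrow> - \<psi> (resolv a z0 * resolv a z0)) (at z0)"
    by (intro tendsto_minus bounded_linear.tendsto[OF b] tendsto_mult tendsto_const isCont_resolv z0)
  have "\<forall>\<^sub>F z in at z0. z \<in> - spec a - {z0}"
    using z0 by (intro eventually_at_in_open open_resolvent_set) simp
  then show "\<forall>\<^sub>F z in at z0. - \<psi> (resolv a z * resolv a z0) = (\<psi> (resolv a z) - \<psi> (resolv a z0)) / (z - z0)"
  proof eventually_elim
    case (elim z)
    have "\<psi> (resolv a z) - \<psi> (resolv a z0) = \<psi> (resolv a z - resolv a z0)"
      using b by (simp add: linear_simps)
    also have "\<dots> = (z0 - z) * \<psi> (resolv a z * resolv a z0)"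
      using resolv_identity[of z a z0] elim z0 \<psi> unfolding cfunctional_def by simp
    finally show ?case using elim by (simp add: field_simps)
  qed
qed

lemma resolv_at_infinity:
  fixes a :: "'a::cbanach_algebra_1"
  shows "\<forall>\<^sub>F z in at_infinity. z \<notin> spec a" "(resolv a \<longlongrightarrow> 0) at_infinity"
proof -
  \<comment> \<open>Beyond \<open>2 * norm a\<close> the Neumann series for
    \<open>1 - (1 / z) *\<^sub>C a\<close> has ratio at most 1/2; the extra 1 keeps \<open>z\<close>
    nonzero.\<close>
  have ev: "\<forall>\<^sub>F z in at_infinity. cmod z \<ge> 2 * norm a + 1"
    unfolding eventually_at_infinity by blast
  have main: "z \<notin> spec a \<and> norm (resolv a z) \<le> 2 * inverse (cmod z)" if z: "cmod z \<ge> 2 * norm a + 1" for z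
  proof -
    have z0: "cmod z > 0" using z norm_ge_zero[of a] by linarith
    then have z1: "z \<noteq> 0" by auto
    define y where "y = 1 - (1 / z) *\<^sub>C a"
    have "norm (1 - y) = norm a / cmod z" unfolding y_def by (simp add: norm_cscale norm_divide)
    also have "\<dots> \<le> 1 / 2" using z z0 by (simp add: field_simps)
    finally have n: "norm (1 - y) \<le> 1 / 2" .
    then have inv: "invertible_el y" and yn: "norm (ainv y) \<le> 1 / (1 - norm (1 - y))"
      using neumann[of y] by auto
    have "1 / (1 - norm (1 - y)) \<le> 1 / (1 / 2)" using n by (intro divide_left_mono) auto
    then have yn2: "norm (ainv y) \<le> 2" using yn by simp
    have fac: "z *\<^sub>C 1 - a = z *\<^sub>C y"
      unfolding y_def using z1 by (simp add: cscale_diff_right cscale_cscale cscale_one)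
    have i: "(z *\<^sub>C 1 - a) * ((1 / z) *\<^sub>C ainv y) = 1" "((1 / z) *\<^sub>C ainv y) * (z *\<^sub>C 1 - a) = 1"
      unfolding fac using z1 ainv[OF inv] by (simp_all add: cscale_mult_left cscale_mult_right cscale_cscale cscale_one)
    have "z \<notin> spec a" unfolding spec_def using invertible_elI[OF i] by simp
    moreover have "norm (resolv a z) = norm (ainv y) * inverse (cmod z)"
      unfolding resolv_def ainv_unique[OF i] by (simp add: norm_cscale norm_inverse divide_inverse)
    then have "norm (resolv a z) \<le> 2 * inverse (cmod z)"
      using yn2 by (simp add: mult_right_mono)
    ultimately show ?thesis by blast
  qed
  show "\<forall>\<^sub>F z in at_infinity. z \<notin> spec a" using ev by eventually_elim (use main in blast)
  show "(resolv a \<longlongrightarrow> 0) at_infinity"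
  proof (rule Lim_null_comparison)
    show "\<forall>\<^sub>F z in at_infinity. norm (resolv a z) \<le> 2 * inverse (cmod z)"
      using ev by eventually_elim (use main in blast)
    have "((\<lambda>z::complex. 2 * inverse (cmod z)) \<longlongrightarrow> 2 * 0) at_infinity"
      by (intro tendsto_mult tendsto_const tendsto_inverse_0_at_top filterlim_norm_at_top)
    then show "((\<lambda>z::complex. 2 * inverse (cmod z)) \<longlongrightarrow> 0) at_infinity" by simp
  qed
qed

subsection \<open>The Sylvester equation\<close>

text \<open>The form takes the same value at \<open>(resolv a z, 1)\<close> and \<open>(1, resolv b z)\<close>; since the spectra are
  disjoint, these two functions of \<open>z\<close> glue to an entire function that vanishes at infinity.\<close>
lemma intertwining_form_vanishes:
  fixes a b :: "'a::cbanach_algebra_1" and \<Phi> :: "'a \<Rightarrow> 'a \<Rightarrow> real"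
  assumes disj: "spec a \<inter> spec b = {}"
    and blin: "\<And>u. bounded_linear (\<Phi> u)" "\<And>v. bounded_linear (\<lambda>u. \<Phi> u v)"
    and bal: "\<And>c u v. \<Phi> (c *\<^sub>C u) v = \<Phi> u (c *\<^sub>C v)"
    and int: "\<And>u v. u * a = a * u \<Longrightarrow> v * b = b * v \<Longrightarrow> \<Phi> (u * a) v = \<Phi> u (b * v)"
  shows "\<Phi> 1 1 = 0"
proof -
  define \<psi>l where "\<psi>l = complexify (\<lambda>u. \<Phi> u 1)"
  define \<psi>r where "\<psi>r = complexify (\<Phi> 1)"
  have cf: "cfunctional \<psi>l" "cfunctional \<psi>r"
    unfolding \<psi>l_def \<psi>r_def by (intro cfunctional_complexify blin)+
  then have bl: "bounded_linear \<psi>l" unfolding cfunctional_def by blast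
  have glue: "\<psi>l (resolv a z) = \<psi>r (resolv b z)" if za: "z \<notin> spec a" and zb: "z \<notin> spec b" for z
  proof -
    define A where "A = resolv a z"
    define C where "C = resolv b z"
    have A: "A * a = z *\<^sub>C A - 1" "a * A = z *\<^sub>C A - 1" unfolding A_def using resolv[OF za] by auto
    have C: "C * b = z *\<^sub>C C - 1" "b * C = z *\<^sub>C C - 1" unfolding C_def using resolv[OF zb] by auto
    \<comment> \<open>Moving \<open>a\<close> out of the left argument as \<open>b\<close> into the
      right one and expanding both with the resolvent equation produces terms in \<open>z\<close>
      that cancel by balance. The free scalar is needed because the form is real: 1 and
      \<open>\<i>\<close> give the real and the imaginary part.\<close>
    have "\<Phi> (c *\<^sub>C A) 1 = \<Phi> 1 (c *\<^sub>C C)" for c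
    proof -
      have "\<Phi> (c *\<^sub>C A * a) C = \<Phi> (c *\<^sub>C A) (b * C)"
        by (rule int) (simp_all add: cscale_mult_left cscale_mult_right A C)
      then have "\<Phi> (c *\<^sub>C z *\<^sub>C A - c *\<^sub>C 1) C = \<Phi> (c *\<^sub>C A) (z *\<^sub>C C - 1)"
        by (simp add: cscale_mult_left A C cscale_diff_right)
      then have "\<Phi> (c *\<^sub>C z *\<^sub>C A) C - \<Phi> (c *\<^sub>C 1) C = \<Phi> (c *\<^sub>C A) (z *\<^sub>C C) - \<Phi> (c *\<^sub>C A) 1"
        by (simp only: linear_diff[OF bounded_linear.linear[OF blin(1)]] linear_diff[OF bounded_linear.linear[OF blin(2)]])
      then show ?thesis by (simp add: bal cscale_cscale mult.commute)
    qed
    from this[of 1] this[of \<i>] show ?thesis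
      unfolding \<psi>l_def \<psi>r_def complexify_def A_def C_def by (simp add: cscale_one)
  qed
  define G where "G = (\<lambda>z. if z \<notin> spec a then \<psi>l (resolv a z) else \<psi>r (resolv b z))"
  have "G field_differentiable at z" for z
  proof (cases "z \<in> spec a")
    case False
    have "(G has_field_derivative - \<psi>l (resolv a z * resolv a z)) (at z)"
      by (rule has_field_derivative_transform_within_open[OF resolv_field_derivative[OF False cf(1)] open_resolvent_set[of a]])
        (use False in \<open>auto simp: G_def\<close>)
    then show ?thesis unfolding field_differentiable_def by blast
  next
    case True
    then have F: "z \<notin> spec b" using disj by blast
    have "(G has_field_derivative - \<psi>r (resolv b z * resolv b z)) (at z)"
      by (rule has_field_derivative_transform_within_open[OF resolv_field_derivative[OF F cf(2)] open_resolvent_set[of b]])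
        (use F glue in \<open>auto simp: G_def\<close>)
    then show ?thesis unfolding field_differentiable_def by blast
  qed
  then have hol: "G holomorphic_on UNIV" unfolding holomorphic_on_def by simp
  have "((\<lambda>z. \<psi>l (resolv a z)) \<longlongrightarrow> \<psi>l 0) at_infinity"
    by (intro bounded_linear.tendsto[OF bl] resolv_at_infinity)
  then have "((\<lambda>z. \<psi>l (resolv a z)) \<longlongrightarrow> 0) at_infinity" using bl by (simp add: linear_simps)
  then have "(G \<longlongrightarrow> 0) at_infinity"
    by (rule Lim_transform_eventually) (use resolv_at_infinity(1)[of a] in \<open>eventually_elim, simp add: G_def\<close>)
  from Liouville_weak[OF hol this] have G0: "G z = 0" for z .
  \<comment> \<open>\<open>1 + a * resolv a z\<close> is \<open>z *\<^sub>C resolv a z\<close>,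
    which \<open>\<psi>l\<close> kills since \<open>G\<close> is 0, and it tends to 1: this reads
    off the coefficient of \<open>1 / z\<close> at infinity.\<close>
  have "\<forall>\<^sub>F z in at_infinity. \<psi>l (1 + a * resolv a z) = 0"
    using resolv_at_infinity(1)[of a]
  proof eventually_elim
    case (elim z)
    have "\<psi>l (z *\<^sub>C resolv a z) = z * \<psi>l (resolv a z)" using cf(1) unfolding cfunctional_def by blast
    then show ?case using elim G0[of z] resolv(3)[OF elim] unfolding G_def by simp
  qed
  moreover have "((\<lambda>z. \<psi>l (1 + a * resolv a z)) \<longlongrightarrow> \<psi>l (1 + a * 0)) at_infinity"
    by (intro bounded_linear.tendsto[OF bl] tendsto_intros resolv_at_infinity)
  ultimately have "((\<lambda>z::complex. 0) \<longlongrightarrow> \<psi>l (1 + a * 0)) at_infinity"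
    by (rule Lim_transform_eventually[rotated])
  then have "\<psi>l 1 = 0" using tendsto_unique[OF trivial_limit_at_infinity tendsto_const] by fastforce
  then show ?thesis unfolding \<psi>l_def complexify_def by (simp add: complex_eq_iff)
qed

text \<open>Correcting the residual again and again shrinks it by the factor \<open>\<theta>\<close>
  each time, so the corrections form an absolutely convergent series whose sum solves the equation
  exactly.\<close>

lemma surj_if_approximately_surj:
  fixes S :: "'a::banach \<Rightarrow> 'b::real_normed_vector"
  assumes S: "bounded_linear S" and \<theta>: "\<theta> < 1" "0 \<le> \<theta>"
    and ap: "\<And>y. \<exists>x. norm x \<le> C * norm y \<and> norm (S x - y) \<le> \<theta> * norm y"
  shows "\<exists>x. S x = y"
proof -
  obtain h where h: "\<And>y. norm (h y) \<le> C * norm y" "\<And>y. norm (S (h y) - y) \<le> \<theta> * norm y"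
    using ap by metis
  define Y where "Y n = ((\<lambda>y. y - S (h y)) ^^ n) y" for n
  have Y: "Y 0 = y" "Y (Suc n) = Y n - S (h (Y n))" for n unfolding Y_def by simp_all
  have Yn: "norm (Y n) \<le> \<theta> ^ n * norm y" for n
  proof (induction n)
    case (Suc n)
    have "norm (Y (Suc n)) \<le> \<theta> * norm (Y n)" using h(2)[of "Y n"] by (simp add: Y norm_minus_commute)
    also have "\<dots> \<le> \<theta> * (\<theta> ^ n * norm y)" using Suc \<theta> by (intro mult_left_mono)
    finally show ?case by simp
  qed (simp add: Y)
  have C0: "norm (h (Y n)) \<le> \<bar>C\<bar> * norm y * \<theta> ^ n" for n
  proof -
    have "norm (h (Y n)) \<le> C * norm (Y n)" by (rule h)
    also have "\<dots> \<le> \<bar>C\<bar> * norm (Y n)" by (intro mult_right_mono) auto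
    also have "\<dots> \<le> \<bar>C\<bar> * (\<theta> ^ n * norm y)" by (intro mult_left_mono Yn) auto
    finally show ?thesis by (simp add: mult_ac)
  qed
  have "summable (\<lambda>n. \<bar>C\<bar> * norm y * \<theta> ^ n)" using \<theta> by (intro summable_mult summable_geometric) simp
  then have sum: "summable (\<lambda>n. h (Y n))"
    by (rule summable_comparison_test'[where N=0]) (use C0 in auto)
  have "Y \<longlonglongrightarrow> 0"
  proof (rule Lim_null_comparison)
    have "(\<lambda>n. \<theta> ^ n * norm y) \<longlonglongrightarrow> 0 * norm y"
      using \<theta> by (intro tendsto_mult LIMSEQ_realpow_zero tendsto_const) auto
    then show "(\<lambda>n. \<theta> ^ n * norm y) \<longlonglongrightarrow> 0" by simp
  qed (use Yn in auto)
  then have "(\<lambda>n. Y n - Y (Suc n)) sums (Y 0 - 0)" by (rule telescope_sums')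
  then have "(\<lambda>n. S (h (Y n))) sums y" by (simp add: Y)
  moreover have "(\<lambda>n. S (h (Y n))) sums S (\<Sum>n. h (Y n))"
    using bounded_linear.sums[OF S summable_sums[OF sum]] .
  ultimately show ?thesis using sums_unique2 by blast
qed

text \<open>Invertibility with a bounded inverse, expressed through a lower bound so that the open
  mapping theorem is avoided and perturbations can be treated with explicit constants.\<close>

definition bounded_iso :: "('a::real_normed_vector \<Rightarrow> 'b::real_normed_vector) \<Rightarrow> bool" where
  "bounded_iso S \<longleftrightarrow> bounded_linear S \<and> surj S \<and> (\<exists>C. \<forall>x. norm x \<le> C * norm (S x))"

text \<open>A preimage under \<open>T\<close> solves the equation for \<open>S\<close> with relative
  error \<open>\<eta> * C\<close>, which is below 1, so approximate surjectivity suffices. The lower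
  bound only loses the factor \<open>1 - \<eta> * C\<close>.\<close>

lemma bounded_iso_perturb:
  fixes T :: "'a::banach \<Rightarrow> 'b::real_normed_vector"
  assumes T: "bounded_linear T" "surj T" "\<And>x. norm x \<le> C * norm (T x)"
    and S: "bounded_linear S" "\<And>x. norm (S x - T x) \<le> \<eta> * norm x"
    and C: "C \<ge> 0" "\<eta> \<ge> 0" and \<eta>: "\<eta> * C < 1"
  shows "bounded_iso S"
  unfolding bounded_iso_def
proof (intro conjI)
  show "surj S" unfolding surj_def
  proof
    fix y
    have "\<exists>x. S x = y"
    proof (rule surj_if_approximately_surj[OF S(1) \<eta>])
      show "0 \<le> \<eta> * C" using C by simp
      fix y
      obtain x where x: "T x = y" using T(2) by (metis surjD)
      have "norm (S x - y) \<le> \<eta> * norm x" using S(2)[of x] x by simp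
      also have "\<dots> \<le> \<eta> * (C * norm y)" using T(3)[of x] x C by (intro mult_left_mono) auto
      finally show "\<exists>x. norm x \<le> C * norm y \<and> norm (S x - y) \<le> \<eta> * C * norm y"
        using T(3)[of x] x by (auto simp: mult.assoc)
    qed
    then show "\<exists>x. y = S x" by blast
  qed
  have "norm x \<le> C / (1 - \<eta> * C) * norm (S x)" for x
  proof -
    have "norm (T x) \<le> norm (S x) + \<eta> * norm x"
      using S(2)[of x] norm_triangle_ineq2[of "T x" "S x"] by (simp add: norm_minus_commute)
    then have "C * norm (T x) \<le> C * (norm (S x) + \<eta> * norm x)" using C by (intro mult_left_mono)
    then have "norm x * (1 - \<eta> * C) \<le> C * norm (S x)" using T(3)[of x] by (simp add: algebra_simps)
    then show ?thesis using \<eta> by (simp add: field_simps)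
  qed
  then show "\<exists>C. \<forall>x. norm x \<le> C * norm (S x)" by blast
qed (rule S)

lemma bounded_iso_inverse:
  assumes S: "bounded_iso S" "clinear_bounded S"
  obtains R where "clinear_bounded R" "\<And>y. S (R y) = y" "\<And>x. R (S x) = x"
proof -
  obtain C where C: "\<And>x. norm x \<le> C * norm (S x)" and sur: "surj S" and bl: "bounded_linear S"
    using S(1) unfolding bounded_iso_def by blast
  interpret S: bounded_linear S by fact
  have cl: "S (c *\<^sub>C x) = c *\<^sub>C S x" for c x using S(2) unfolding clinear_bounded_def by blast
  have inj: "x = y" if "S x = S y" for x y
    using C[of "x - y"] that by (simp add: S.diff)
  define R where "R = inv S"
  have SR: "S (R y) = y" for y unfolding R_def using sur by (rule surj_f_inv_f)
  have RS: "R (S x) = x" for x using inj SR by blast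
  have "clinear_bounded R" unfolding clinear_bounded_def
  proof (intro conjI allI)
    show "bounded_linear R"
    proof (rule bounded_linear_intro[of _ C])
      show "R (x + y) = R x + R y" for x y by (rule inj) (simp add: SR S.add)
      show "R (r *\<^sub>R x) = r *\<^sub>R R x" for r x by (rule inj) (simp add: SR S.scaleR)
      show "norm (R y) \<le> norm y * C" for y using C[of "R y"] by (simp add: SR mult.commute)
    qed
    show "R (c *\<^sub>C v) = c *\<^sub>C R v" for c v by (rule inj) (simp add: SR cl)
  qed
  then show ?thesis using that SR RS by blast
qed

text \<open>Rosenblum's theorem without contour integrals. A functional that kills all
  \<open>T o\<^sub>L c\<close>, or all \<open>c o\<^sub>L T\<close>, yields a form on pairs
  \<open>(u, v)\<close> through \<open>x \<mapsto> u * x * v\<close> to which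
  \<open>intertwining_form_vanishes\<close> applies, so it kills the identity. Hence the identity is
  approximated by both families: the first gives surjectivity, the second the lower bound. Bounded
  operators form only a real space here, which is why that form is real and carries a balance
  condition.\<close>

lemma sylvester_bounded_iso:
  fixes a b :: "'a::cbanach_algebra_1"
  assumes disj: "spec a \<inter> spec b = {}"
  shows "bounded_iso (\<lambda>x. a * x - x * b)"
proof -
  define LR where "LR u v = blinfun_mult_right u o\<^sub>L blinfun_mult_left v" for u v :: 'a
  have LR: "blinfun_apply (LR u v) x = u * x * v" for u v x
    unfolding LR_def by (simp add: mult.assoc)
  have LRbl: "bounded_linear (LR u)" "bounded_linear (\<lambda>u. LR u v)" for u v
    unfolding LR_def
    by (intro bounded_linear_compose[OF bounded_bilinear.bounded_linear_right[OF bounded_bilinear_blinfun_compose]]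
        bounded_linear_compose[OF bounded_bilinear.bounded_linear_left[OF bounded_bilinear_blinfun_compose]]
        bounded_linear_blinfun_mult_left bounded_linear_blinfun_mult_right)+
  define T where "T = LR a 1 - LR 1 b"
  have T: "blinfun_apply T x = a * x - x * b" for x
    unfolding T_def by (simp add: blinfun.diff_left LR)
  have dist0: "infdist id_blinfun J = 0"
    if J: "subspace J" and JT: "\<And>u v. u * a = a * u \<Longrightarrow> v * b = b * v \<Longrightarrow> LR (u * a) v - LR u (b * v) \<in> J" for J
  proof -
    obtain \<phi> where \<phi>: "bounded_linear \<phi>" "\<And>c. \<bar>\<phi> c\<bar> \<le> infdist c J" "\<phi> id_blinfun = infdist id_blinfun J"
      using hahn_banach_infdist[OF J] by blast
    have "\<phi> (LR 1 1) = 0"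
    proof (rule intertwining_form_vanishes[where \<Phi>="\<lambda>u v. \<phi> (LR u v)", OF disj])
      show "bounded_linear (\<lambda>v. \<phi> (LR u v))" for u by (intro bounded_linear_compose[OF \<phi>(1)] LRbl)
      show "bounded_linear (\<lambda>u. \<phi> (LR u v))" for v by (intro bounded_linear_compose[OF \<phi>(1)] LRbl)
      have "LR (c *\<^sub>C u) v = LR u (c *\<^sub>C v)" for c u v
        by (rule blinfun_eqI) (simp add: LR cscale_mult_left cscale_mult_right)
      then show "\<phi> (LR (c *\<^sub>C u) v) = \<phi> (LR u (c *\<^sub>C v))" for c u v by simp
      fix u v assume uv: "u * a = a * u" "v * b = b * v"
      have "\<bar>\<phi> (LR (u * a) v - LR u (b * v))\<bar> \<le> 0"
        using \<phi>(2)[of "LR (u * a) v - LR u (b * v)"] JT[OF uv] by simp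
      then show "\<phi> (LR (u * a) v) = \<phi> (LR u (b * v))" using \<phi>(1) by (simp add: linear_simps)
    qed
    moreover have "LR 1 1 = id_blinfun" by (rule blinfun_eqI) (simp add: LR)
    ultimately show ?thesis using \<phi>(3) by simp
  qed
  have approx: "\<exists>j\<in>J. norm (id_blinfun - j) < 1 / 2" if J: "J \<noteq> {}" "infdist id_blinfun J = 0" for J :: "('a \<Rightarrow>\<^sub>L 'a) set"
  proof -
    have "Inf (dist id_blinfun ` J) < 1 / 2" using J by (simp add: infdist_def)
    then obtain j where "j \<in> J" "dist id_blinfun j < 1 / 2"
      using cInf_lessD[of "dist id_blinfun ` J"] J(1) by blast
    then show ?thesis by (auto simp: dist_norm)
  qed
  have right: "\<exists>c. norm (id_blinfun - (T o\<^sub>L c)) < 1 / 2"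
  proof -
    have "subspace (range ((o\<^sub>L) T))"
      by (rule linear_subspace_image[OF bounded_linear.linear[OF
            bounded_bilinear.bounded_linear_right[OF bounded_bilinear_blinfun_compose]] subspace_UNIV])
    moreover have "LR (u * a) v - LR u (b * v) \<in> range ((o\<^sub>L) T)" if "u * a = a * u" "v * b = b * v" for u v
    proof
      \<comment> \<open>Commutation moves \<open>a\<close> and \<open>b\<close> to the outside,
        where \<open>T\<close> acts last. In the other order of composition they already stand next
        to \<open>x\<close>.\<close>
      show "LR (u * a) v - LR u (b * v) = T o\<^sub>L LR u v"
      proof (rule blinfun_eqI)
        fix x
        have "u * x * (b * v) = u * x * v * b" using that by (simp add: mult.assoc)
        moreover have "u * a * x * v = a * (u * x * v)" using that by (simp add: mult.assoc)
        ultimately show "blinfun_apply (LR (u * a) v - LR u (b * v)) x = blinfun_apply (T o\<^sub>L LR u v) x"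
          by (simp add: LR T blinfun.diff_left)
      qed
    qed simp
    ultimately have "infdist id_blinfun (range ((o\<^sub>L) T)) = 0" by (rule dist0)
    from approx[OF _ this] show ?thesis by auto
  qed
  have left: "\<exists>c. norm (id_blinfun - (c o\<^sub>L T)) < 1 / 2"
  proof -
    have "subspace (range (\<lambda>c. c o\<^sub>L T))"
      by (rule linear_subspace_image[OF bounded_linear.linear[OF
            bounded_bilinear.bounded_linear_left[OF bounded_bilinear_blinfun_compose]] subspace_UNIV])
    moreover have "LR (u * a) v - LR u (b * v) \<in> range (\<lambda>c. c o\<^sub>L T)" if "u * a = a * u" "v * b = b * v" for u v
    proof
      show "LR (u * a) v - LR u (b * v) = LR u v o\<^sub>L T"
        by (rule blinfun_eqI) (simp add: LR T blinfun.diff_left algebra_simps)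
    qed simp
    ultimately have "infdist id_blinfun (range (\<lambda>c. c o\<^sub>L T)) = 0" by (rule dist0)
    from approx[OF _ this] show ?thesis by auto
  qed
  have "bounded_iso (blinfun_apply T)"
    unfolding bounded_iso_def
  proof (intro conjI)
    obtain c where c: "norm (id_blinfun - (T o\<^sub>L c)) < 1 / 2" using right by blast
    show "surj (blinfun_apply T)" unfolding surj_def
    proof
      fix y
      have "\<exists>x. blinfun_apply T x = y"
      proof (rule surj_if_approximately_surj[OF blinfun.bounded_linear_right, of "1 / 2"])
        fix y
        have "norm (blinfun_apply (id_blinfun - (T o\<^sub>L c)) y) \<le> norm (id_blinfun - (T o\<^sub>L c)) * norm y"
          by (rule norm_blinfun)
        also have "\<dots> \<le> 1 / 2 * norm y" using c by (intro mult_right_mono) auto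
        finally have "norm (blinfun_apply T (blinfun_apply c y) - y) \<le> 1 / 2 * norm y"
          by (simp add: blinfun.diff_left norm_minus_commute)
        then show "\<exists>x. norm x \<le> norm c * norm y \<and> norm (blinfun_apply T x - y) \<le> 1 / 2 * norm y"
          using norm_blinfun[of c y] by blast
      qed simp_all
      then show "\<exists>x. y = blinfun_apply T x" by blast
    qed
    obtain d where d: "norm (id_blinfun - (d o\<^sub>L T)) < 1 / 2" using left by blast
    have "norm x \<le> 2 * norm d * norm (blinfun_apply T x)" for x
    proof -
      have "norm (blinfun_apply (id_blinfun - (d o\<^sub>L T)) x) \<le> norm (id_blinfun - (d o\<^sub>L T)) * norm x"
        by (rule norm_blinfun)
      also have "\<dots> \<le> 1 / 2 * norm x" using d by (intro mult_right_mono) auto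
      finally have "norm (x - blinfun_apply d (blinfun_apply T x)) \<le> 1 / 2 * norm x"
        by (simp add: blinfun.diff_left)
      then have "norm x \<le> 2 * norm (blinfun_apply d (blinfun_apply T x))"
        using norm_triangle_ineq2[of x "blinfun_apply d (blinfun_apply T x)"] by simp
      also have "\<dots> \<le> 2 * (norm d * norm (blinfun_apply T x))" using norm_blinfun by (intro mult_left_mono) auto
      finally show ?thesis by simp
    qed
    then show "\<exists>C. \<forall>x. norm x \<le> C * norm (blinfun_apply T x)" by blast
  qed (rule blinfun.bounded_linear_right)
  then show ?thesis by (simp add: T[abs_def])
qed

section \<open>The homological operator for small time steps\<close>

lemma right_difference_quotient:
  fixes q :: "real \<Rightarrow> 'a::real_normed_vector"
  assumes "(q has_vector_derivative d) (at 0 within {0<..})"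
  shows "((\<lambda>t. (1 / t) *\<^sub>R (q t - q 0)) \<longlongrightarrow> d) (at_right 0)"
proof -
  have "((\<lambda>t. (1 / norm (t - 0)) *\<^sub>R (q t - (q 0 + (t - 0) *\<^sub>R d))) \<longlongrightarrow> 0) (at_right 0)"
    using assms unfolding has_vector_derivative_def has_derivative_within by blast
  moreover have "\<forall>\<^sub>F t::real in at_right 0. t > 0" by (simp add: eventually_at_right_less)
  then have "\<forall>\<^sub>F t in at_right 0. (1 / norm (t - 0)) *\<^sub>R (q t - (q 0 + (t - 0) *\<^sub>R d)) = (1 / t) *\<^sub>R (q t - q 0) - d"
    by eventually_elim (simp add: scaleR_diff_right scaleR_add_right)
  ultimately have "((\<lambda>t. (1 / t) *\<^sub>R (q t - q 0) - d) \<longlongrightarrow> 0) (at_right 0)"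
    by (rule Lim_transform_eventually)
  then show ?thesis by (simp add: LIM_zero_iff)
qed

text \<open>The operator that linearizes the cocycle equation at time \<open>t\<close> on maps vanishing to order \<open>k\<close>.\<close>
definition homological :: "complex \<Rightarrow> 'a::cbanach_algebra_1 \<Rightarrow> real \<Rightarrow> nat \<Rightarrow> 'a \<Rightarrow> 'a" where
  "homological \<omega> b t k x = x - exp (- (of_real t * \<omega>)) ^ k *\<^sub>C (exp (- (t *\<^sub>R b)) * x * exp (t *\<^sub>R b))"

lemma clinear_bounded_homological: "clinear_bounded (homological \<omega> b t k)"
proof -
  have "clinear_bounded (\<lambda>x::'a. x)" unfolding clinear_bounded_def by (simp add: bounded_linear_ident)
  moreover have "clinear_bounded (\<lambda>x. (- (exp (- (of_real t * \<omega>)) ^ k)) *\<^sub>C (exp (- (t *\<^sub>R b)) * x * exp (t *\<^sub>R b)))"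
    by (intro clinear_bounded_compose[OF clinear_bounded_cscale] clinear_bounded_compose[OF clinear_bounded_mult_left clinear_bounded_mult_right]
        clinear_bounded_compose[OF clinear_bounded_mult_right clinear_bounded_mult_left])
  ultimately show ?thesis
    using clinear_bounded_add by (fastforce simp: homological_def[abs_def] cscale_minus_left)
qed

text \<open>As \<open>t\<close> tends to \<open>0\<close>, the operator divided by \<open>t\<close> tends to the Sylvester operator
  \<open>x \<mapsto> (b + k \<omega>) x - x b\<close>.\<close>
lemma homological_bounded_iso:
  fixes b :: "'a::cbanach_algebra_1"
  assumes nonres: "of_nat k * \<omega> \<notin> {z - w | z w. z \<in> spec b \<and> w \<in> spec b}"
  shows "\<forall>\<^sub>F t in at_right 0. bounded_iso (homological \<omega> b t k)"
proof -
  \<comment> \<open>Adding the scalar shifts the spectrum by \<open>k \<omega>\<close>, so a common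
    spectral value of \<open>a\<close> and \<open>b\<close> would be a resonance.\<close>
  define a where "a = b + (of_nat k * \<omega>) *\<^sub>C 1"
  have "spec a \<inter> spec b = {}"
  proof (rule ccontr)
    assume "spec a \<inter> spec b \<noteq> {}"
    then obtain z where z: "z \<in> spec a" "z \<in> spec b" by blast
    have "(z - of_nat k * \<omega>) *\<^sub>C 1 - b = z *\<^sub>C 1 - a" unfolding a_def by (simp add: cscale_diff_left)
    then have "z - of_nat k * \<omega> \<in> spec b" using z(1) unfolding spec_def by simp
    then show False using z(2) nonres by force
  qed
  from sylvester_bounded_iso[OF this]
  obtain C where T: "bounded_linear (\<lambda>x. a * x - x * b)" "surj (\<lambda>x. a * x - x * b)"
    and C: "\<And>x. norm x \<le> C * norm (a * x - x * b)"
    unfolding bounded_iso_def by blast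
  have "norm (1::'a) \<le> C * norm (a * 1 - 1 * b)" by (rule C)
  then have C0: "C > 0" by (smt (verit) mult_nonpos_nonneg norm_ge_zero norm_one)
  define p where "p t = exp (- (of_real t * \<omega>)) ^ k *\<^sub>C exp (- (t *\<^sub>R b))" for t
  define q where "q t = exp (t *\<^sub>R b)" for t
  have dq: "(q has_vector_derivative b) (at 0 within {0<..})"
    using exp_scaleR_has_vector_derivative_right[of b 0 "{0<..}"] unfolding q_def by simp
  have dexp: "((\<lambda>t. exp (- (of_real t * \<omega>)) ^ k) has_vector_derivative - (of_nat k * \<omega>)) (at 0 within {0<..})"
  proof -
    have "((\<lambda>z. exp (- (z * \<omega>)) ^ k) has_field_derivative - (of_nat k * \<omega>)) (at (of_real 0))"
      by (auto intro!: derivative_eq_intros)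
    from has_vector_derivative_real_field[OF this, of "{0<..}"] show ?thesis .
  qed
  have de: "((\<lambda>t. exp (- (t *\<^sub>R b))) has_vector_derivative - b) (at 0 within {0<..})"
    using exp_scaleR_has_vector_derivative_right[of "- b" 0 "{0<..}"] by simp
  have dp: "(p has_vector_derivative - a) (at 0 within {0<..})"
    using bounded_bilinear.has_vector_derivative[OF bounded_bilinear_cscale dexp de]
    unfolding p_def a_def by (simp add: cscale_minus_left cscale_minus_right cscale_one)
  have q0: "q 0 = 1" "p 0 = 1" unfolding q_def p_def by (simp_all add: cscale_one)
  have limq: "(q \<longlongrightarrow> 1) (at_right 0)"
    using has_vector_derivative_continuous[OF dq] q0 by (simp add: continuous_within)
  have qq: "((\<lambda>t. (1 / t) *\<^sub>R (q t - 1)) \<longlongrightarrow> b) (at_right 0)"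
    using right_difference_quotient[OF dq] q0 by simp
  have qp: "((\<lambda>t. (1 / t) *\<^sub>R (p t - 1)) \<longlongrightarrow> - a) (at_right 0)"
    using right_difference_quotient[OF dp] q0 by simp
  \<comment> \<open>A bound for the operator-norm distance between the homological operator divided
    by \<open>t\<close> and the Sylvester operator. Below \<open>1 / (2 * C)\<close> it meets the
    perturbation condition.\<close>
  define \<eta> where "\<eta> t = norm ((1 / t) *\<^sub>R (p t - 1) - (- a)) * norm (q t) + norm a * norm (q t - 1)
      + norm ((1 / t) *\<^sub>R (q t - 1) - b)" for t
  have "(\<eta> \<longlongrightarrow> norm (- a - (- a)) * norm (1::'a) + norm a * norm (1 - 1 :: 'a) + norm (b - b)) (at_right 0)"
    unfolding \<eta>_def by (intro tendsto_intros limq qq qp)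
  then have "(\<eta> \<longlongrightarrow> 0) (at_right 0)" by simp
  then have "\<forall>\<^sub>F t in at_right 0. \<eta> t < 1 / (2 * C)" by (rule order_tendstoD) (use C0 in simp)
  moreover have "\<forall>\<^sub>F t::real in at_right 0. t > 0" by (simp add: eventually_at_right_less)
  ultimately show ?thesis
  proof eventually_elim
    case (elim t)
    have hom: "homological \<omega> b t k x = x - p t * x * q t" for x
      unfolding homological_def p_def q_def by (simp add: cscale_mult_left)
    have S: "bounded_linear (homological \<omega> b t k)"
      using clinear_bounded_homological unfolding clinear_bounded_def by blast
    have iso: "bounded_iso (\<lambda>x. (1 / t) *\<^sub>R homological \<omega> b t k x)"
    proof (rule bounded_iso_perturb[OF T C])
      show "bounded_linear (\<lambda>x. (1 / t) *\<^sub>R homological \<omega> b t k x)"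
        by (intro bounded_linear_compose[OF bounded_linear_scaleR_right S])
      show "C \<ge> 0" using C0 by simp
      show "\<eta> t \<ge> 0" unfolding \<eta>_def by simp
      have "\<eta> t * C < 1 / (2 * C) * C" using elim C0 by (intro mult_strict_right_mono)
      also have "\<dots> < 1" using C0 by simp
      finally show "\<eta> t * C < 1" .
      fix x
      have "(1 / t) *\<^sub>R homological \<omega> b t k x - (a * x - x * b)
         = - (((1 / t) *\<^sub>R (p t - 1) - (- a)) * x * q t) + a * x * (q t - 1) - x * ((1 / t) *\<^sub>R (q t - 1) - b)"
        unfolding hom by (simp add: algebra_simps)
      also have "norm \<dots> \<le> norm (((1 / t) *\<^sub>R (p t - 1) - (- a)) * x * q t) + norm (a * x * (q t - 1))
          + norm (x * ((1 / t) *\<^sub>R (q t - 1) - b))"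
        by (rule order_trans[OF norm_triangle_ineq4 add_right_mono[OF order_trans[OF norm_triangle_ineq]]]) simp
      also have "\<dots> \<le> norm ((1 / t) *\<^sub>R (p t - 1) - (- a)) * norm x * norm (q t) + norm a * norm x * norm (q t - 1)
          + norm x * norm ((1 / t) *\<^sub>R (q t - 1) - b)"
        by (intro add_mono norm_mult_ineq order_trans[OF norm_mult_ineq] mult_right_mono) auto
      also have "\<dots> = \<eta> t * norm x" unfolding \<eta>_def by (simp add: algebra_simps)
      finally show "norm ((1 / t) *\<^sub>R homological \<omega> b t k x - (a * x - x * b)) \<le> \<eta> t * norm x" .
    qed
    then obtain D where D: "\<And>x. norm x \<le> D * norm ((1 / t) *\<^sub>R homological \<omega> b t k x)"
      and sur: "surj (\<lambda>x. (1 / t) *\<^sub>R homological \<omega> b t k x)" unfolding bounded_iso_def by blast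
    have "surj (homological \<omega> b t k)" unfolding surj_def
    proof
      fix y
      obtain x where "(1 / t) *\<^sub>R homological \<omega> b t k x = (1 / t) *\<^sub>R y" using surjD[OF sur] by metis
      then show "\<exists>x. y = homological \<omega> b t k x" using elim by auto
    qed
    moreover have "norm x \<le> D / t * norm (homological \<omega> b t k x)" for x using D[of x] elim by simp
    ultimately show ?case unfolding bounded_iso_def using S by blast
  qed
qed

subsection \<open>The semigroup\<close>

lemma op_exp_scalar:
  fixes f' :: "'x::cbanach \<Rightarrow>\<^sub>L 'x"
  assumes f': "\<And>h. blinfun_apply f' h = c *\<^sub>C h"
  shows "blinfun_apply (op_exp (t *\<^sub>R f')) v = exp (of_real t * c) *\<^sub>C v"
proof -
  define a where "a = t *\<^sub>R f'"
  have pow: "blinfun_apply (op_pow a n) v = (of_real t * c) ^ n *\<^sub>C v" for n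
    by (induction n) (simp_all add: cscale_one a_def f' blinfun.scaleR_left cscale_cscale mult.assoc flip: cscale_of_real)
  have pown: "norm (op_pow a n) \<le> norm a ^ n" for n
  proof (induction n)
    case 0
    show ?case by (simp add: norm_blinfun_id_le)
  next
    case (Suc n)
    have "norm (a o\<^sub>L op_pow a n) \<le> norm a * norm (op_pow a n)" by (rule norm_blinfun_compose)
    also have "\<dots> \<le> norm a * norm a ^ n" using Suc by (intro mult_left_mono) auto
    finally show ?case by simp
  qed
  have "summable (\<lambda>n. norm a ^ n / fact n)" using summable_exp[of "norm a"] by (simp add: divide_inverse mult.commute)
  then have "summable (\<lambda>n. (1 / fact n) *\<^sub>R op_pow a n)"
    by (rule summable_comparison_test'[where N=0]) (use pown in \<open>simp add: divide_right_mono\<close>)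
  then have "(\<lambda>n. blinfun_apply ((1 / fact n) *\<^sub>R op_pow a n) v) sums blinfun_apply (op_exp a) v"
    unfolding op_exp_def by (intro bounded_linear.sums[OF blinfun.bounded_linear_left] summable_sums)
  moreover have "(\<lambda>n. ((of_real t * c) ^ n /\<^sub>R fact n) *\<^sub>C v) sums (exp (of_real t * c) *\<^sub>C v)"
    by (intro bounded_linear.sums[OF bounded_bilinear.bounded_linear_left[OF bounded_bilinear_cscale]] exp_converges)
  ultimately show ?thesis
    unfolding a_def[symmetric] using sums_unique2
    by (fastforce simp: blinfun.scaleR_left pow scaleR_cscale divide_inverse)
qed

text \<open>The growth rate is bounded below by testing on one nonzero vector. In the zero space the
  exponential has norm 0 and \<open>kappa_plus\<close> is \<open>- \<infinity>\<close> for every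
  \<open>\<omega>\<close>.\<close>

lemma kappa_plus_scalar:
  fixes f' :: "'x::cbanach \<Rightarrow>\<^sub>L 'x"
  assumes f': "\<And>h. blinfun_apply f' h = (- \<omega>) *\<^sub>C h" and neg: "kappa_plus f' < 0" and v: "v \<noteq> (0::'x)"
  shows "Re \<omega> > 0"
proof -
  have "ereal (- Re \<omega>) \<le> kappa_plus f'"
    unfolding kappa_plus_def
  proof (rule le_Limsup)
    show "\<forall>\<^sub>F t::real in at_top. ereal (- Re \<omega>) \<le> (if norm (op_exp (t *\<^sub>R f')) = 0 then - \<infinity>
        else ereal (ln (norm (op_exp (t *\<^sub>R f'))) / t))"
      using eventually_gt_at_top[of 0]
    proof eventually_elim
      case (elim t)
      have "exp (- t * Re \<omega>) * norm v \<le> norm (op_exp (t *\<^sub>R f')) * norm v"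
        using norm_blinfun[of "op_exp (t *\<^sub>R f')" v]
        by (simp add: op_exp_scalar[OF f'] norm_cscale)
      then have le: "exp (- t * Re \<omega>) \<le> norm (op_exp (t *\<^sub>R f'))" using v by simp
      then have pos: "norm (op_exp (t *\<^sub>R f')) > 0" using exp_gt_zero less_le_trans by blast
      have "- t * Re \<omega> \<le> ln (norm (op_exp (t *\<^sub>R f')))" using le pos by (simp add: ln_ge_iff)
      then have "- Re \<omega> \<le> ln (norm (op_exp (t *\<^sub>R f'))) / t" using elim by (simp add: field_simps)
      then show ?case using pos by simp
    qed
  qed simp
  then have "ereal (- Re \<omega>) < 0" using neg by (rule le_less_trans)
  then show ?thesis by simp
qed

locale generated_semigroup =
  fixes D :: "'x::cbanach set" and F :: "real \<Rightarrow> 'x \<Rightarrow> 'x" and f :: "'x \<Rightarrow> 'x" and x0 :: 'x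
  assumes D_open: "open D"
    and F_holo: "\<And>t. t \<ge> 0 \<Longrightarrow> holo_on D (F t)"
    and F_self: "\<And>t. t \<ge> 0 \<Longrightarrow> F t ` D \<subseteq> D"
    and F_zero: "\<And>x. x \<in> D \<Longrightarrow> F 0 x = x"
    and F_semigroup: "\<And>t s x. t \<ge> 0 \<Longrightarrow> s \<ge> 0 \<Longrightarrow> x \<in> D \<Longrightarrow> F (t + s) x = F t (F s x)"
    and x0_in: "x0 \<in> D"
    and F_conv: "\<And>S e. strictly_inside S D \<Longrightarrow> e > 0 \<Longrightarrow>
                   \<exists>T. \<forall>t\<ge>T. \<forall>x\<in>S. dist (F t x) x0 < e"
    and f_holo: "holo_on D f"
    and f_gen: "\<And>S e. strictly_inside S D \<Longrightarrow> e > 0 \<Longrightarrow>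
                   \<exists>\<delta>>0. \<forall>t. 0 < t \<and> t < \<delta> \<longrightarrow>
                      (\<forall>x\<in>S. norm ((1 / t) *\<^sub>R (F t x - x) - f x) < e)"
begin

lemma F_in: "t \<ge> 0 \<Longrightarrow> x \<in> D \<Longrightarrow> F t x \<in> D"
  using F_self by blast

lemma strictly_inside_ball:
  assumes "x \<in> D" "R > 0"
  obtains r where "r > 0" "r \<le> R" "ball x (2 * r) \<subseteq> D" "strictly_inside (ball x r) D"
proof -
  obtain e where e: "e > 0" "ball x e \<subseteq> D" using D_open assms by (meson open_contains_ball)
  define r where "r = min R (e / 2)"
  have r: "r > 0" "r \<le> R" "2 * r \<le> e" using e assms unfolding r_def by auto
  then have sub: "ball x (2 * r) \<subseteq> D" using e subset_ball[of "2 * r" e x] by blast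
  have "ball y r \<subseteq> D" if "y \<in> ball x r" for y
    using ball_trans[OF that, of r "2 * r"] sub by simp
  then have "strictly_inside (ball x r) D"
    unfolding strictly_inside_def using sub r subset_ball[of r "2 * r" x]
    by (intro conjI exI[of _ r] ballI) auto
  then show ?thesis using that r sub by blast
qed

text \<open>The orbit of \<open>x0\<close> converges to \<open>x0\<close>, and applying the
  continuous map \<open>F s\<close> to it merely shifts time.\<close>

lemma F_fix:
  assumes s: "s \<ge> 0"
  shows "F s x0 = x0"
proof (rule LIMSEQ_unique)
  have si: "strictly_inside {x0} D"
    using D_open x0_in unfolding strictly_inside_def by (simp add: open_contains_ball)
  have lim: "(\<lambda>n. F (r + real n) x0) \<longlonglongrightarrow> x0" for r
  proof (rule metric_LIMSEQ_I)
    fix e :: real assume "e > 0"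
    then obtain T where T: "\<And>t. t \<ge> T \<Longrightarrow> dist (F t x0) x0 < e" using F_conv[OF si] by blast
    obtain N where "real N \<ge> T - r" using real_arch_simple by blast
    then show "\<exists>N. \<forall>n\<ge>N. dist (F (r + real n) x0) x0 < e"
      using T by (intro exI[of _ N] allI impI) (auto intro!: T)
  qed
  show "(\<lambda>n. F (s + real n) x0) \<longlonglongrightarrow> x0" by (rule lim)
  have "(\<lambda>n. F s (F (0 + real n) x0)) \<longlonglongrightarrow> F s x0"
    by (rule isCont_tendsto_compose[OF holo_on_isCont[OF F_holo[OF s] x0_in] lim])
  then show "(\<lambda>n. F (s + real n) x0) \<longlonglongrightarrow> F s x0"
    using F_semigroup[OF s _ x0_in] by simp
qed

lemma F_near_id:
  assumes x: "x \<in> D"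
  obtains r C \<delta> where "r > 0" "C > 0" "\<delta> > 0" "ball x r \<subseteq> D"
    "\<And>h y. 0 \<le> h \<Longrightarrow> h < \<delta> \<Longrightarrow> y \<in> ball x r \<Longrightarrow> norm (F h y - y) \<le> C * h"
proof -
  obtain d where d: "d > 0" "\<And>y. dist y x < d \<Longrightarrow> dist (f y) (f x) < 1"
    using holo_on_isCont[OF f_holo x] unfolding continuous_at_eps_delta by (metis zero_less_one)
  obtain r where r: "r > 0" "r \<le> d" "ball x (2 * r) \<subseteq> D" "strictly_inside (ball x r) D"
    using strictly_inside_ball[OF x d(1)] by blast
  obtain \<delta> where \<delta>: "\<delta> > 0" "\<And>t y. 0 < t \<Longrightarrow> t < \<delta> \<Longrightarrow> y \<in> ball x r \<Longrightarrow> norm ((1 / t) *\<^sub>R (F t y - y) - f y) < 1"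
    using f_gen[OF r(4) zero_less_one] by blast
  have sub: "ball x r \<subseteq> D" using r subset_ball[of r "2 * r" x] by auto
  \<comment> \<open>One unit covers the variation of \<open>f\<close> on the ball, the other the
    error in the generation limit.\<close>
  define C where "C = norm (f x) + 2"
  show ?thesis
  proof (rule that[of r C \<delta>])
    show "C > 0" unfolding C_def by (simp add: add_nonneg_pos)
    fix h y assume h: "0 \<le> h" "h < \<delta>" and y: "y \<in> ball x r"
    show "norm (F h y - y) \<le> C * h"
    proof (cases "h = 0")
      case True then show ?thesis using F_zero y sub by auto
    next
      case False
      then have h0: "h > 0" using h by simp
      have "dist (f y) (f x) < 1" using d(2)[of y] y r by (simp add: dist_commute)
      then have "norm (f y) \<le> norm (f x) + 1" using norm_triangle_ineq2[of "f y" "f x"] by (simp add: dist_norm)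
      moreover have "norm ((1 / h) *\<^sub>R (F h y - y)) \<le> norm (f y) + 1"
        using \<delta>(2)[OF h0 h(2) y] norm_triangle_ineq2[of "(1 / h) *\<^sub>R (F h y - y)" "f y"] by linarith
      ultimately have "norm ((1 / h) *\<^sub>R (F h y - y)) \<le> C" unfolding C_def by simp
      then have "norm (F h y - y) / h \<le> C" unfolding norm_scaleR using h0 by simp
      then show ?thesis using h0 by (simp add: divide_le_eq)
    qed
  qed (use r \<delta> sub in auto)
qed

text \<open>Left continuity of orbits needs points that flow into \<open>x\<close> within a short
  time. They are fixed points of \<open>y \<mapsto> x - (F h y - y)\<close>, a contraction because
  the displacement \<open>F h y - y\<close> is uniformly of order \<open>h\<close> and so, by the
  Cauchy estimate, is its Lipschitz constant.\<close>

lemma F_backward: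
  assumes x: "x \<in> D"
  obtains C \<delta> where "C > 0" "\<delta> > 0"
    "\<And>h. 0 \<le> h \<Longrightarrow> h < \<delta> \<Longrightarrow> \<exists>z\<in>D. F h z = x \<and> norm (z - x) \<le> C * h"
proof -
  obtain r C \<delta> where r: "r > 0" and C: "C > 0" and \<delta>: "\<delta> > 0" and sub: "ball x r \<subseteq> D"
    and near: "\<And>h y. 0 \<le> h \<Longrightarrow> h < \<delta> \<Longrightarrow> y \<in> ball x r \<Longrightarrow> norm (F h y - y) \<le> C * h"
    using F_near_id[OF x] by metis
  \<comment> \<open>When \<open>16 * (C * h) \<le> r\<close>, the Lipschitz constant
    \<open>4 * (C * h) / (r / 2)\<close> is at most 1/2 and the closed ball of radius
    \<open>r / 4\<close> is mapped into itself.\<close>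
  define \<epsilon> where "\<epsilon> = min \<delta> (r / (16 * C))"
  have e: "\<epsilon> > 0" "\<epsilon> \<le> \<delta>" "\<epsilon> \<le> r / (16 * C)" unfolding \<epsilon>_def using r C \<delta> by auto
  show ?thesis
  proof (rule that[OF C e(1)])
    fix h assume h: "0 \<le> h" "h < \<epsilon>"
    have Ch: "16 * (C * h) \<le> r"
    proof -
      have "C * h \<le> C * (r / (16 * C))" using h e C by (intro mult_left_mono) auto
      then show ?thesis using C by simp
    qed
    define g where "g = (\<lambda>y. F h y - y)"
    have gb: "norm (g y) \<le> C * h" if "y \<in> ball x r" for y
      unfolding g_def using near h e that by simp
    have idh: "holo_on D (\<lambda>y. y)"
      by (rule holo_onI[of _ _ "\<lambda>_ h. h"]) (auto simp: clinear_bounded_def bounded_linear_ident)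
    have gh: "holo_on (ball x (2 * (r / 2))) g"
      unfolding g_def using sub by (intro holo_on_diff holo_on_subset[OF F_holo[OF h(1)]] holo_on_subset[OF idh]) auto
    have lip: "norm (g y - g z) \<le> 1 / 2 * norm (y - z)" if "y \<in> ball x (r / 2)" "z \<in> ball x (r / 2)" for y z
    proof -
      have "norm (g y - g z) \<le> 4 * (C * h) / (r / 2) * norm (y - z)"
        by (rule holo_lipschitz[OF gh]) (use r gb that in auto)
      also have "\<dots> \<le> 1 / 2 * norm (y - z)"
        using Ch r by (intro mult_right_mono) (auto simp: field_simps)
      finally show ?thesis .
    qed
    have "\<exists>!y\<in>cball x (r / 4). x - g y = y"
    proof (rule Banach_fix[of _ "1 / 2"])
      show "complete (cball x (r / 4))" by (simp add: complete_eq_closed)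
      show "cball x (r / 4) \<noteq> {}" using r by simp
      show "(\<lambda>y. x - g y) ` cball x (r / 4) \<subseteq> cball x (r / 4)"
      proof clarify
        fix y assume "y \<in> cball x (r / 4)"
        then have "norm (g y) \<le> C * h" using r by (intro gb) auto
        then show "x - g y \<in> cball x (r / 4)" using Ch r C h by (simp add: dist_norm)
      qed
      fix y z assume "y \<in> cball x (r / 4)" "z \<in> cball x (r / 4)"
      then have "y \<in> ball x (r / 2)" "z \<in> ball x (r / 2)" using r by auto
      from lip[OF this] show "dist (x - g y) (x - g z) \<le> 1 / 2 * dist y z"
        by (simp add: dist_norm norm_minus_commute)
    qed simp_all
    then obtain y where y: "y \<in> cball x (r / 4)" "x - g y = y" by blast
    have yb: "y \<in> ball x r" using y r by auto
    have "F h y = x" using y(2) unfolding g_def by (simp add: algebra_simps)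
    moreover have "y - x = - g y" using y(2) by (simp add: algebra_simps)
    then have "norm (y - x) \<le> C * h" using gb[OF yb] by simp
    ultimately show "\<exists>z\<in>D. F h z = x \<and> norm (z - x) \<le> C * h" using yb sub by blast
  qed
qed

text \<open>To the right of \<open>t\<close> the flow moves \<open>F t x\<close> only slightly. To
  the left, \<open>F s x = F t z\<close> for a nearby point \<open>z\<close> that flows into
  \<open>x\<close> in time \<open>t - s\<close>, so continuity of \<open>F t\<close> at
  \<open>x\<close> decides. The result makes \<open>B\<close> bounded along compact pieces of
  orbits.\<close>

lemma continuous_on_orbit:
  assumes x: "x \<in> D"
  shows "continuous_on {0..} (\<lambda>t. F t x)"
  unfolding continuous_on_iff
proof (intro ballI allI impI)
  fix t e :: real assume t: "t \<in> {0..}" and e: "e > 0"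
  have Fx: "F t x \<in> D" using F_in t x by simp
  obtain r C \<delta> where C: "r > 0" "C > 0" "\<delta> > 0"
    and near: "\<And>h y. 0 \<le> h \<Longrightarrow> h < \<delta> \<Longrightarrow> y \<in> ball (F t x) r \<Longrightarrow> norm (F h y - y) \<le> C * h"
    using F_near_id[OF Fx] by metis
  obtain C' \<delta>' where C': "C' > 0" "\<delta>' > 0"
    and bwd: "\<And>h. 0 \<le> h \<Longrightarrow> h < \<delta>' \<Longrightarrow> \<exists>z\<in>D. F h z = x \<and> norm (z - x) \<le> C' * h"
    using F_backward[OF x] by metis
  obtain d where d: "d > 0" "\<And>y. dist y x < d \<Longrightarrow> dist (F t y) (F t x) < e"
    using holo_on_isCont[OF F_holo x] t e unfolding continuous_at_eps_delta by (metis atLeast_iff)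
  define \<eta> where "\<eta> = min (min \<delta> \<delta>') (min (e / C) (d / C'))"
  have \<eta>: "\<eta> > 0" "\<eta> \<le> \<delta>" "\<eta> \<le> \<delta>'" "\<eta> \<le> e / C" "\<eta> \<le> d / C'" unfolding \<eta>_def using C C' e d by auto
  show "\<exists>d>0. \<forall>s\<in>{0..}. dist s t < d \<longrightarrow> dist (F s x) (F t x) < e"
  proof (intro exI[of _ \<eta>] conjI ballI impI)
    fix s :: real assume s: "s \<in> {0..}" "dist s t < \<eta>"
    show "dist (F s x) (F t x) < e"
    proof (cases "s \<ge> t")
      case True
      have h: "0 \<le> s - t" "s - t < \<eta>" using True s by (auto simp: dist_real_def)
      have "F s x = F (s - t) (F t x)" using F_semigroup[of "s - t" t x] h t x by simp
      then have "norm (F s x - F t x) \<le> C * (s - t)" using near[of "s - t" "F t x"] h \<eta> C by simp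
      also have "\<dots> < C * (e / C)" using h \<eta> C by (intro mult_strict_left_mono) auto
      finally show ?thesis using C by (simp add: dist_norm)
    next
      case False
      have h: "0 \<le> t - s" "t - s < \<eta>" using False s by (auto simp: dist_real_def)
      obtain z where z: "z \<in> D" "F (t - s) z = x" "norm (z - x) \<le> C' * (t - s)"
        using bwd[of "t - s"] h \<eta> by auto
      have "C' * (t - s) < C' * (d / C')" using h \<eta> C' by (intro mult_strict_left_mono) auto
      then have "dist z x < d" using z(3) C' by (simp add: dist_norm)
      then have "dist (F t z) (F t x) < e" by (rule d)
      moreover have "F t z = F s x" using F_semigroup[of s "t - s" z] z h s by simp
      ultimately show ?thesis by simp
    qed
  qed (rule \<eta>)
qed

end

section \<open>The derivative at the fixed point\<close>

locale dilation_semigroup = generated_semigroup +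
  fixes \<omega> :: complex
  assumes f_deriv: "(f has_derivative (\<lambda>h. (- \<omega>) *\<^sub>C h)) (at x0)"
begin

text \<open>A Cauchy estimate at \<open>x0\<close> carries the uniform generation limit over from
  the maps to their derivatives; the tolerance \<open>e * r / 4\<close> absorbs its constant
  \<open>4 / r\<close>.\<close>

lemma F_deriv_near_zero:
  assumes A: "\<And>t. t \<ge> 0 \<Longrightarrow> (F t has_derivative A t) (at x0)" "\<And>t. t \<ge> 0 \<Longrightarrow> clinear_bounded (A t)"
    and e: "e > 0"
  obtains \<delta> where "\<delta> > 0" "\<And>t h. 0 < t \<Longrightarrow> t < \<delta> \<Longrightarrow> norm (A t h - h + (of_real t * \<omega>) *\<^sub>C h) \<le> e * t * norm h"
proof -
  obtain r where r: "r > 0" "ball x0 (2 * r) \<subseteq> D" "strictly_inside (ball x0 r) D"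
    using strictly_inside_ball[OF x0_in zero_less_one] by metis
  have sub: "ball x0 r \<subseteq> D" using r subset_ball[of r "2 * r" x0] by auto
  obtain \<delta> where \<delta>: "\<delta> > 0"
    "\<And>t y. 0 < t \<Longrightarrow> t < \<delta> \<Longrightarrow> y \<in> ball x0 r \<Longrightarrow> norm ((1 / t) *\<^sub>R (F t y - y) - f y) < e * r / 4"
    using f_gen[OF r(3), of "e * r / 4"] e r by (metis divide_pos_pos mult_pos_pos zero_less_numeral)
  show ?thesis
  proof (rule that[OF \<delta>(1)])
    fix t h assume t: "0 < t" "t < \<delta>"
    then have A': "(F t has_derivative A t) (at x0)" "clinear_bounded (A t)" using A by auto
    define g where "g = (\<lambda>y. (1 / t) *\<^sub>R (F t y - y) - f y)"
    define L where "L = (\<lambda>h. (1 / t) *\<^sub>R (A t h - h) - (- \<omega>) *\<^sub>C h)"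
    have der: "(g has_derivative L) (at x0)"
      unfolding g_def L_def by (intro derivative_intros A' f_deriv)
    have idh: "holo_on D (\<lambda>y. y)"
      by (rule holo_onI[of _ _ "\<lambda>_ h. h"]) (auto simp: clinear_bounded_def bounded_linear_ident)
    have "holo_on D g"
      unfolding g_def using t
      by (simp flip: cscale_of_real) (intro holo_on_diff holo_on_cscale F_holo idh f_holo, simp)
    then have hol: "holo_on (ball x0 r) g" using sub by (rule holo_on_subset)
    have "clinear_bounded L"
      unfolding clinear_bounded_def
    proof (intro conjI allI)
      show "bounded_linear L" using der by (rule has_derivative_bounded_linear)
      show "L (c *\<^sub>C v) = c *\<^sub>C L v" for c v
        using A'(2) unfolding L_def clinear_bounded_def
        by (simp add: cscale_add_right cscale_diff_right cscale_scaleR cscale_cscale cscale_minus_left cscale_minus_right mult.commute)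
    qed
    then have "norm (L h) \<le> 4 * (e * r / 4) / r * norm h"
      using \<delta>(2)[OF t] by (intro cauchy_estimate[OF hol r(1) _ der]) (auto simp: g_def intro: less_imp_le)
    then have "norm (L h) \<le> e * norm h" using r by simp
    then have "t * norm (L h) \<le> t * (e * norm h)" using t by (intro mult_left_mono) auto
    moreover have "A t h - h + (of_real t * \<omega>) *\<^sub>C h = t *\<^sub>R L h"
      unfolding L_def using t
      by (simp add: scaleR_diff_right scaleR_add_right cscale_minus_left flip: cscale_cscale)
        (simp add: cscale_of_real scaleR_add_right scaleR_diff_right)
    ultimately show "norm (A t h - h + (of_real t * \<omega>) *\<^sub>C h) \<le> e * t * norm h"
      using t by (simp add: mult_ac)
  qed
qed

text \<open>By the chain rule at the fixed point the derivatives form a one-parameter semigroup.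
  Rescaled by \<open>exp (t \<omega>)\<close> it becomes \<open>U\<close>, which differs from the
  identity by \<open>o(s)\<close> at small times \<open>s\<close>; cutting \<open>t\<close> into
  many equal steps then shows that \<open>U t\<close> is the identity.\<close>

lemma F_deriv:
  assumes t: "t \<ge> 0"
  shows "(F t has_derivative (\<lambda>h. exp (- (of_real t * \<omega>)) *\<^sub>C h)) (at x0)"
proof -
  obtain A where A: "\<And>t. t \<ge> 0 \<Longrightarrow> (F t has_derivative A t) (at x0)" "\<And>t. t \<ge> 0 \<Longrightarrow> clinear_bounded (A t)"
  proof -
    have "\<exists>L. t \<ge> 0 \<longrightarrow> (F t has_derivative L) (at x0) \<and> clinear_bounded L" for t
      using F_holo[of t] x0_in unfolding holo_on_def by blast
    then show ?thesis using that by metis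
  qed
  have Ac: "A t (c *\<^sub>C h) = c *\<^sub>C A t h" if "t \<ge> 0" for t c h
    using A(2)[OF that] unfolding clinear_bounded_def by blast
  have comp: "A (t + s) h = A t (A s h)" if ts: "t \<ge> 0" "s \<ge> 0" for t s h
  proof -
    have "((\<lambda>x. F t (F s x)) has_derivative (\<lambda>h. A t (A s h))) (at x0)"
      using ts F_fix by (intro has_derivative_compose[OF A(1)[OF ts(2)]]) (simp add: A(1))
    then have "(F (t + s) has_derivative (\<lambda>h. A t (A s h))) (at x0)"
      by (rule has_derivative_transform_within_open[OF _ D_open x0_in]) (simp add: F_semigroup ts)
    then show ?thesis using has_derivative_unique[OF A(1)[of "t + s"]] ts by (metis add_nonneg_nonneg)
  qed
  define U where "U t h = exp (of_real t * \<omega>) *\<^sub>C A t h" for t h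
  have Ucomp: "U (t + s) h = U t (U s h)" if "t \<ge> 0" "s \<ge> 0" for t s h
    unfolding U_def using that
    by (simp add: comp Ac cscale_cscale distrib_right exp_add)
  have U0: "U 0 h = h" for h
  proof -
    have "((\<lambda>x. x) has_derivative A 0) (at x0)"
      by (rule has_derivative_transform_within_open[OF A(1)[of 0] D_open x0_in]) (simp_all add: F_zero)
    then have "A 0 = (\<lambda>h. h)" using has_derivative_unique has_derivative_ident by blast
    then show ?thesis unfolding U_def by (simp add: cscale_one)
  qed
  have small: "\<exists>\<delta>>0. \<forall>s h. 0 < s \<longrightarrow> s < \<delta> \<longrightarrow> norm (U s h - h) \<le> e * s * norm h" if e: "e > 0" for e
  proof -
    obtain \<delta>1 where \<delta>1: "\<delta>1 > 0"
      "\<And>t h. 0 < t \<Longrightarrow> t < \<delta>1 \<Longrightarrow> norm (A t h - h + (of_real t * \<omega>) *\<^sub>C h) \<le> e / 4 * t * norm h"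
      using F_deriv_near_zero[OF A, of "e / 4"] e by auto
    \<comment> \<open>The scalar part of \<open>U s\<close>: to first order the derivative of
      \<open>F s\<close> is \<open>1 - s \<omega>\<close>, and its product with the exponential has
      derivative 0 at 0.\<close>
    define E where "E s = exp (of_real s * \<omega>) * (1 - of_real s * \<omega>)" for s :: real
    have "((\<lambda>z. exp (z * \<omega>) * (1 - z * \<omega>)) has_field_derivative 0) (at (of_real 0))"
      by (auto intro!: derivative_eq_intros)
    from has_vector_derivative_real_field[OF this, of "{0<..}"]
    have "(E has_vector_derivative 0) (at 0 within {0<..})" unfolding E_def .
    from right_difference_quotient[OF this]
    have "((\<lambda>t. (1 / t) *\<^sub>R (E t - 1)) \<longlongrightarrow> 0) (at_right 0)" unfolding E_def by simp
    then have 1: "\<forall>\<^sub>F s in at_right 0. norm ((1 / s) *\<^sub>R (E s - 1)) < e / 2"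
      using e tendsto_norm_zero order_tendstoD(2) half_gt_zero by blast
    have "((\<lambda>s. cmod (exp (of_real s * \<omega>))) \<longlongrightarrow> cmod (exp (of_real 0 * \<omega>))) (at_right 0)"
      by (intro tendsto_intros)
    then have 2: "\<forall>\<^sub>F s in at_right 0. cmod (exp (of_real s * \<omega>)) < 2"
      by (rule order_tendstoD) simp
    obtain \<delta>2 where \<delta>2: "\<delta>2 > 0" "\<And>s. 0 < s \<Longrightarrow> s < \<delta>2 \<Longrightarrow> norm ((1 / s) *\<^sub>R (E s - 1)) < e / 2 \<and> cmod (exp (of_real s * \<omega>)) < 2"
      using eventually_conj[OF 1 2] unfolding eventually_at_right_field by blast
    have "norm (U s h - h) \<le> e * s * norm h" if s: "0 < s" "s < min \<delta>1 \<delta>2" for s h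
    proof -
      have "cmod (E s - 1) / s < e / 2" using \<delta>2(2)[of s] s unfolding norm_scaleR by simp
      then have E: "cmod (E s - 1) \<le> e / 2 * s" using s by (simp add: divide_less_eq)
      have "U s h - h = exp (of_real s * \<omega>) *\<^sub>C (A s h - h + (of_real s * \<omega>) *\<^sub>C h) + (E s - 1) *\<^sub>C h"
        unfolding U_def E_def
        by (simp add: cscale_add_right cscale_diff_right cscale_cscale cscale_diff_left right_diff_distrib cscale_one)
      also have "norm \<dots> \<le> cmod (exp (of_real s * \<omega>)) * norm (A s h - h + (of_real s * \<omega>) *\<^sub>C h) + cmod (E s - 1) * norm h"
        by (rule order_trans[OF norm_triangle_ineq]) (simp only: norm_cscale order_refl)
      also have "\<dots> \<le> 2 * (e / 4 * s * norm h) + e / 2 * s * norm h"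
        using \<delta>1(2)[of s h] \<delta>2(2)[of s] E s e by (intro add_mono mult_mono) auto
      also have "\<dots> = e * s * norm h" by (simp add: field_simps)
      finally show ?thesis .
    qed
    then show ?thesis using \<delta>1 \<delta>2 by (intro exI[of _ "min \<delta>1 \<delta>2"]) auto
  qed
  have bound: "norm (U t h - h) \<le> (exp (e * t) - 1) * norm h" if e: "e > 0" for e h
  proof -
    obtain \<delta> where \<delta>: "\<delta> > 0" "\<And>s h. 0 < s \<Longrightarrow> s < \<delta> \<Longrightarrow> norm (U s h - h) \<le> e * s * norm h"
      using small[OF e] by blast
    obtain n where n: "real n > t / \<delta>" using reals_Archimedean2 by blast
    show ?thesis
    proof (cases "t = 0")
      case True then show ?thesis using U0 by simp
    next
      case False
      then have t0: "t > 0" using t by simp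
      then have n0: "n > 0" using n \<delta> by (metis divide_pos_pos less_trans of_nat_0_less_iff)
      define s where "s = t / real n"
      have s: "0 < s" "s < \<delta>" using t0 n0 n \<delta> unfolding s_def by (auto simp: field_simps)
      \<comment> \<open>Size and deviation are bounded together, since each new increment is
        controlled by the size reached so far.\<close>
      have it: "norm (U (real m * s) h) \<le> (1 + e * s) ^ m * norm h \<and>
          norm (U (real m * s) h - h) \<le> ((1 + e * s) ^ m - 1) * norm h" for m
      proof (induction m)
        case 0
        then show ?case using U0 by simp
      next
        case (Suc m)
        define y where "y = U (real m * s) h"
        have y: "U (real (Suc m) * s) h = U s y"
          unfolding y_def using Ucomp[of s "real m * s" h] s by (simp add: algebra_simps)
        have d: "norm (U s y - y) \<le> e * s * norm y" using \<delta>(2) s by blast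
        also have "\<dots> \<le> e * s * ((1 + e * s) ^ m * norm h)"
          using Suc e s unfolding y_def by (intro mult_left_mono) auto
        finally have d: "norm (U s y - y) \<le> e * s * ((1 + e * s) ^ m * norm h)" .
        have "norm (U s y) \<le> norm (U s y - y) + norm y" using norm_triangle_sub[of "U s y" y] by simp
        moreover have "norm (U s y - h) \<le> norm (U s y - y) + norm (y - h)"
          using norm_triangle_ineq[of "U s y - y" "y - h"] by simp
        ultimately show ?case unfolding y using d Suc unfolding y_def[symmetric]
          by (auto simp: algebra_simps)
      qed
      have "norm (U t h - h) \<le> ((1 + e * s) ^ n - 1) * norm h"
        using it[of n] n0 unfolding s_def by simp
      also have "\<dots> \<le> (exp (e * s) ^ n - 1) * norm h"
        using e s by (intro mult_right_mono diff_right_mono power_mono) (auto simp: add_nonneg_nonneg)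
      also have "exp (e * s) ^ n = exp (e * t)"
        unfolding s_def using n0 by (simp flip: exp_of_nat_mult)
      finally show ?thesis .
    qed
  qed
  have "U t h = h" for h
  proof -
    have "((\<lambda>e. (exp (e * t) - 1) * norm h) \<longlongrightarrow> (exp (0 * t) - 1) * norm h) (at_right 0)"
      by (intro tendsto_intros)
    moreover have "\<forall>\<^sub>F e in at_right 0. norm (U t h - h) \<le> (exp (e * t) - 1) * norm h"
      using bound by (simp add: eventually_at_right_less eventually_at_filter)
    ultimately have "norm (U t h - h) \<le> (exp (0 * t) - 1) * norm h"
      by (intro tendsto_lowerbound) auto
    then show ?thesis by simp
  qed
  then have "A t h = exp (- (of_real t * \<omega>)) *\<^sub>C h" for h
    unfolding U_def by (metis cscale_cscale cscale_one exp_minus_inverse mult.commute)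
  then have "A t = (\<lambda>h. exp (- (of_real t * \<omega>)) *\<^sub>C h)" by blast
  then show ?thesis using A(1)[OF t] by simp
qed

lemma F_quadratic:
  assumes s: "s \<ge> 0"
  shows "vanishes x0 2 (\<lambda>x. F s x - (x0 + exp (- (of_real s * \<omega>)) *\<^sub>C (x - x0)))"
proof -
  obtain r where r: "r > 0" "ball x0 r \<subseteq> D" using D_open x0_in by (meson open_contains_ball)
  define \<mu> where "\<mu> = exp (- (of_real s * \<omega>))"
  have blC: "bounded_linear (cscale \<mu> :: 'a \<Rightarrow> 'a)"
    using clinear_bounded_cscale unfolding clinear_bounded_def by blast
  have der: "((\<lambda>x. x0 + \<mu> *\<^sub>C (x - x0)) has_derivative (\<lambda>h. \<mu> *\<^sub>C h)) (at x)" for x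
    by (auto intro!: derivative_eq_intros bounded_linear.has_derivative[OF blC])
  have "vanishes x0 2 (\<lambda>x. F s x - (x0 + \<mu> *\<^sub>C (x - x0)))"
  proof (rule vanishes_2[OF _ r(1)])
    show "holo_on (ball x0 r) (\<lambda>x. F s x - (x0 + \<mu> *\<^sub>C (x - x0)))"
      by (intro holo_on_diff holo_on_subset[OF F_holo[OF s] r(2)] holo_onI[OF der] clinear_bounded_cscale)
    show "((\<lambda>x. F s x - (x0 + \<mu> *\<^sub>C (x - x0))) has_derivative (\<lambda>h. 0)) (at x0)"
      using has_derivative_diff[OF F_deriv[OF s] der[of x0]] unfolding \<mu>_def by simp
  qed (simp add: F_fix s)
  then show ?thesis unfolding \<mu>_def .
qed

end

subsection \<open>The semicocycle\<close>

text \<open>Comparison with the maximum in place of Gronwall's inequality: if \<open>K\<close> is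
  the largest norm on the interval, the deviation from 1 is at most \<open>K / 4\<close>, hence
  \<open>K \<le> 4 / 3\<close> and the deviation is at most 1/3.\<close>

lemma linear_ode_near_one:
  fixes v :: "real \<Rightarrow> 'a::cbanach_algebra_1"
  assumes v: "\<And>s. s \<in> {0..h} \<Longrightarrow> (v has_vector_derivative b s * v s) (at s within {0..h})"
    and b: "\<And>s. s \<in> {0..h} \<Longrightarrow> norm (b s) \<le> C" and v0: "v 0 = 1" and h: "0 \<le> h" "C * h \<le> 1 / 4"
  shows "norm (1 - v h) < 1"
proof -
  have "continuous_on {0..h} v"
    unfolding continuous_on_eq_continuous_within using v has_vector_derivative_continuous by blast
  then have "continuous_on {0..h} (\<lambda>s. norm (v s))" by (intro continuous_intros)
  then obtain s0 where s0: "s0 \<in> {0..h}" "\<And>s. s \<in> {0..h} \<Longrightarrow> norm (v s) \<le> norm (v s0)"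
    using continuous_attains_sup[of "{0..h}" "\<lambda>s. norm (v s)"] h by auto
  have C0: "0 \<le> C" using b[of 0] h by (auto intro: order_trans[OF norm_ge_zero])
  have dev: "norm (v s - 1) \<le> norm (v s0) / 4" if s: "s \<in> {0..h}" for s
  proof -
    have "norm (v s - v 0) \<le> C * norm (v s0) * norm (s - 0)"
    proof (rule differentiable_bound)
      show "(v has_derivative (\<lambda>d. d *\<^sub>R (b t * v t))) (at t within {0..h})" if "t \<in> {0..h}" for t
        using v[OF that] unfolding has_vector_derivative_def .
      show "onorm (\<lambda>d. d *\<^sub>R (b t * v t)) \<le> C * norm (v s0)" if t: "t \<in> {0..h}" for t
      proof (rule onorm_bound)
        fix d :: real
        have "norm (b t * v t) \<le> C * norm (v s0)"
          using b[OF t] s0(2)[OF t] C0 by (intro order_trans[OF norm_mult_ineq] mult_mono) auto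
        then have "\<bar>d\<bar> * norm (b t * v t) \<le> \<bar>d\<bar> * (C * norm (v s0))" by (intro mult_left_mono) auto
        then show "norm (d *\<^sub>R (b t * v t)) \<le> C * norm (v s0) * norm d" by (simp add: mult_ac)
      qed (use C0 in simp)
    qed (use s h in auto)
    also have "\<dots> = (C * s) * norm (v s0)" using s by simp
    also have "\<dots> \<le> (1 / 4) * norm (v s0)"
    proof (intro mult_right_mono norm_ge_zero)
      have "C * s \<le> C * h" using s C0 by (intro mult_left_mono) auto
      then show "C * s \<le> 1 / 4" using h by simp
    qed
    finally show ?thesis using v0 by simp
  qed
  have "norm (v s0) \<le> 1 + norm (v s0 - 1)" using norm_triangle_ineq[of "v s0 - 1" 1] by simp
  then have "norm (v s0) \<le> 4 / 3" using dev[OF s0(1)] by simp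
  then show ?thesis using dev[of h] h by (simp add: norm_minus_commute)
qed

locale generated_semicocycle = dilation_semigroup D F f x0 \<omega>
  for D :: "'x::cbanach set" and F f x0 \<omega> +
  fixes \<Gamma> :: "real \<Rightarrow> 'x \<Rightarrow> 'a::cbanach_algebra_1" and B :: "'x \<Rightarrow> 'a" and B0 :: 'a
  assumes \<Gamma>_holo: "\<And>t. t \<ge> 0 \<Longrightarrow> holo_on D (\<Gamma> t)"
    and \<Gamma>_cocycle: "\<And>t s x. t \<ge> 0 \<Longrightarrow> s \<ge> 0 \<Longrightarrow> x \<in> D \<Longrightarrow> \<Gamma> (t + s) x = \<Gamma> t (F s x) * \<Gamma> s x"
    and B_holo: "holo_on D B"
    and \<Gamma>_gen: "\<And>x t. x \<in> D \<Longrightarrow> t \<ge> 0 \<Longrightarrow>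
        ((\<lambda>s. \<Gamma> s x) has_vector_derivative (B (F t x) * \<Gamma> t x)) (at t within {0..})"
    and \<Gamma>_zero: "\<And>x. x \<in> D \<Longrightarrow> \<Gamma> 0 x = 1"
    and B0_def: "B0 = B x0"
begin

text \<open>Over the fixed point the differential equation has the constant coefficient
  \<open>B0\<close>.\<close>

lemma \<Gamma>_x0:
  assumes t: "t \<ge> 0"
  shows "\<Gamma> t x0 = exp (t *\<^sub>R B0)"
proof -
  define g where "g s = exp (s *\<^sub>R (- B0)) * \<Gamma> s x0" for s
  have "(g has_vector_derivative 0) (at s within {0..})" if s: "s \<in> {0..}" for s
  proof -
    have "(g has_vector_derivative exp (s *\<^sub>R (- B0)) * (B0 * \<Gamma> s x0) + exp (s *\<^sub>R (- B0)) * (- B0) * \<Gamma> s x0)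
        (at s within {0..})"
      unfolding g_def using \<Gamma>_gen[OF x0_in, of s] s F_fix[of s]
      by (intro has_vector_derivative_mult exp_scaleR_has_vector_derivative_right) (simp add: B0_def)
    then show ?thesis by (simp add: mult.assoc)
  qed
  then obtain c where c: "\<And>s. s \<in> {0..} \<Longrightarrow> g s = c"
    using has_vector_derivative_zero_constant[of "{0..}" g] by auto
  have "g t = g 0" using c t by simp
  then have "exp (- (t *\<^sub>R B0)) * \<Gamma> t x0 = 1" unfolding g_def using \<Gamma>_zero x0_in by simp
  then have "exp (t *\<^sub>R B0) * (exp (- (t *\<^sub>R B0)) * \<Gamma> t x0) = exp (t *\<^sub>R B0)" by simp
  then show ?thesis using exp_minus_inverse[of "t *\<^sub>R B0"] by (simp flip: mult.assoc)
qed

text \<open>The cocycle law splits \<open>\<Gamma> t x\<close> into factors over short time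
  intervals. \<open>B\<close> is bounded along the compact piece of orbit, so each factor lies
  within distance 1 of the unit.\<close>

lemma \<Gamma>_invertible:
  assumes t: "t \<ge> 0" and x: "x \<in> D"
  shows "invertible_el (\<Gamma> t x)"
proof -
  have "continuous_on {0..t} (\<lambda>s. F s x)"
    using continuous_on_orbit[OF x] continuous_on_subset by fastforce
  moreover have "continuous_on D B"
    using holo_on_isCont[OF B_holo] continuous_at_imp_continuous_on by blast
  ultimately have "continuous_on {0..t} (\<lambda>s. B (F s x))"
    using F_in x by (intro continuous_on_compose2[of D B "{0..t}" "\<lambda>s. F s x"]) auto
  then have "compact ((\<lambda>s. B (F s x)) ` {0..t})" by (intro compact_continuous_image) auto
  then obtain C where C: "C > 0" "\<And>s. s \<in> {0..t} \<Longrightarrow> norm (B (F s x)) \<le> C"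
    using compact_imp_bounded bounded_pos by (metis imageI)
  \<comment> \<open>The step \<open>t / n\<close> then satisfies the bound
    \<open>C * h \<le> 1 / 4\<close> required by \<open>linear_ode_near_one\<close>.\<close>
  obtain n where n: "real n > 4 * C * t" using reals_Archimedean2 by blast
  then have n0: "n > 0" using C t by (metis mult_nonneg_nonneg less_le_trans not_less of_nat_0_less_iff zero_le_numeral less_eq_real_def)
  define h where "h = t / real n"
  have h: "h \<ge> 0" "real n * h = t" "C * h \<le> 1 / 4" unfolding h_def using t n n0 by (auto simp: field_simps)
  have "m \<le> n \<Longrightarrow> invertible_el (\<Gamma> (real m * h) x)" for m
  proof (induction m)
    case 0
    show ?case using \<Gamma>_zero x by (auto intro: invertible_elI[of 1 1])
  next
    case (Suc m)
    define y where "y = F (real m * h) x"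
    have y: "y \<in> D" unfolding y_def using F_in h x by simp
    have "norm (1 - \<Gamma> h y) < 1"
    proof (rule linear_ode_near_one[where v="\<lambda>s. \<Gamma> s y" and b="\<lambda>s. B (F s y)"])
      fix s assume s: "s \<in> {0..h}"
      show "((\<lambda>s. \<Gamma> s y) has_vector_derivative B (F s y) * \<Gamma> s y) (at s within {0..h})"
        using \<Gamma>_gen[OF y, of s] s by (auto intro: has_vector_derivative_within_subset)
      have "real (Suc m) * h \<le> real n * h" using Suc.prems h by (intro mult_right_mono) auto
      then have "s + real m * h \<in> {0..t}" using s h by (auto simp: algebra_simps)
      moreover have "F s y = F (s + real m * h) x" unfolding y_def using F_semigroup[of s "real m * h" x] s h x by simp
      ultimately show "norm (B (F s y)) \<le> C" using C(2) by simp
    qed (use h \<Gamma>_zero y in auto)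
    then have "invertible_el (\<Gamma> h y)" by (rule neumann)
    moreover have "\<Gamma> (real (Suc m) * h) x = \<Gamma> h y * \<Gamma> (real m * h) x"
      unfolding y_def using \<Gamma>_cocycle[of h "real m * h" x] h x by (simp add: algebra_simps)
    ultimately show ?case using Suc invertible_el_mult by simp
  qed
  from this[of n] show ?thesis using h by simp
qed

section \<open>The transfer operators\<close>

definition transfer :: "real \<Rightarrow> ('x \<Rightarrow> 'a) \<Rightarrow> 'x \<Rightarrow> 'a" where
  "transfer s N x = exp (- (s *\<^sub>R B0)) * N (F s x) * \<Gamma> s x"

lemma transfer_zero: "x \<in> D \<Longrightarrow> transfer 0 N x = N x"
  unfolding transfer_def by (simp add: F_zero \<Gamma>_zero)

text \<open>The order of composition is immaterial on the right-hand side, so the transfer operators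
  commute; this is what passes from one time step to all times.\<close>

lemma transfer_transfer:
  assumes "s \<ge> 0" "r \<ge> 0" "x \<in> D"
  shows "transfer s (transfer r N) x = transfer (r + s) N x"
proof -
  have "exp (- ((r + s) *\<^sub>R B0)) = exp (- (s *\<^sub>R B0)) * exp (- (r *\<^sub>R B0))"
    by (subst exp_add_commuting[symmetric]) (simp_all add: algebra_simps)
  then show ?thesis unfolding transfer_def using assms
    by (simp add: F_semigroup \<Gamma>_cocycle mult.assoc)
qed

lemma transfer_add: "transfer s (\<lambda>x. N x + P x) x = transfer s N x + transfer s P x"
  unfolding transfer_def by (simp add: algebra_simps)

lemma transfer_diff: "transfer s (\<lambda>x. N x - P x) x = transfer s N x - transfer s P x"
  unfolding transfer_def by (simp add: algebra_simps)

lemma transfer_cong: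
  "s \<ge> 0 \<Longrightarrow> x \<in> D \<Longrightarrow> (\<And>y. y \<in> D \<Longrightarrow> N y = P y) \<Longrightarrow> transfer s N x = transfer s P x"
  unfolding transfer_def by (simp add: F_in)

lemma transfer_holo:
  assumes "s \<ge> 0" "holo_on D N"
  shows "holo_on D (transfer s N)"
  unfolding transfer_def using assms
  by (intro holo_on_mult holo_on_const holo_on_compose[OF F_holo assms(2)] \<Gamma>_holo F_in)

lemma transfer_x0: "s \<ge> 0 \<Longrightarrow> N x0 = 1 \<Longrightarrow> transfer s N x0 = 1"
  unfolding transfer_def using exp_minus_inverse[of "- (s *\<^sub>R B0)"] by (simp add: F_fix \<Gamma>_x0)

text \<open>Two replacements, each with an error of one order more: \<open>W (F s x)\<close> by
  \<open>\<mu> ^ k *\<^sub>C W x\<close>, through the quadratic approximation of \<open>F s\<close>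
  and scaling; and \<open>\<Gamma> s x\<close> by its value \<open>exp (s *\<^sub>R B0)\<close> at
  \<open>x0\<close>, since the difference vanishes to order 1 and multiplies a map of order
  \<open>k\<close>.\<close>

lemma transfer_leading_term:
  assumes W: "holo_on D W" and v: "vanishes x0 k W" and s: "s \<ge> 0" and \<omega>: "Re \<omega> > 0"
  shows "vanishes x0 (Suc k) (\<lambda>x. transfer s W x - W x + homological \<omega> B0 s k (W x))"
proof -
  obtain r where r: "r > 0" "ball x0 r \<subseteq> D" using D_open x0_in by (meson open_contains_ball)
  note W' = holo_on_subset[OF W r(2)]
  define \<mu> where "\<mu> = exp (- (of_real s * \<omega>))"
  have mu: "cmod \<mu> \<le> 1" unfolding \<mu>_def using s \<omega> by simp
  have quad: "vanishes x0 2 (\<lambda>x. F s x - (x0 + \<mu> *\<^sub>C (x - x0)))"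
    using F_quadratic[OF s] unfolding \<mu>_def .
  have "vanishes x0 (Suc k) (\<lambda>x. (W (F s x) - W (x0 + \<mu> *\<^sub>C (x - x0))) + (W (x0 + \<mu> *\<^sub>C (x - x0)) - \<mu> ^ k *\<^sub>C W x))"
    by (intro vanishes_add vanishes_perturb[OF W' r(1) v mu quad] vanishes_scaling[OF W' r(1) v mu])
  then have 1: "vanishes x0 (Suc k) (\<lambda>x. exp (- (s *\<^sub>R B0)) * (W (F s x) - \<mu> ^ k *\<^sub>C W x))"
    by (intro vanishes_bounded_linear[OF bounded_linear_mult_right]) simp
  have "vanishes x0 (Suc k + 0) (\<lambda>x. exp (- (s *\<^sub>R B0)) * (W (F s x) - \<mu> ^ k *\<^sub>C W x) * \<Gamma> s x)"
    by (intro vanishes_mult 1 vanishes_0 holo_on_isCont[OF \<Gamma>_holo[OF s] x0_in])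
  moreover have "vanishes x0 (k + 1) (\<lambda>x. (\<mu> ^ k *\<^sub>C exp (- (s *\<^sub>R B0))) * (W x * (\<Gamma> s x - exp (s *\<^sub>R B0))))"
    using s r \<Gamma>_x0[OF s]
    by (intro vanishes_bounded_linear[OF bounded_linear_mult_right] vanishes_mult v vanishes_1[OF _ r(1)]
        holo_on_diff holo_on_const holo_on_subset[OF \<Gamma>_holo r(2)]) simp_all
  ultimately have "vanishes x0 (Suc k) (\<lambda>x. exp (- (s *\<^sub>R B0)) * (W (F s x) - \<mu> ^ k *\<^sub>C W x) * \<Gamma> s x
      + (\<mu> ^ k *\<^sub>C exp (- (s *\<^sub>R B0))) * (W x * (\<Gamma> s x - exp (s *\<^sub>R B0))))"
    by (intro vanishes_add) simp_all
  moreover have "exp (- (s *\<^sub>R B0)) * (W (F s x) - \<mu> ^ k *\<^sub>C W x) * \<Gamma> s x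
      + (\<mu> ^ k *\<^sub>C exp (- (s *\<^sub>R B0))) * (W x * (\<Gamma> s x - exp (s *\<^sub>R B0)))
      = transfer s W x - W x + homological \<omega> B0 s k (W x)" for x
    unfolding transfer_def homological_def \<mu>_def[symmetric]
    by (simp add: algebra_simps cscale_mult_left cscale_mult_right cscale_diff_right)
  ultimately show ?thesis by simp
qed

end

text \<open>One time step \<open>\<tau>\<close> for which the homological operators of low order are invertible, while
  high order of vanishing beats the growth of the conjugation by \<open>exp (\<tau> B0)\<close>.\<close>
locale transfer_step = generated_semicocycle D F f x0 \<omega> \<Gamma> B B0
  for D :: "'x::cbanach set" and F f x0 \<omega> and \<Gamma> :: "real \<Rightarrow> 'x \<Rightarrow> 'a::cbanach_algebra_1" and B B0 +
  fixes m :: nat and \<tau> :: real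
  assumes \<omega>_pos: "Re \<omega> > 0" and m_pos: "m > 0" and \<tau>_pos: "\<tau> > 0"
    and m_large: "2 * norm B0 < real m * Re \<omega>"
    and hom_iso: "\<And>k. k \<ge> 1 \<Longrightarrow> k < m \<Longrightarrow> bounded_iso (homological \<omega> B0 \<tau> k)"
begin

text \<open>Adding \<open>P\<close> changes the residual \<open>E\<close> by minus the homological
  operator applied to \<open>P\<close>, up to one more order, so \<open>P = R E\<close> cancels it.
  The residual is 0 at \<open>x0\<close>, hence the normalization survives.\<close>

lemma approximate_fixed_point:
  assumes "k < m"
  shows "\<exists>N. holo_on D N \<and> N x0 = 1 \<and> vanishes x0 (Suc k) (\<lambda>x. transfer \<tau> N x - N x)"
  using assms
proof (induction k)
  case 0
  obtain r where r: "r > 0" "ball x0 r \<subseteq> D" using D_open x0_in by (meson open_contains_ball)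
  have "holo_on D (\<lambda>x. transfer \<tau> (\<lambda>x. 1) x - 1)"
    using \<tau>_pos by (intro holo_on_diff transfer_holo holo_on_const) simp
  then have "vanishes x0 1 (\<lambda>x. transfer \<tau> (\<lambda>x. 1) x - 1)"
    using \<tau>_pos by (intro vanishes_1[OF holo_on_subset[OF _ r(2)] r(1)]) (simp_all add: transfer_x0)
  then show ?case using holo_on_const by (intro exI[of _ "\<lambda>x. 1"]) simp
next
  case (Suc k)
  then obtain N where N: "holo_on D N" "N x0 = 1" "vanishes x0 (Suc k) (\<lambda>x. transfer \<tau> N x - N x)" by auto
  define E where "E = (\<lambda>x. transfer \<tau> N x - N x)"
  have E: "holo_on D E" "vanishes x0 (Suc k) E"
    unfolding E_def using N \<tau>_pos by (auto intro!: holo_on_diff transfer_holo)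
  have "bounded_iso (homological \<omega> B0 \<tau> (Suc k))" using hom_iso Suc.prems by simp
  then obtain R where R: "clinear_bounded R" "\<And>y. homological \<omega> B0 \<tau> (Suc k) (R y) = y"
    using bounded_iso_inverse clinear_bounded_homological by metis
  have blR: "bounded_linear R" using R(1) unfolding clinear_bounded_def by blast
  define P where "P = (\<lambda>x. R (E x))"
  have P: "holo_on D P" "vanishes x0 (Suc k) P"
    unfolding P_def by (rule holo_on_clinear_compose[OF R(1) E(1)], rule vanishes_bounded_linear[OF blR E(2)])
  have "E x0 = 0" unfolding E_def using \<tau>_pos N by (simp add: transfer_x0)
  then have "P x0 = 0" unfolding P_def using blR by (simp add: linear_simps)
  moreover have "vanishes x0 (Suc (Suc k)) (\<lambda>x. transfer \<tau> P x - P x + homological \<omega> B0 \<tau> (Suc k) (P x))"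
    using \<tau>_pos by (intro transfer_leading_term P \<omega>_pos) simp
  then have "vanishes x0 (Suc (Suc k)) (\<lambda>x. transfer \<tau> (\<lambda>x. N x + P x) x - (N x + P x))"
    unfolding transfer_add P_def R(2) unfolding E_def by (simp add: algebra_simps)
  ultimately show ?case using N P
    by (intro exI[of _ "\<lambda>x. N x + P x"]) (simp add: holo_on_add)
qed

text \<open>For a fixed point the residual is 0, so the leading-term lemma bounds the homological
  operator applied to \<open>W\<close> by one more order; its bounded inverse hands this gain to
  \<open>W\<close> itself.\<close>

lemma fixed_point_vanishes:
  assumes W: "holo_on D W" "\<And>x. x \<in> D \<Longrightarrow> transfer \<tau> W x = W x" "W x0 = 0" and "k < m"
  shows "vanishes x0 (Suc k) W"
  using \<open>k < m\<close>
proof (induction k)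
  case 0
  obtain r where r: "r > 0" "ball x0 r \<subseteq> D" using D_open x0_in by (meson open_contains_ball)
  show ?case using vanishes_1[OF holo_on_subset[OF W(1) r(2)] r(1) W(3)] by simp
next
  case (Suc k)
  obtain r where r: "r > 0" "ball x0 r \<subseteq> D" using D_open x0_in by (meson open_contains_ball)
  have "bounded_iso (homological \<omega> B0 \<tau> (Suc k))" using hom_iso Suc.prems by simp
  then obtain R where R: "clinear_bounded R" "\<And>x. R (homological \<omega> B0 \<tau> (Suc k) x) = x"
    using bounded_iso_inverse clinear_bounded_homological by metis
  have "vanishes x0 (Suc (Suc k)) (\<lambda>x. transfer \<tau> W x - W x + homological \<omega> B0 \<tau> (Suc k) (W x))"
    using \<tau>_pos Suc by (intro transfer_leading_term W \<omega>_pos) auto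
  then have "vanishes x0 (Suc (Suc k)) (\<lambda>x. homological \<omega> B0 \<tau> (Suc k) (W x))"
    by (rule vanishes_cong[OF _ r(1)]) (use W(2) r(2) in auto)
  from vanishes_bounded_linear[OF _ this, of R] show ?case
    using R unfolding clinear_bounded_def by simp
qed

text \<open>Near \<open>x0\<close> every step multiplies the bound by \<open>q\<close>. Points near
  an arbitrary \<open>x\<close> first reach that neighbourhood in a common number \<open>j\<close>
  of steps, by uniform convergence of the flow, and the factors met on the way enter the constant
  \<open>C\<close>.\<close>

lemma transfer_iterate_decay:
  assumes E: "holo_on D E" "vanishes x0 m E" and x: "x \<in> D"
  obtains \<rho> C q j where "\<rho> > 0" "ball x \<rho> \<subseteq> D" "0 \<le> q" "q < 1"
    "\<And>y n. y \<in> ball x \<rho> \<Longrightarrow> norm (transfer (real (n + j) * \<tau>) E y) \<le> C * q ^ n"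
proof -
  define \<mu> where "\<mu> = exp (- (of_real \<tau> * \<omega>))"
  define c where "c = exp (\<tau> *\<^sub>R B0)"
  define c' where "c' = exp (- (\<tau> *\<^sub>R B0))"
  have mu: "cmod \<mu> < 1" unfolding \<mu>_def using \<tau>_pos \<omega>_pos by simp
  \<comment> \<open>The zeros mark where \<open>\<epsilon>\<close> will enter: the inequality is
    strict by \<open>m_large\<close>, so it persists for small positive
    \<open>\<epsilon>\<close>.\<close>
  have q0: "norm c' * (norm c + 0) * (cmod \<mu> + 0) ^ m < 1"
  proof -
    have "norm c' * norm c * cmod \<mu> ^ m \<le> exp (\<tau> * norm B0) * exp (\<tau> * norm B0) * exp (- (\<tau> * Re \<omega>)) ^ m"
      using norm_exp[of "\<tau> *\<^sub>R B0"] norm_exp[of "- (\<tau> *\<^sub>R B0)"] \<tau>_pos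
      unfolding c_def c'_def \<mu>_def by (intro mult_mono) auto
    also have "\<dots> = exp (- \<tau> * (real m * Re \<omega> - 2 * norm B0))"
      by (simp add: exp_add[symmetric] exp_of_nat_mult[symmetric] algebra_simps)
    also have "\<dots> < 1" using \<tau>_pos m_large by simp
    finally show ?thesis by simp
  qed
  have "((\<lambda>e. norm c' * (norm c + e) * (cmod \<mu> + e) ^ m) \<longlongrightarrow> norm c' * (norm c + 0) * (cmod \<mu> + 0) ^ m) (at_right 0)"
    by (intro tendsto_intros)
  then have "\<forall>\<^sub>F e in at_right 0. norm c' * (norm c + e) * (cmod \<mu> + e) ^ m < 1"
    using q0 by (rule order_tendstoD)
  moreover have "((\<lambda>e. cmod \<mu> + e) \<longlongrightarrow> cmod \<mu> + 0) (at_right 0)" by (intro tendsto_intros)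
  then have "\<forall>\<^sub>F e in at_right 0. cmod \<mu> + e < 1" by (rule order_tendstoD) (use mu in simp)
  moreover have "\<forall>\<^sub>F e::real in at_right 0. e > 0" by (simp add: eventually_at_right_less)
  ultimately have "\<forall>\<^sub>F e in at_right 0. e > 0 \<and> cmod \<mu> + e < 1 \<and> norm c' * (norm c + e) * (cmod \<mu> + e) ^ m < 1"
    by eventually_elim blast
  then obtain \<epsilon> where \<epsilon>: "\<epsilon> > 0" "cmod \<mu> + \<epsilon> < 1" "norm c' * (norm c + \<epsilon>) * (cmod \<mu> + \<epsilon>) ^ m < 1"
    using eventually_happens'[OF trivial_limit_at_right_real] by blast
  define q where "q = norm c' * (norm c + \<epsilon>) * (cmod \<mu> + \<epsilon>) ^ m"
  have q: "0 \<le> q" "q < 1" unfolding q_def using \<epsilon> by auto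
  obtain K d1 where K: "K > 0" "d1 > 0" "\<And>y. y \<in> ball x0 d1 \<Longrightarrow> norm (E y) \<le> K * norm (y - x0) ^ m"
    using vanishesE[OF E(2) zero_less_one] by metis
  obtain C d2 where C: "C > 0" "d2 > 0"
    "\<And>y. y \<in> ball x0 d2 \<Longrightarrow> norm (F \<tau> y - (x0 + \<mu> *\<^sub>C (y - x0))) \<le> C * norm (y - x0) ^ 2"
    using vanishesE[OF F_quadratic zero_less_one] \<tau>_pos unfolding \<mu>_def by (metis less_imp_le)
  obtain d3 where d3: "d3 > 0" "\<And>y. dist y x0 < d3 \<Longrightarrow> dist (\<Gamma> \<tau> y) (\<Gamma> \<tau> x0) < \<epsilon>"
    using holo_on_isCont[OF \<Gamma>_holo x0_in, of \<tau>] \<tau>_pos \<epsilon>(1) unfolding continuous_at_eps_delta by (metis less_imp_le)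
  obtain d4 where d4: "d4 > 0" "ball x0 d4 \<subseteq> D" using D_open x0_in by (meson open_contains_ball)
  \<comment> \<open>The cap \<open>\<epsilon> / C\<close> turns the quadratic error of
    \<open>F \<tau>\<close> into at most \<open>\<epsilon> * norm (y - x0)\<close>.\<close>
  define \<delta> where "\<delta> = min (min d1 d2) (min (min d3 d4) (\<epsilon> / C))"
  have \<delta>: "\<delta> > 0" "\<delta> \<le> d1" "\<delta> \<le> d2" "\<delta> \<le> d3" "\<delta> \<le> d4" "\<delta> \<le> \<epsilon> / C"
    unfolding \<delta>_def using K C d3 d4 \<epsilon> by auto
  have \<delta>D: "ball x0 \<delta> \<subseteq> D" using d4 \<delta> subset_ball[of \<delta> d4 x0] by blast
  have contract: "norm (F \<tau> y - x0) \<le> (cmod \<mu> + \<epsilon>) * norm (y - x0)" if y: "y \<in> ball x0 \<delta>" for y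
  proof -
    have ny: "norm (y - x0) < \<delta>" using y by (simp add: dist_norm norm_minus_commute)
    have "norm (F \<tau> y - (x0 + \<mu> *\<^sub>C (y - x0))) \<le> C * norm (y - x0) * norm (y - x0)"
      using C(3)[of y] y \<delta> by (simp add: power2_eq_square mult.assoc)
    also have "\<dots> \<le> \<epsilon> * norm (y - x0)"
    proof (intro mult_right_mono norm_ge_zero)
      have "C * norm (y - x0) \<le> C * (\<epsilon> / C)" using ny \<delta> C by (intro mult_left_mono) auto
      then show "C * norm (y - x0) \<le> \<epsilon>" using C by simp
    qed
    finally have "norm (F \<tau> y - (x0 + \<mu> *\<^sub>C (y - x0))) \<le> \<epsilon> * norm (y - x0)" .
    moreover have "norm (F \<tau> y - x0) \<le> norm (F \<tau> y - (x0 + \<mu> *\<^sub>C (y - x0))) + norm (\<mu> *\<^sub>C (y - x0))"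
      using norm_triangle_ineq[of "F \<tau> y - (x0 + \<mu> *\<^sub>C (y - x0))" "\<mu> *\<^sub>C (y - x0)"] by simp
    ultimately show ?thesis by (simp add: norm_cscale distrib_right)
  qed
  have \<Gamma>b: "norm (\<Gamma> \<tau> y) \<le> norm c + \<epsilon>" if y: "y \<in> ball x0 \<delta>" for y
  proof -
    have "dist (\<Gamma> \<tau> y) (\<Gamma> \<tau> x0) < \<epsilon>" using y \<delta> by (intro d3) (simp add: dist_commute)
    then show ?thesis using \<Gamma>_x0[of \<tau>] \<tau>_pos norm_triangle_ineq2[of "\<Gamma> \<tau> y" c]
      by (simp add: dist_norm c_def)
  qed
  \<comment> \<open>The induction varies \<open>y\<close>: each step evaluates the previous iterate
    at \<open>F \<tau> y\<close>, which the contraction keeps in the ball.\<close>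
  have local: "norm (transfer (real n * \<tau>) E y) \<le> K * q ^ n * norm (y - x0) ^ m" if "y \<in> ball x0 \<delta>" for n y
    using that
  proof (induction n arbitrary: y)
    case 0
    then have "y \<in> D" using \<delta>D by blast
    then show ?case using K(3)[of y] 0 \<delta> by (simp add: transfer_zero)
  next
    case (Suc n)
    have yD: "y \<in> D" using Suc.prems \<delta>D by blast
    have "norm (F \<tau> y - x0) \<le> 1 * norm (y - x0)"
      using contract[OF Suc.prems] \<epsilon> mult_right_mono[of "cmod \<mu> + \<epsilon>" 1 "norm (y - x0)"] by simp
    then have Fy: "F \<tau> y \<in> ball x0 \<delta>" using Suc.prems by (simp add: dist_norm norm_minus_commute)
    have "transfer (real (Suc n) * \<tau>) E y = transfer \<tau> (transfer (real n * \<tau>) E) y"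
      using transfer_transfer[of \<tau> "real n * \<tau>" y E] yD \<tau>_pos by (simp add: algebra_simps)
    also have "norm \<dots> \<le> norm c' * norm (transfer (real n * \<tau>) E (F \<tau> y)) * norm (\<Gamma> \<tau> y)"
      unfolding transfer_def[of \<tau> "transfer (real n * \<tau>) E"] c'_def[symmetric]
      by (intro order_trans[OF norm_mult_ineq] mult_right_mono norm_mult_ineq norm_ge_zero)
    also have "\<dots> \<le> norm c' * (K * q ^ n * ((cmod \<mu> + \<epsilon>) * norm (y - x0)) ^ m) * (norm c + \<epsilon>)"
    proof (intro mult_mono order_refl \<Gamma>b Suc.prems)
      have "norm (transfer (real n * \<tau>) E (F \<tau> y)) \<le> K * q ^ n * norm (F \<tau> y - x0) ^ m"
        by (rule Suc.IH[OF Fy])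
      also have "\<dots> \<le> K * q ^ n * ((cmod \<mu> + \<epsilon>) * norm (y - x0)) ^ m"
        using contract[OF Suc.prems] K q by (intro mult_left_mono power_mono) auto
      finally show "norm (transfer (real n * \<tau>) E (F \<tau> y)) \<le> K * q ^ n * ((cmod \<mu> + \<epsilon>) * norm (y - x0)) ^ m" .
    qed (use K q \<epsilon> in auto)
    also have "\<dots> = K * q ^ Suc n * norm (y - x0) ^ m"
      unfolding q_def by (simp add: power_mult_distrib mult_ac)
    finally show ?case .
  qed
  obtain r where r: "r > 0" "ball x (2 * r) \<subseteq> D" "strictly_inside (ball x r) D"
    using strictly_inside_ball[OF x zero_less_one] by metis
  obtain T where T: "\<And>t y. t \<ge> T \<Longrightarrow> y \<in> ball x r \<Longrightarrow> dist (F t y) x0 < \<delta>"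
    using F_conv[OF r(3) \<delta>(1)] by blast
  \<comment> \<open>The entry time is rounded up to whole steps so that it becomes an index
    shift.\<close>
  obtain j where j: "real j \<ge> T / \<tau>" using real_arch_simple by blast
  define t where "t = real j * \<tau>"
  have t: "t \<ge> T" "t \<ge> 0" unfolding t_def using j \<tau>_pos by (auto simp: field_simps)
  obtain d where d: "d > 0" "\<And>y. dist y x < d \<Longrightarrow> dist (\<Gamma> t y) (\<Gamma> t x) < 1"
    using holo_on_isCont[OF \<Gamma>_holo[OF t(2)] x] unfolding continuous_at_eps_delta by (metis zero_less_one)
  define \<rho> where "\<rho> = min r d"
  have \<rho>: "\<rho> > 0" "\<rho> \<le> r" "\<rho> \<le> d" unfolding \<rho>_def using r d by auto
  have \<rho>D: "ball x \<rho> \<subseteq> D" using r \<rho> subset_ball[of \<rho> "2 * r" x] by auto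
  show ?thesis
  proof (rule that[OF \<rho>(1) \<rho>D q])
    fix y n assume y: "y \<in> ball x \<rho>"
    have yD: "y \<in> D" using y \<rho>D by blast
    have "dist (F t y) x0 < \<delta>" using y \<rho> t by (intro T) auto
    then have Fy: "F t y \<in> ball x0 \<delta>" by (simp add: dist_commute)
    have "dist (\<Gamma> t y) (\<Gamma> t x) < 1" using y \<rho> by (intro d) (simp add: dist_commute)
    then have \<Gamma>y: "norm (\<Gamma> t y) \<le> norm (\<Gamma> t x) + 1"
      using norm_triangle_ineq2[of "\<Gamma> t y" "\<Gamma> t x"] by (simp add: dist_norm)
    have "norm (transfer (real n * \<tau>) E (F t y)) \<le> K * q ^ n * norm (F t y - x0) ^ m" by (rule local[OF Fy])
    also have "\<dots> \<le> K * q ^ n * \<delta> ^ m"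
      using Fy K q by (intro mult_left_mono power_mono) (auto simp: dist_norm norm_minus_commute)
    finally have step: "norm (transfer (real n * \<tau>) E (F t y)) \<le> K * q ^ n * \<delta> ^ m" .
    have "transfer (real (n + j) * \<tau>) E y = transfer t (transfer (real n * \<tau>) E) y"
      using transfer_transfer[of t "real n * \<tau>" y E] yD \<tau>_pos t by (simp add: t_def algebra_simps)
    also have "norm \<dots> \<le> norm (exp (- (t *\<^sub>R B0))) * norm (transfer (real n * \<tau>) E (F t y)) * norm (\<Gamma> t y)"
      unfolding transfer_def[of t "transfer (real n * \<tau>) E"]
      by (intro order_trans[OF norm_mult_ineq] mult_right_mono norm_mult_ineq norm_ge_zero)
    also have "\<dots> \<le> norm (exp (- (t *\<^sub>R B0))) * (K * q ^ n * \<delta> ^ m) * (norm (\<Gamma> t x) + 1)"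
      using step \<Gamma>y K q \<delta> by (intro mult_mono order_refl) auto
    finally show "norm (transfer (real (n + j) * \<tau>) E y)
        \<le> norm (exp (- (t *\<^sub>R B0))) * K * \<delta> ^ m * (norm (\<Gamma> t x) + 1) * q ^ n"
      by (simp add: mult_ac)
  qed
qed

lemma transfer_iterate_fixed:
  assumes "\<And>x. x \<in> D \<Longrightarrow> transfer \<tau> W x = W x" "x \<in> D"
  shows "transfer (real n * \<tau>) W x = W x"
  using assms(2)
proof (induction n arbitrary: x)
  case 0
  then show ?case by (simp add: transfer_zero)
next
  case (Suc n)
  have "transfer (real (Suc n) * \<tau>) W x = transfer \<tau> (transfer (real n * \<tau>) W) x"
    using transfer_transfer[of \<tau> "real n * \<tau>" x W] Suc.prems \<tau>_pos by (simp add: algebra_simps)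
  also have "\<dots> = transfer \<tau> W x" using Suc \<tau>_pos by (intro transfer_cong) auto
  finally show ?case using assms(1) Suc.prems by simp
qed

text \<open>A fixed point equals all its iterates, and these decay to 0. This serves twice: for
  uniqueness, and to pass from the step \<open>\<tau>\<close> to arbitrary times.\<close>

lemma fixed_point_zero:
  assumes W: "holo_on D W" "\<And>x. x \<in> D \<Longrightarrow> transfer \<tau> W x = W x" "W x0 = 0" and x: "x \<in> D"
  shows "W x = 0"
proof -
  have "vanishes x0 m W" using fixed_point_vanishes[OF W, of "m - 1"] m_pos by simp
  from transfer_iterate_decay[OF W(1) this x] obtain \<rho> C q j where
    \<rho>: "\<rho> > 0" and q: "0 \<le> q" "q < 1"
    and b: "\<And>y n. y \<in> ball x \<rho> \<Longrightarrow> norm (transfer (real (n + j) * \<tau>) W y) \<le> C * q ^ n" by metis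
  have "norm (W x) \<le> C * q ^ n" for n
    using b[of x n] \<rho> transfer_iterate_fixed[OF W(2) x, of "n + j"] by simp
  moreover have "(\<lambda>n. C * q ^ n) \<longlonglongrightarrow> C * 0"
    using q by (intro tendsto_mult tendsto_const LIMSEQ_realpow_zero)
  ultimately have "norm (W x) \<le> C * 0" by (intro LIMSEQ_le_const) auto
  then show ?thesis by simp
qed

text \<open>The iterates of an approximate fixed point are partial sums of its iterated residuals,
  which decay geometrically and uniformly near each point; the local uniformity keeps the limit
  holomorphic.\<close>

lemma fixed_point_exists:
  "\<exists>M. holo_on D M \<and> M x0 = 1 \<and> (\<forall>x\<in>D. transfer \<tau> M x = M x)"
proof -
  obtain N where N: "holo_on D N" "N x0 = 1" "vanishes x0 m (\<lambda>x. transfer \<tau> N x - N x)"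
    using approximate_fixed_point[of "m - 1"] m_pos by auto
  define E where "E = (\<lambda>x. transfer \<tau> N x - N x)"
  have E: "holo_on D E" "vanishes x0 m E"
    unfolding E_def using N \<tau>_pos by (auto intro!: holo_on_diff transfer_holo)
  define A where "A n = transfer (real n * \<tau>) N" for n
  have A_holo: "holo_on D (A n)" for n unfolding A_def using N \<tau>_pos by (intro transfer_holo) auto
  have A_Suc: "A (Suc n) x = transfer \<tau> (A n) x" if "x \<in> D" for n x
    unfolding A_def using transfer_transfer[of \<tau> "real n * \<tau>" x N] that \<tau>_pos by (simp add: algebra_simps)
  have A_diff: "A (Suc n) x - A n x = transfer (real n * \<tau>) E x" if "x \<in> D" for n x
    unfolding E_def transfer_diff A_def
    using transfer_transfer[of "real n * \<tau>" \<tau> x N] that \<tau>_pos by (simp add: algebra_simps)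
  have A_sum: "A (n + j) x = A j x + (\<Sum>i<n. transfer (real (i + j) * \<tau>) E x)" if "x \<in> D" for n j x
    by (induction n) (use A_diff[OF that] in \<open>auto simp: algebra_simps\<close>)
  define M where "M x = lim (\<lambda>n. A n x)" for x
  \<comment> \<open>The shift \<open>j\<close> depends on \<open>x\<close>, so uniform convergence
    is stated for shifted sequences; \<open>M\<close>, being the pointwise limit, is independent of
    the chosen ball.\<close>
  have conv: "\<exists>\<rho>>0. \<exists>j. ball x \<rho> \<subseteq> D \<and> uniform_limit (ball x \<rho>) (\<lambda>n. A (n + j)) M sequentially" if x: "x \<in> D" for x
  proof -
    obtain \<rho> C q j where \<rho>: "\<rho> > 0" "ball x \<rho> \<subseteq> D" and q: "0 \<le> q" "q < 1"
      and b: "\<And>y n. y \<in> ball x \<rho> \<Longrightarrow> norm (transfer (real (n + j) * \<tau>) E y) \<le> C * q ^ n"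
      using transfer_iterate_decay[OF E x] by metis
    have "uniform_limit (ball x \<rho>) (\<lambda>n y. \<Sum>i<n. transfer (real (i + j) * \<tau>) E y)
        (\<lambda>y. \<Sum>i. transfer (real (i + j) * \<tau>) E y) sequentially"
      by (rule Weierstrass_m_test[OF b]) (use q in \<open>auto intro: summable_mult summable_geometric\<close>)
    then have "uniform_limit (ball x \<rho>) (\<lambda>n y. A j y + (\<Sum>i<n. transfer (real (i + j) * \<tau>) E y))
        (\<lambda>y. A j y + (\<Sum>i. transfer (real (i + j) * \<tau>) E y)) sequentially"
      by (intro uniform_limit_add uniform_limit_const)
    then have ul: "uniform_limit (ball x \<rho>) (\<lambda>n. A (n + j)) (\<lambda>y. A j y + (\<Sum>i. transfer (real (i + j) * \<tau>) E y)) sequentially"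
      by (rule uniform_limit_cong'[THEN iffD1, rotated -1]) (use \<rho>(2) in \<open>auto simp: A_sum\<close>)
    have "M y = A j y + (\<Sum>i. transfer (real (i + j) * \<tau>) E y)" if "y \<in> ball x \<rho>" for y
    proof -
      have "(\<lambda>n. A (n + j) y) \<longlonglongrightarrow> A j y + (\<Sum>i. transfer (real (i + j) * \<tau>) E y)"
        using tendsto_uniform_limitI[OF ul that] .
      then have "(\<lambda>n. A n y) \<longlonglongrightarrow> A j y + (\<Sum>i. transfer (real (i + j) * \<tau>) E y)"
        by (rule LIMSEQ_offset)
      then show ?thesis unfolding M_def by (rule limI)
    qed
    then have "uniform_limit (ball x \<rho>) (\<lambda>n. A (n + j)) M sequentially"
      using ul unfolding uniform_limit_iff by simp
    then show ?thesis using \<rho> by blast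
  qed
  have lim: "(\<lambda>n. A n x) \<longlonglongrightarrow> M x" if x: "x \<in> D" for x
  proof -
    obtain \<rho> j where "\<rho> > 0" "uniform_limit (ball x \<rho>) (\<lambda>n. A (n + j)) M sequentially" using conv[OF x] by blast
    then have "(\<lambda>n. A (n + j) x) \<longlonglongrightarrow> M x" by (intro tendsto_uniform_limitI) auto
    then show ?thesis by (rule LIMSEQ_offset)
  qed
  have "holo_on D M"
    unfolding holo_on_def
  proof
    fix x assume "x \<in> D"
    from conv[OF this] obtain \<rho> j where \<rho>: "\<rho> > 0" "ball x \<rho> \<subseteq> D"
      "uniform_limit (ball x \<rho>) (\<lambda>n. A (n + j)) M sequentially" by blast
    show "\<exists>L. (M has_derivative L) (at x) \<and> clinear_bounded L"
      by (rule holo_uniform_limit[OF holo_on_subset[OF A_holo \<rho>(2)] \<rho>(3,1)])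
  qed
  moreover have "M x0 = 1"
  proof (rule LIMSEQ_unique[OF lim[OF x0_in]])
    have "A n x0 = 1" for n unfolding A_def using \<tau>_pos N by (simp add: transfer_x0)
    then show "(\<lambda>n. A n x0) \<longlonglongrightarrow> 1" by simp
  qed
  moreover have "transfer \<tau> M x = M x" if x: "x \<in> D" for x
  proof (rule LIMSEQ_unique)
    have Fx: "F \<tau> x \<in> D" using F_in x \<tau>_pos by simp
    show "(\<lambda>n. transfer \<tau> (A n) x) \<longlonglongrightarrow> transfer \<tau> M x"
      unfolding transfer_def by (intro tendsto_intros lim Fx)
    have "(\<lambda>n. A (Suc n) x) \<longlonglongrightarrow> M x" using lim[OF x] by (rule LIMSEQ_Suc)
    then show "(\<lambda>n. transfer \<tau> (A n) x) \<longlonglongrightarrow> M x" using A_Suc[OF x] by simp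
  qed
  ultimately show ?thesis by blast
qed

end

section \<open>From one time step to all times\<close>

context generated_semicocycle
begin

lemma linearizes_iff_fixed:
  assumes inv: "\<And>x. x \<in> D \<Longrightarrow> invertible_el (M x)" and t: "t \<ge> 0" and x: "x \<in> D"
  shows "\<Gamma> t x = ainv (M (F t x)) * exp (t *\<^sub>R B0) * M x \<longleftrightarrow> transfer t M x = M x"
proof -
  note e = exp_minus_inverse[of "t *\<^sub>R B0"] exp_minus_inverse[of "- (t *\<^sub>R B0)"]
  note i = ainv[OF inv[OF F_in[OF t x]]]
  show ?thesis
  proof
    assume "\<Gamma> t x = ainv (M (F t x)) * exp (t *\<^sub>R B0) * M x"
    then have "transfer t M x = exp (- (t *\<^sub>R B0)) * (M (F t x) * ainv (M (F t x))) * exp (t *\<^sub>R B0) * M x"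
      unfolding transfer_def by (simp add: mult.assoc)
    then show "transfer t M x = M x" using e i by simp
  next
    assume fixed: "transfer t M x = M x"
    have "ainv (M (F t x)) * exp (t *\<^sub>R B0) * transfer t M x
        = ainv (M (F t x)) * ((exp (t *\<^sub>R B0) * exp (- (t *\<^sub>R B0))) * M (F t x)) * \<Gamma> t x"
      unfolding transfer_def by (simp add: mult.assoc)
    then show "\<Gamma> t x = ainv (M (F t x)) * exp (t *\<^sub>R B0) * M x" using e i fixed by simp
  qed
qed

lemma transfer_step_exists:
  assumes \<omega>: "Re \<omega> > 0"
    and nonres: "\<And>k::nat. k \<ge> 1 \<Longrightarrow> of_nat k * \<omega> \<notin> {z - w | z w. z \<in> spec B0 \<and> w \<in> spec B0}"
  obtains m \<tau> where "transfer_step D F f x0 \<omega> \<Gamma> B B0 m \<tau>"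
proof -
  obtain m where m: "real m > 2 * norm B0 / Re \<omega>" using reals_Archimedean2 by blast
  have "2 * norm B0 / Re \<omega> \<ge> 0" using \<omega> by simp
  then have m0: "m > 0" using m by (cases m) auto
  have "\<forall>\<^sub>F \<tau> in at_right 0. \<forall>k\<in>{1..<m}. bounded_iso (homological \<omega> B0 \<tau> k)"
    by (intro eventually_ball_finite ballI homological_bounded_iso nonres) auto
  moreover have "\<forall>\<^sub>F \<tau>::real in at_right 0. \<tau> > 0" by (simp add: eventually_at_right_less)
  ultimately have "\<forall>\<^sub>F \<tau> in at_right 0. \<tau> > 0 \<and> (\<forall>k\<in>{1..<m}. bounded_iso (homological \<omega> B0 \<tau> k))"
    by eventually_elim blast
  then obtain \<tau> where \<tau>: "\<tau> > 0" "\<And>k. k \<in> {1..<m} \<Longrightarrow> bounded_iso (homological \<omega> B0 \<tau> k)"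
    using eventually_happens'[OF trivial_limit_at_right_real] by blast
  have "transfer_step D F f x0 \<omega> \<Gamma> B B0 m \<tau>"
    by unfold_locales (use \<omega> m m0 \<tau> in \<open>auto simp: field_simps\<close>)
  then show ?thesis by (rule that)
qed

text \<open>Once the orbit of \<open>x\<close> is close to \<open>x0\<close>, the value of
  \<open>M\<close> there is close to the unit. The fixed-point equation writes \<open>M x\<close> as
  this value between two invertible factors.\<close>

lemma fixed_point_invertible:
  assumes M: "holo_on D M" "M x0 = 1" "\<And>s x. s \<ge> 0 \<Longrightarrow> x \<in> D \<Longrightarrow> transfer s M x = M x" and x: "x \<in> D"
  shows "invertible_el (M x)"
proof -
  obtain d where d: "d > 0" "\<And>y. dist y x0 < d \<Longrightarrow> dist (M y) (M x0) < 1"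
    using holo_on_isCont[OF M(1) x0_in] unfolding continuous_at_eps_delta by (metis zero_less_one)
  have "strictly_inside {x} D"
    using D_open x unfolding strictly_inside_def by (simp add: open_contains_ball)
  then obtain T where T: "\<And>t. t \<ge> T \<Longrightarrow> dist (F t x) x0 < d" using F_conv d(1) by blast
  define s where "s = max T 0"
  have s: "s \<ge> T" "s \<ge> 0" unfolding s_def by auto
  have "dist (M (F s x)) 1 < 1" using d(2)[OF T[OF s(1)]] M(2) by simp
  then have "invertible_el (M (F s x))"
    by (intro neumann) (simp add: dist_norm norm_minus_commute)
  then have "invertible_el (transfer s M x)"
    unfolding transfer_def by (intro invertible_el_mult invertible_el_exp \<Gamma>_invertible s x)
  then show ?thesis using M(3)[OF s(2) x] by simp
qed

lemma linearization_exists: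
  assumes step: "transfer_step D F f x0 \<omega> \<Gamma> B B0 m \<tau>"
  shows "\<exists>M. holo_on D M \<and> (\<forall>x\<in>D. invertible_el (M x)) \<and>
    (\<forall>t\<ge>0. \<forall>x\<in>D. \<Gamma> t x = ainv (M (F t x)) * exp (t *\<^sub>R B0) * M x)"
proof -
  interpret step: transfer_step D F f x0 \<omega> \<Gamma> B B0 m \<tau> by (rule step)
  obtain M where M: "holo_on D M" "M x0 = 1" "\<And>x. x \<in> D \<Longrightarrow> transfer \<tau> M x = M x"
    using step.fixed_point_exists by blast
  have fixed: "transfer s M x = M x" if s: "s \<ge> 0" and x: "x \<in> D" for s x
  proof -
    define W where "W = (\<lambda>x. transfer s M x - M x)"
    have "W x = 0"
    proof (rule step.fixed_point_zero[OF _ _ _ x])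
      show "holo_on D W" unfolding W_def by (intro holo_on_diff transfer_holo s M)
      show "W x0 = 0" unfolding W_def using s M by (simp add: transfer_x0)
      fix y assume y: "y \<in> D"
      \<comment> \<open>Both sides are the transfer of \<open>M\<close> by the time
        \<open>s + \<tau>\<close>.\<close>
      have "transfer \<tau> (transfer s M) y = transfer s (transfer \<tau> M) y"
        using transfer_transfer[of \<tau> s y M] transfer_transfer[of s \<tau> y M] y s step.\<tau>_pos
        by (simp add: add.commute)
      also have "\<dots> = transfer s M y" using s y M(3) by (intro transfer_cong)
      finally show "transfer \<tau> W y = W y" unfolding W_def transfer_diff using M(3)[OF y] by simp
    qed
    then show ?thesis unfolding W_def by simp
  qed
  have inv: "invertible_el (M x)" if "x \<in> D" for x
    by (rule fixed_point_invertible[OF M(1,2) fixed that])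
  have "\<Gamma> t x = ainv (M (F t x)) * exp (t *\<^sub>R B0) * M x" if "t \<ge> 0" "x \<in> D" for t x
    using linearizes_iff_fixed[of M t x] inv fixed that by simp
  then show ?thesis using M(1) inv by (intro exI[of _ M]) simp
qed

lemma linearization_unique:
  assumes step: "transfer_step D F f x0 \<omega> \<Gamma> B B0 m \<tau>"
    and M1: "holo_on D M1" "\<And>x. x \<in> D \<Longrightarrow> invertible_el (M1 x)"
      "\<And>t x. t \<ge> 0 \<Longrightarrow> x \<in> D \<Longrightarrow> \<Gamma> t x = ainv (M1 (F t x)) * exp (t *\<^sub>R B0) * M1 x"
    and M2: "holo_on D M2" "\<And>x. x \<in> D \<Longrightarrow> invertible_el (M2 x)"
      "\<And>t x. t \<ge> 0 \<Longrightarrow> x \<in> D \<Longrightarrow> \<Gamma> t x = ainv (M2 (F t x)) * exp (t *\<^sub>R B0) * M2 x"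
    and eq: "M1 x0 = M2 x0" and x: "x \<in> D"
  shows "M1 x = M2 x"
proof -
  interpret step: transfer_step D F f x0 \<omega> \<Gamma> B B0 m \<tau> by (rule step)
  have \<tau>: "\<tau> \<ge> 0" using step.\<tau>_pos by simp
  have "M1 x - M2 x = 0"
  proof (rule step.fixed_point_zero[OF _ _ _ x])
    show "holo_on D (\<lambda>x. M1 x - M2 x)" by (intro holo_on_diff M1 M2)
    show "M1 x0 - M2 x0 = 0" using eq by simp
    fix y assume y: "y \<in> D"
    have "transfer \<tau> M1 y = M1 y" using linearizes_iff_fixed[of M1 \<tau> y, OF M1(2) \<tau> y] M1(3)[OF \<tau> y] by blast
    moreover have "transfer \<tau> M2 y = M2 y" using linearizes_iff_fixed[of M2 \<tau> y, OF M2(2) \<tau> y] M2(3)[OF \<tau> y] by blast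
    ultimately show "transfer \<tau> (\<lambda>x. M1 x - M2 x) y = M1 y - M2 y" unfolding transfer_diff by simp
  qed
  then show ?thesis by simp
qed

end

theorem theorem4p10:
  fixes D :: "'x::cbanach set"
    and F :: "real \<Rightarrow> 'x \<Rightarrow> 'x"
    and f :: "'x \<Rightarrow> 'x"
    and x0 :: 'x
    and f' :: "'x \<Rightarrow>\<^sub>L 'x"
    and \<omega> :: complex
    and \<Gamma> :: "real \<Rightarrow> 'x \<Rightarrow> 'a::cbanach_algebra_1"
    and B :: "'x \<Rightarrow> 'a"
    and B0 :: 'a
  assumes D_open: "open D" and D_conn: "connected D" and D_ne: "D \<noteq> {}"
    \<comment> \<open>semigroup of holomorphic self-maps\<close>
    and F_holo: "\<And>t. t \<ge> 0 \<Longrightarrow> holo_on D (F t)"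
    and F_self: "\<And>t. t \<ge> 0 \<Longrightarrow> F t ` D \<subseteq> D"
    and F_zero: "\<And>x. x \<in> D \<Longrightarrow> F 0 x = x"
    and F_semigroup: "\<And>t s x. t \<ge> 0 \<Longrightarrow> s \<ge> 0 \<Longrightarrow> x \<in> D \<Longrightarrow> F (t + s) x = F t (F s x)"
    and F_cont0: "\<And>x. x \<in> D \<Longrightarrow> ((\<lambda>t. F t x) \<longlongrightarrow> x) (at_right 0)"
    \<comment> \<open>condition (*)\<close>
    and x0_in: "x0 \<in> D"
    and F_conv: "\<And>S e. strictly_inside S D \<Longrightarrow> e > 0 \<Longrightarrow>
                   \<exists>T. \<forall>t\<ge>T. \<forall>x\<in>S. dist (F t x) x0 < e"
    and f_holo: "holo_on D f"
    and f_gen: "\<And>S e. strictly_inside S D \<Longrightarrow> e > 0 \<Longrightarrow>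
                   \<exists>\<delta>>0. \<forall>t. 0 < t \<and> t < \<delta> \<longrightarrow>
                      (\<forall>x\<in>S. norm ((1 / t) *\<^sub>R (F t x - x) - f x) < e)"
    and f_deriv: "(f has_derivative blinfun_apply f') (at x0)"
    and kappa_neg: "kappa_plus f' < 0"
    \<comment> \<open>f'(x0) = - omega Id\<close>
    and f'_eq: "\<And>h. blinfun_apply f' h = (- \<omega>) *\<^sub>C h"
    \<comment> \<open>semicocycle generated by B\<close>
    and \<Gamma>_holo: "\<And>t. t \<ge> 0 \<Longrightarrow> holo_on D (\<Gamma> t)"
    and \<Gamma>_cocycle: "\<And>t s x. t \<ge> 0 \<Longrightarrow> s \<ge> 0 \<Longrightarrow> x \<in> D \<Longrightarrow>
                      \<Gamma> (t + s) x = \<Gamma> t (F s x) * \<Gamma> s x"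
    and \<Gamma>_cont0: "\<And>x. x \<in> D \<Longrightarrow> ((\<lambda>t. \<Gamma> t x) \<longlongrightarrow> 1) (at_right 0)"
    and B_holo: "holo_on D B"
    and \<Gamma>_gen: "\<And>x t. x \<in> D \<Longrightarrow> t \<ge> 0 \<Longrightarrow>
                   ((\<lambda>s. \<Gamma> s x) has_vector_derivative (B (F t x) * \<Gamma> t x)) (at t within {0..})"
    and \<Gamma>_zero: "\<And>x. x \<in> D \<Longrightarrow> \<Gamma> 0 x = 1"
    and B0_def: "B0 = B x0"
    \<comment> \<open>non-resonance\<close>
    and nonres: "\<And>k::nat. k \<ge> 1 \<Longrightarrow>
                   of_nat k * \<omega> \<notin> {z - w | z w. z \<in> spec B0 \<and> w \<in> spec B0}"
  shows "(\<exists>M :: 'x \<Rightarrow> 'a. holo_on D M \<and> (\<forall>x\<in>D. invertible_el (M x)) \<and>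
            (\<forall>t\<ge>0. \<forall>x\<in>D. \<Gamma> t x = ainv (M (F t x)) * exp (t *\<^sub>R B0) * M x))
       \<and> (\<forall>M1 M2 :: 'x \<Rightarrow> 'a.
            (holo_on D M1 \<and> (\<forall>x\<in>D. invertible_el (M1 x)) \<and>
             (\<forall>t\<ge>0. \<forall>x\<in>D. \<Gamma> t x = ainv (M1 (F t x)) * exp (t *\<^sub>R B0) * M1 x) \<and> M1 x0 = 1) \<and>
            (holo_on D M2 \<and> (\<forall>x\<in>D. invertible_el (M2 x)) \<and>
             (\<forall>t\<ge>0. \<forall>x\<in>D. \<Gamma> t x = ainv (M2 (F t x)) * exp (t *\<^sub>R B0) * M2 x) \<and> M2 x0 = 1)
            \<longrightarrow> (\<forall>x\<in>D. M1 x = M2 x))"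
proof -
  have f_deriv': "(f has_derivative (\<lambda>h. (- \<omega>) *\<^sub>C h)) (at x0)"
    using f_deriv by (simp add: f'_eq[abs_def])
  interpret generated_semicocycle D F f x0 \<omega> \<Gamma> B B0
    by unfold_locales ((rule D_open F_holo F_self F_zero F_semigroup x0_in F_conv f_holo f_gen f_deriv'
        \<Gamma>_holo \<Gamma>_cocycle B_holo \<Gamma>_gen \<Gamma>_zero B0_def; assumption)+)
  show ?thesis
  \<comment> \<open>In the zero space the growth condition says nothing about
    \<open>Re \<omega>\<close>, but there \<open>D\<close> is a single point and the constant map 1
    linearizes.\<close>
  proof (cases "\<exists>v::'x. v \<noteq> 0")
    case True
    then have "Re \<omega> > 0" using kappa_plus_scalar[OF f'_eq kappa_neg] by blast
    then obtain m \<tau> where step: "transfer_step D F f x0 \<omega> \<Gamma> B B0 m \<tau>"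
      using transfer_step_exists nonres by blast
    show ?thesis
    proof (intro conjI allI impI ballI)
      fix M1 M2 :: "'x \<Rightarrow> 'a" and x
      assume M: "(holo_on D M1 \<and> (\<forall>x\<in>D. invertible_el (M1 x)) \<and>
             (\<forall>t\<ge>0. \<forall>x\<in>D. \<Gamma> t x = ainv (M1 (F t x)) * exp (t *\<^sub>R B0) * M1 x) \<and> M1 x0 = 1) \<and>
            (holo_on D M2 \<and> (\<forall>x\<in>D. invertible_el (M2 x)) \<and>
             (\<forall>t\<ge>0. \<forall>x\<in>D. \<Gamma> t x = ainv (M2 (F t x)) * exp (t *\<^sub>R B0) * M2 x) \<and> M2 x0 = 1)"
        and x: "x \<in> D"
      show "M1 x = M2 x"
        by (rule linearization_unique[OF step _ _ _ _ _ _ _ x]) (use M in auto)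
    qed (rule linearization_exists[OF step])
  next
    case False
    then have triv: "x = y" for x y :: 'x by metis
    have "\<Gamma> t x = ainv 1 * exp (t *\<^sub>R B0) * 1" if "t \<ge> 0" for t x
      using \<Gamma>_x0[OF that] triv[of x x0] ainv_unique[of 1 "1::'a"] by simp
    then have "holo_on D (\<lambda>x. 1::'a) \<and> (\<forall>x\<in>D. invertible_el (1::'a)) \<and>
        (\<forall>t\<ge>0. \<forall>x\<in>D. \<Gamma> t x = ainv 1 * exp (t *\<^sub>R B0) * 1)"
      using holo_on_const invertible_elI[of 1 "1::'a"] by auto
    moreover have "M1 x = M2 x" if "M1 x0 = 1" "M2 x0 = 1" for M1 M2 :: "'x \<Rightarrow> 'a" and x
      using that triv[of x x0] by simp
    ultimately show ?thesis by (intro conjI exI[of _ "\<lambda>x. 1"]) auto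
  qed
qed

end
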